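(* Let $p\ne2$ be a prime, let $n$ be a positive integer with $p\nmid n$, and let $e\ge1$ be an integer. Then the number of pairs of integers $(x,y)$ with $1\le x,y\le p^e(p-1)$, $p\nmid x$, $p\nmid y$ satisfying $$x^{x^n}\equiv y\pmod{p^e}\quad\text{and}\quad y^{y^n}\equiv x\pmod{p^e}$$ is $$\sum_{x_0=1}^{p-1}\sum_{y_0=1}^{p-1}\gcd(p-1,x_0^ny_0^n-1) +\sum_{x_0=1}^{p-1}\sum_{y_0=1}^{p-1}\gcd\bigl(p-1,n(y_0^n+1),x_0^ny_0^n-1\bigr)\cdot\left(p^{\lfloor e/2\rfloor}-1\right)$$ $$+\sum_{x_0=1}^{p-1}\sum_{y_0=1}^{p-1}\Bigl(\gcd(p-1,2n,x_0^ny_0^n-1)-\gcd(p-1,n,x_0^ny_0^n-1)\Bigr)\cdot\left(p^{\lfloor e/3\rfloor+\lfloor (e+1)/3\rfloor}-p^{\lfloor e/2\rfloor}\right)$$ $$=\sum_{d\mid p-1}\phi(d)^2\left(\frac{p-1}{d}\right)^2N_{z^n-1}(d) +\sum_{d\mid p-1}\phi(d)\left(\frac{p-1}{d}\right)^2\mathcal{N}_{n(z^n+1)}(d)\,N_{z^n-1}(d)\cdot\left(p^{\lfloor e/2\rfloor}-1\right)$$ $$+\sum_{\substack{d\mid\gcd(p-1,2n)\\ d\nmid\gcd(p-1,n)}}\phi(d)^2\left(\frac{p-1}{d}\right)^2N_{z^n-1}(d)\cdot\left(p^{\lfloor e/3\rfloor+\lfloor (e+1)/3\rfloor}-p^{\lfloor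 e/2\rfloor}\right).$$ However, the number of $(x,y,x_0,y_0)\in\mathbb{Z}_p^2\times\{1,\dots,p-1\}^2$ with $p\nmid x$, $p\nmid y$ satisfying $$\omega(x)^{x_0^n}\langle x\rangle^{x^n}=y\quad\text{and}\quad\omega(y)^{y_0^n}\langle y\rangle^{y^n}=x$$ is only $$\sum_{x_0=1}^{p-1}\sum_{y_0=1}^{p-1}\gcd(p-1,x_0^ny_0^n-1)=\sum_{d\mid p-1}\phi(d)^2\left(\frac{p-1}{d}\right)^2N_{z^n-1}(d).$$
   Context: Here $p$ is an odd prime. $\mathbb{Z}_p$ is the ring of $p$-adic integers, $\phi$ the Euler phi function. For $x\in\mathbb{Z}_p^\times$, $\omega(x)$ is the Teichmüller representative of $x$ (the unique $(p-1)$-th root of unity in $\mathbb{Z}_p$ congruent to $x$ modulo $p$), and $\langle x\rangle=x/\omega(x)\in 1+p\mathbb{Z}_p$; for $w\in\mathbb{Z}_p$, $\langle x\rangle^{w}=\exp(w\log\langle x\rangle)$. For a positive integer $d$, $N_{z^n-1}(d)$ is the number of $z\in\mathbb{Z}/d\mathbb{Z}$ with $z^n-1\equiv0\pmod d$, and $\mathcal{N}_{n(z^n+1)}(d)$ is the number of $z\in\mathbb{Z}/d\mathbb{Z}$ with $z$ relatively prime to $d$ and $n(z^n+1)\equiv0\pmod d$. Convention: $\gcd$ with $0$ as one argument ignores that argument, e.g. $\gcd(m,0)=m$. *)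

theory Defs
  imports
    "HOL-Number_Theory.Cong"
    "HOL-Number_Theory.Totient"
    "HOL-Algebra.Ring"
    "HOL-Algebra.Divisibility"
begin

text \<open>
  The ring of \<open>p\<close>-adic integers as the inverse limit of the rings \<open>\<int>/p\<^sup>k\<int>\<close>: the \<open>k\<close>-th
  component of an element is its residue modulo \<open>p\<^sup>k\<close>, taken in \<open>{0..<p\<^sup>k}\<close>.
\<close>

definition Zp :: "nat \<Rightarrow> (nat \<Rightarrow> int) ring" where
  "Zp p =
    \<lparr>carrier = {x. \<forall>k. 0 \<le> x k \<and> x k < int p ^ k \<and> x (Suc k) mod int p ^ k = x k},
     mult = (\<lambda>x y k. (x k * y k) mod int p ^ k),
     one = (\<lambda>k. 1 mod int p ^ k),
     zero = (\<lambda>k. 0),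
     add = (\<lambda>x y k. (x k + y k) mod int p ^ k)\<rparr>"

lemma cring_Zp:
  assumes "p > 0"
  shows "cring (Zp p)"
proof -
  have pos: "0 < int p ^ k" for k
    using assms by simp
  have coh: "a mod int p ^ Suc k mod int p ^ k = a mod int p ^ k" for a :: int and k
    by (intro mod_mod_cancel) simp
  have comp: "x k mod int p ^ k = x k" "x (Suc k) mod int p ^ k = x k"
    if "x \<in> carrier (Zp p)" for x k
    using that by (auto simp: Zp_def)
  have red: "(\<lambda>k. f k mod int p ^ k) \<in> carrier (Zp p)"
    if "\<And>k. f (Suc k) mod int p ^ k = f k mod int p ^ k" for f
    using that pos coh by (simp add: Zp_def)
  have add: "x \<oplus>\<^bsub>Zp p\<^esub> y \<in> carrier (Zp p)" and mult: "x \<otimes>\<^bsub>Zp p\<^esub> y \<in> carrier (Zp p)"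
    if "x \<in> carrier (Zp p)" "y \<in> carrier (Zp p)" for x y
  proof -
    have "(\<lambda>k. (x k + y k) mod int p ^ k) \<in> carrier (Zp p)"
      by (rule red) (metis comp(2) mod_add_eq mod_mod_trivial that)
    moreover have "(\<lambda>k. (x k * y k) mod int p ^ k) \<in> carrier (Zp p)"
      by (rule red) (metis comp(2) mod_mult_eq mod_mod_trivial that)
    ultimately show "x \<oplus>\<^bsub>Zp p\<^esub> y \<in> carrier (Zp p)" "x \<otimes>\<^bsub>Zp p\<^esub> y \<in> carrier (Zp p)"
      by (simp_all add: Zp_def)
  qed
  have one: "\<one>\<^bsub>Zp p\<^esub> \<in> carrier (Zp p)"
    using red[of "\<lambda>_. 1"] by (simp add: Zp_def)
  have zero: "\<zero>\<^bsub>Zp p\<^esub> \<in> carrier (Zp p)"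
    using pos by (simp add: Zp_def)
  have neg: "\<exists>y \<in> carrier (Zp p). y \<oplus>\<^bsub>Zp p\<^esub> x = \<zero>\<^bsub>Zp p\<^esub>" if "x \<in> carrier (Zp p)" for x
  proof
    show "(\<lambda>k. (- x k) mod int p ^ k) \<in> carrier (Zp p)"
      by (rule red) (metis comp(2) mod_minus_eq that)
    show "(\<lambda>k. (- x k) mod int p ^ k) \<oplus>\<^bsub>Zp p\<^esub> x = \<zero>\<^bsub>Zp p\<^esub>"
      by (simp add: Zp_def fun_eq_iff mod_add_left_eq)
  qed
  show ?thesis
  proof (rule cringI)
    show "abelian_group (Zp p)"
    proof (rule abelian_groupI)
      fix x y z assume "x \<in> carrier (Zp p)" "y \<in> carrier (Zp p)" "z \<in> carrier (Zp p)"
      show "x \<oplus>\<^bsub>Zp p\<^esub> y \<oplus>\<^bsub>Zp p\<^esub> z = x \<oplus>\<^bsub>Zp p\<^esub> (y \<oplus>\<^bsub>Zp p\<^esub> z)"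
        by (simp add: Zp_def fun_eq_iff mod_add_left_eq mod_add_right_eq add.assoc)
    next
      fix x assume "x \<in> carrier (Zp p)"
      then show "\<zero>\<^bsub>Zp p\<^esub> \<oplus>\<^bsub>Zp p\<^esub> x = x"
        using comp(1)[of x] by (simp add: Zp_def fun_eq_iff)
    qed (use add zero neg in \<open>auto simp: Zp_def add.commute\<close>)
    show "comm_monoid (Zp p)"
    proof (rule comm_monoidI)
      fix x y z assume "x \<in> carrier (Zp p)" "y \<in> carrier (Zp p)" "z \<in> carrier (Zp p)"
      show "x \<otimes>\<^bsub>Zp p\<^esub> y \<otimes>\<^bsub>Zp p\<^esub> z = x \<otimes>\<^bsub>Zp p\<^esub> (y \<otimes>\<^bsub>Zp p\<^esub> z)"
        by (simp add: Zp_def fun_eq_iff mod_mult_left_eq mod_mult_right_eq mult.assoc)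
    next
      fix x assume "x \<in> carrier (Zp p)"
      then show "\<one>\<^bsub>Zp p\<^esub> \<otimes>\<^bsub>Zp p\<^esub> x = x"
        using comp(1)[of x] by (simp add: Zp_def fun_eq_iff mod_mult_left_eq)
    qed (use mult one in \<open>auto simp: Zp_def mult.commute\<close>)
    fix x y z assume "x \<in> carrier (Zp p)" "y \<in> carrier (Zp p)" "z \<in> carrier (Zp p)"
    show "(x \<oplus>\<^bsub>Zp p\<^esub> y) \<otimes>\<^bsub>Zp p\<^esub> z = x \<otimes>\<^bsub>Zp p\<^esub> z \<oplus>\<^bsub>Zp p\<^esub> y \<otimes>\<^bsub>Zp p\<^esub> z"
      by (simp add: Zp_def fun_eq_iff mod_mult_left_eq mod_add_eq distrib_right)
  qed
qed

definition p_dvd :: "nat \<Rightarrow> (nat \<Rightarrow> int) \<Rightarrow> bool" where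
  "p_dvd p x \<longleftrightarrow> ([p] \<cdot>\<^bsub>Zp p\<^esub> \<one>\<^bsub>Zp p\<^esub>) divides\<^bsub>Zp p\<^esub> x"

definition teichmueller :: "nat \<Rightarrow> (nat \<Rightarrow> int) \<Rightarrow> (nat \<Rightarrow> int)" where
  "teichmueller p x =
    (THE w. w \<in> carrier (Zp p) \<and> w [^]\<^bsub>Zp p\<^esub> (p - 1) = \<one>\<^bsub>Zp p\<^esub> \<and> p_dvd p (w \<ominus>\<^bsub>Zp p\<^esub> x))"

definition one_unit_part :: "nat \<Rightarrow> (nat \<Rightarrow> int) \<Rightarrow> (nat \<Rightarrow> int)" where
  "one_unit_part p x = x \<otimes>\<^bsub>Zp p\<^esub> inv\<^bsub>Zp p\<^esub> (teichmueller p x)"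

text \<open>
  Convergence of a series in the \<open>p\<close>-adic topology: for every \<open>m\<close> the partial sums are eventually
  congruent to the limit modulo \<open>p\<^sup>m\<close>, i.e. agree with it in the \<open>m\<close>-th component.
\<close>

definition padic_sums :: "nat \<Rightarrow> (nat \<Rightarrow> nat \<Rightarrow> int) \<Rightarrow> (nat \<Rightarrow> int) \<Rightarrow> bool" where
  "padic_sums p f s \<longleftrightarrow> s \<in> carrier (Zp p) \<and>
    (\<forall>m. \<forall>\<^sub>F N in sequentially. finsum (Zp p) f {..<N} m = s m)"

definition padic_suminf :: "nat \<Rightarrow> (nat \<Rightarrow> nat \<Rightarrow> int) \<Rightarrow> (nat \<Rightarrow> int)" where
  "padic_suminf p f = (THE s. padic_sums p f s)"

text \<open>
  The quotient \<open>a / k\<close> in the field \<open>\<rat>\<^sub>p\<close>, for the case that it lies in \<open>\<int>\<^sub>p\<close>.  This suffices for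
  the logarithm on \<open>1 + p\<int>\<^sub>p\<close> and the exponential on \<open>p\<int>\<^sub>p\<close> for odd \<open>p\<close>: if \<open>p\<close> divides \<open>u\<close>, all
  terms \<open>u\<^sup>k / k\<close> (with \<open>k \<ge> 1\<close>) and \<open>u\<^sup>k / k!\<close> are \<open>p\<close>-adic integers.
\<close>

definition padic_quot :: "nat \<Rightarrow> (nat \<Rightarrow> int) \<Rightarrow> nat \<Rightarrow> (nat \<Rightarrow> int)" where
  "padic_quot p a k = (THE s. s \<in> carrier (Zp p) \<and> [k] \<cdot>\<^bsub>Zp p\<^esub> s = a)"

text \<open>
  \<open>log x = \<Sum>\<^sub>k\<^sub>\<ge>\<^sub>1 (-1)\<^sup>k\<^sup>-\<^sup>1 (x - 1)\<^sup>k / k\<close>, with the index shifted by one, and \<open>exp u = \<Sum>\<^sub>k\<^sub>\<ge>\<^sub>0 u\<^sup>k / k!\<close>.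
\<close>

definition padic_log :: "nat \<Rightarrow> (nat \<Rightarrow> int) \<Rightarrow> (nat \<Rightarrow> int)" where
  "padic_log p x = padic_suminf p (\<lambda>k.
     (\<ominus>\<^bsub>Zp p\<^esub> \<one>\<^bsub>Zp p\<^esub>) [^]\<^bsub>Zp p\<^esub> k
       \<otimes>\<^bsub>Zp p\<^esub> padic_quot p ((x \<ominus>\<^bsub>Zp p\<^esub> \<one>\<^bsub>Zp p\<^esub>) [^]\<^bsub>Zp p\<^esub> Suc k) (Suc k))"

definition padic_exp :: "nat \<Rightarrow> (nat \<Rightarrow> int) \<Rightarrow> (nat \<Rightarrow> int)" where
  "padic_exp p u = padic_suminf p (\<lambda>k. padic_quot p (u [^]\<^bsub>Zp p\<^esub> k) (fact k))"

text \<open>The power \<open>\<langle>x\<rangle>\<^sup>w\<close> for a \<open>p\<close>-adic unit \<open>x\<close> and a \<open>p\<close>-adic integer \<open>w\<close>.\<close>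

definition one_unit_power :: "nat \<Rightarrow> (nat \<Rightarrow> int) \<Rightarrow> (nat \<Rightarrow> int) \<Rightarrow> (nat \<Rightarrow> int)" where
  "one_unit_power p x w = padic_exp p (w \<otimes>\<^bsub>Zp p\<^esub> padic_log p (one_unit_part p x))"

definition num_roots_mod :: "(int \<Rightarrow> int) \<Rightarrow> nat \<Rightarrow> nat" where
  "num_roots_mod f d = card {z \<in> {0..<int d}. [f z = 0] (mod int d)}"

definition num_unit_roots_mod :: "(int \<Rightarrow> int) \<Rightarrow> nat \<Rightarrow> nat" where
  "num_unit_roots_mod f d = card {z \<in> {0..<int d}. coprime z (int d) \<and> [f z = 0] (mod int d)}"

end

theory Submission
  imports Defs "HOL-Number_Theory.Residue_Primitive_Roots"
begin

text \<open>
  A 2-cycle \<open>(x, y)\<close> modulo \<open>p\<^sup>e\<close> is governed by the valuation of \<open>D = x\<^sup>p\<^sup>-\<^sup>1 - 1\<close>, which measures the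
  distance of \<open>x\<close> from the Teichmueller representative of its residue class.  By lifting the
  exponent, \<open>x\<^sup>K - 1\<close> has the valuation of \<open>K D\<close> whenever it is divisible by \<open>p\<close>
  (\<open>power_minus_1_equiv\<close>).  Eliminating \<open>y\<close> leaves \<open>x\<^sup>M\<^sup>-\<^sup>1 = 1\<close> with \<open>M = x\<^sup>n y\<^sup>n\<close>, hence a condition
  modulo \<open>p\<close> and \<open>p\<^sup>e dvd (M - 1) D\<close>.  As \<open>M\<close> is modulo \<open>p\<^sup>e\<close> the power of \<open>x\<close> with exponent \<open>n (1 + x\<^sup>n)\<close>, the
  factor \<open>M - 1\<close> is in turn a unit or has the valuation of \<open>(1 + x\<^sup>n) D\<close>, and \<open>1 + x\<^sup>n\<close> is again a
  unit or has the valuation of \<open>D\<close>.  So the condition is \<open>p\<^sup>e dvd D\<close>, \<open>p\<^sup>e dvd D\<^sup>2\<close> or \<open>p\<^sup>e dvd D\<^sup>3\<close>,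
  and which one holds depends only on \<open>x\<close> modulo \<open>p\<close> and modulo \<open>p - 1\<close> (\<open>two_cycle_iff\<close>).  This
  explains the three powers of \<open>p\<close> in the formula.

  The condition \<open>p\<^sup>s dvd D\<close> describes one residue class modulo \<open>p\<^sup>s\<close> above each unit modulo \<open>p\<close>.  It
  remains to count, for given \<open>x\<close> and \<open>y\<close> modulo \<open>p - 1\<close>, the units modulo \<open>p\<close> of each of the three
  kinds.  They are characterised by divisibility conditions on their orders, and in a cyclic group
  of order \<open>p - 1\<close> such conditions are counted by greatest common divisors
  (\<open>card_two_cycle_residues\<close>).  The sums over divisors arise by writing each greatest common divisor
  as the sum of \<open>\<phi>(d)\<close> over its divisors \<open>d\<close> (\<open>sum_gcd_eq_divisor_sum\<close>).

  For the \<open>p\<close>-adic equations the essential point is that \<open>exp (w log a)\<close> agrees modulo \<open>p\<^sup>j\<close> with \<open>a\<^sup>k\<close>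
  for every natural number \<open>k\<close> congruent to \<open>w\<close> modulo \<open>p\<^sup>j\<close> (\<open>exp_log_component\<close>).  A \<open>p\<close>-adic
  solution therefore yields a solution modulo every \<open>p\<^sup>e\<close>, so \<open>p\<^sup>e dvd D\<^sup>3\<close> for all \<open>e\<close>, and \<open>x\<close> is
  a root of unity.  Only the roots of unity survive, and they are counted by the first sum.
\<close>

section \<open>Lifting the exponent\<close>

locale odd_prime =
  fixes p :: nat
  assumes prime_p: "Factorial_Ring.prime p" and p_neq_2: "p \<noteq> 2"
begin

abbreviation P :: int where "P \<equiv> int p"

lemma prime_P: "Factorial_Ring.prime P"
  using prime_p by simp

lemma p_ge_3: "p \<ge> 3"
  using prime_ge_2_nat[OF prime_p] p_neq_2 by linarith

lemma odd_p: "odd p"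
  using prime_odd_nat[OF prime_p] p_ge_3 by simp

lemma dvd_mult_P: "P dvd a * b \<longleftrightarrow> P dvd a \<or> P dvd b"
  using prime_P by (rule prime_dvd_mult_iff)

lemma dvd_power_P: "P dvd a ^ k \<Longrightarrow> P dvd a"
  using prime_P prime_dvd_power by blast

lemma coprime_P_power: "\<not> P dvd c \<Longrightarrow> coprime (P ^ s) c"
  using prime_P by (simp add: prime_imp_coprime)

lemma not_dvd_below: "0 < a \<Longrightarrow> a < P \<Longrightarrow> \<not> P dvd a"
  using zdvd_imp_le by fastforce

lemma not_dvd_p_minus_1: "\<not> P dvd int (p - 1)"
  using p_ge_3 by (intro not_dvd_below) auto

text \<open>
  Association in the localisation \<open>\<int>\<^sub>(\<^sub>p\<^sub>)\<close>, that is, equality of \<open>p\<close>-adic valuations.  Unlike an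
  equation between multiplicities it makes no exception for \<open>0\<close>, which occurs here whenever a
  power happens to equal 1 exactly, and it is visibly compatible with products.
\<close>

definition equiv_val :: "int \<Rightarrow> int \<Rightarrow> bool" (infix "\<asymp>" 50) where
  "a \<asymp> b \<longleftrightarrow> (\<exists>c d. \<not> P dvd c \<and> \<not> P dvd d \<and> a * c = b * d)"

lemma equiv_val_refl: "a \<asymp> a"
  unfolding equiv_val_def using p_ge_3 by (intro exI[of _ 1]) auto

lemma equiv_val_sym: "a \<asymp> b \<Longrightarrow> b \<asymp> a"
  unfolding equiv_val_def by metis

lemma equiv_val_mult:
  assumes "a \<asymp> b" "a' \<asymp> b'"
  shows "a * a' \<asymp> b * b'"
proof -
  obtain c d where cd: "\<not> P dvd c" "\<not> P dvd d" "a * c = b * d"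
    using assms(1) by (auto simp: equiv_val_def)
  obtain c' d' where cd': "\<not> P dvd c'" "\<not> P dvd d'" "a' * c' = b' * d'"
    using assms(2) by (auto simp: equiv_val_def)
  have "(a * a') * (c * c') = (a * c) * (a' * c')" by (simp only: mult_ac)
  also have "\<dots> = (b * d) * (b' * d')" by (simp only: cd cd')
  also have "\<dots> = (b * b') * (d * d')" by (simp only: mult_ac)
  finally show ?thesis
    unfolding equiv_val_def using cd cd' dvd_mult_P by blast
qed

lemma equiv_val_trans [trans]:
  assumes "a \<asymp> b" "b \<asymp> c"
  shows "a \<asymp> c"
proof -
  obtain u v where uv: "\<not> P dvd u" "\<not> P dvd v" "a * u = b * v"
    using assms(1) by (auto simp: equiv_val_def)
  obtain u' v' where uv': "\<not> P dvd u'" "\<not> P dvd v'" "b * u' = c * v'"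
    using assms(2) by (auto simp: equiv_val_def)
  have "a * (u * u') = (a * u) * u'" by (simp only: mult_ac)
  also have "\<dots> = (b * u') * v" by (simp only: uv mult_ac)
  also have "\<dots> = c * (v * v')" by (simp only: uv' mult_ac)
  finally show ?thesis
    unfolding equiv_val_def using uv uv' dvd_mult_P by blast
qed

lemma equiv_val_unit: "\<not> P dvd u \<Longrightarrow> u * a \<asymp> a"
  unfolding equiv_val_def
  using p_ge_3 by (intro exI[of _ 1] exI[of _ u]) auto

lemma equiv_val_dvd_iff:
  assumes "a \<asymp> b"
  shows "P ^ s dvd a \<longleftrightarrow> P ^ s dvd b"
proof -
  obtain c d where "\<not> P dvd c" "\<not> P dvd d" "a * c = b * d"
    using assms by (auto simp: equiv_val_def)
  then show ?thesis
    using coprime_P_power[of c s] coprime_P_power[of d s]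
    by (metis coprime_dvd_mult_left_iff)
qed

text \<open>
  Writing \<open>x = y + p t\<close>, the cofactor \<open>\<Sum> x\<^sup>i y\<^sup>p\<^sup>-\<^sup>1\<^sup>-\<^sup>i\<close> of \<open>x - y\<close> is \<open>p y\<^sup>p\<^sup>-\<^sup>1\<close> plus
  \<open>p t y\<^sup>p\<^sup>-\<^sup>2 (0 + 1 + \<dots> + (p - 1))\<close> modulo \<open>p\<^sup>2\<close>.  The sum in brackets is a multiple of \<open>p\<close> exactly
  because \<open>p\<close> is odd, so the cofactor is \<open>p\<close> times a unit.
\<close>

lemma power_p_diff:
  fixes x y :: int
  assumes "[x = y] (mod P)" "\<not> P dvd y"
  shows "x ^ p - y ^ p \<asymp> P * (x - y)"
proof -
  define S where "S = (\<Sum>i<p. y ^ (p - Suc i) * x ^ i)"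
  obtain t where x: "x = y + P * t"
    using assms(1) by (metis cong_iff_lin cong_sym_eq)
  \<comment> \<open>The extra factor y avoids the exponent i - 1 in the linear term.\<close>
  have pow: "[y * x ^ i = y ^ i * (y + int i * (P * t))] (mod P ^ 2)" for i
  proof (induction i)
    case (Suc i)
    have "y * x ^ Suc i = (y * x ^ i) * (y + P * t)" by (simp add: x mult_ac)
    also have "[\<dots> = y ^ i * (y + int i * (P * t)) * (y + P * t)] (mod P ^ 2)"
      by (rule cong_mult[OF Suc cong_refl])
    also have "y ^ i * (y + int i * (P * t)) * (y + P * t)
        = y ^ Suc i * (y + int (Suc i) * (P * t)) + P ^ 2 * (y ^ i * int i * t ^ 2)"
      by (simp add: algebra_simps power2_eq_square)
    also have "[\<dots> = y ^ Suc i * (y + int (Suc i) * (P * t))] (mod P ^ 2)"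
      by (simp add: cong_def)
    finally show ?case .
  qed simp
  obtain h where h: "p = 2 * h + 1" using odd_p by (metis oddE)
  have gauss: "(\<Sum>i<p. int i) = P * int h"
  proof -
    have "2 * (\<Sum>i<p. int i) = P * (P - 1)"
      by (induction p) (auto simp: algebra_simps)
    also have "P - 1 = 2 * int h" using h by simp
    finally show ?thesis by simp
  qed
  have "y * S = (\<Sum>i<p. y ^ (p - Suc i) * (y * x ^ i))"
    by (simp add: S_def sum_distrib_left mult_ac)
  also have "[\<dots> = (\<Sum>i<p. y ^ (p - Suc i) * (y ^ i * (y + int i * (P * t))))] (mod P ^ 2)"
    by (intro cong_sum cong_mult pow cong_refl)
  also have "(\<Sum>i<p. y ^ (p - Suc i) * (y ^ i * (y + int i * (P * t))))
      = (\<Sum>i<p. y ^ (p - 1) * (y + int i * (P * t)))"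
  proof (rule sum.cong[OF refl])
    fix i assume "i \<in> {..<p}"
    then have "y ^ (p - Suc i) * y ^ i = y ^ (p - 1)" by (simp flip: power_add)
    then show "y ^ (p - Suc i) * (y ^ i * (y + int i * (P * t)))
        = y ^ (p - 1) * (y + int i * (P * t))"
      by (simp only: mult.assoc[symmetric])
  qed
  also have "\<dots> = y ^ (p - 1) * (P * y + (\<Sum>i<p. int i) * (P * t))"
    by (simp add: sum_distrib_left[symmetric] sum.distrib sum_distrib_right)
  also have "\<dots> = P * y ^ p + P ^ 2 * (y ^ (p - 1) * int h * t)"
    using p_ge_3 by (simp add: gauss algebra_simps power2_eq_square power_eq_if)
  also have "[\<dots> = P * y ^ p] (mod P ^ 2)" by (simp add: cong_def)
  finally have cS: "[y * S = P * y ^ p] (mod P ^ 2)" .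
  then have "P dvd y * S"
    by (metis cong_dvd_iff cong_dvd_modulus dvd_triv_left power2_eq_square)
  then obtain c where c: "S = P * c" using assms(2) dvd_mult_P by (auto elim: dvdE)
  have "\<not> P dvd c"
  proof
    assume "P dvd c"
    then have "P ^ 2 dvd y * S" by (auto simp: c power2_eq_square)
    then have "P ^ 2 dvd P * y ^ p" using cS by (metis cong_dvd_iff)
    then have "P dvd y ^ p" using p_ge_3 by (simp add: power2_eq_square)
    then show False using assms(2) dvd_power_P by blast
  qed
  moreover have "x ^ p - y ^ p = (x - y) * S" by (simp add: S_def power_diff_sumr2)
  ultimately show ?thesis
    unfolding equiv_val_def c using p_ge_3
    by (intro exI[of _ 1] exI[of _ c]) (auto simp: mult_ac)
qed

lemma power_diff_unit_exponent:
  fixes x y :: int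
  assumes "[x = y] (mod P)" "\<not> P dvd y" "\<not> p dvd M"
  shows "x ^ M - y ^ M \<asymp> x - y"
proof -
  define S where "S = (\<Sum>i<M. y ^ (M - Suc i) * x ^ i)"
  have "[S = (\<Sum>i<M. y ^ (M - Suc i) * y ^ i)] (mod P)"
    unfolding S_def by (intro cong_sum cong_mult cong_pow assms(1) cong_refl)
  also have "(\<Sum>i<M. y ^ (M - Suc i) * y ^ i) = (\<Sum>i<M. y ^ (M - 1))"
    by (intro sum.cong refl) (simp flip: power_add)
  also have "\<dots> = int M * y ^ (M - 1)" by simp
  finally have "\<not> P dvd S"
    using assms(2,3) dvd_mult_P dvd_power_P by (metis cong_dvd_iff int_dvd_int_iff)
  moreover have "x ^ M - y ^ M = (x - y) * S" by (simp add: S_def power_diff_sumr2)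
  ultimately show ?thesis by (metis equiv_val_unit mult.commute)
qed

text \<open>
  Split off one prime factor \<open>p\<close> of the exponent at a time; the part prime to \<open>p\<close> does not change
  the valuation.
\<close>

lemma lifting_the_exponent:
  fixes x y :: int
  assumes "[x = y] (mod P)" "\<not> P dvd y"
  shows "x ^ M - y ^ M \<asymp> int M * (x - y)"
proof (induction M rule: less_induct)
  case (less M)
  consider "M = 0" | "\<not> p dvd M" | M' where "M = p * M'" "M' < M"
    using p_ge_3 by (cases "M = 0"; cases "p dvd M") (auto elim!: dvdE)
  then show ?case
  proof cases
    case 1
    then show ?thesis by (simp add: equiv_val_refl)
  next
    case 2
    then have "int M * (x - y) \<asymp> x - y" by (intro equiv_val_unit) simp
    with power_diff_unit_exponent[OF assms 2] show ?thesis
      using equiv_val_sym equiv_val_trans by blast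
  next
    case 3
    have "[x ^ M' = y ^ M'] (mod P)" "\<not> P dvd y ^ M'"
      using assms dvd_power_P by (auto intro: cong_pow)
    then have "(x ^ M') ^ p - (y ^ M') ^ p \<asymp> P * (x ^ M' - y ^ M')"
      by (rule power_p_diff)
    also have "\<dots> \<asymp> P * (int M' * (x - y))"
      by (intro equiv_val_mult equiv_val_refl less.IH 3)
    finally show ?thesis
      by (simp add: 3 power_mult[symmetric] mult_ac)
  qed
qed

lemma fermat_P: "\<not> P dvd x \<Longrightarrow> [x ^ (p - 1) = 1] (mod P)"
proof -
  assume x: "\<not> P dvd x"
  define r where "r = nat (x mod P)"
  have r: "int r = x mod P" using p_ge_3 by (simp add: r_def)
  then have "\<not> p dvd r" using x by (metis dvd_mod_iff dvd_refl int_dvd_int_iff)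
  then have "[r ^ (p - 1) = 1] (mod p)" by (intro fermat_theorem prime_p)
  then have "[int r ^ (p - 1) = 1] (mod P)" by (metis cong_int_iff of_nat_1 of_nat_power)
  then show ?thesis by (simp add: r cong_def power_mod)
qed

text \<open>
  For \<open>x\<close> prime to \<open>p\<close>, the valuation of this number measures how close \<open>x\<close> is to the
  \<open>(p - 1)\<close>-th root of unity in its residue class modulo \<open>p\<close>; in terms of the \<open>p\<close>-adic logarithm it is
  the valuation of \<open>log \<langle>x\<rangle>\<close>.
\<close>

definition unit_defect :: "int \<Rightarrow> int" where
  "unit_defect x = x ^ (p - 1) - 1"

text \<open>
  Both sides have the valuation of \<open>x ^ (K (p - 1)) - 1\<close>: this power can be read as the \<open>(p - 1)\<close>-th power
  of \<open>x\<^sup>K\<close>, which is congruent to 1, or as the \<open>K\<close>-th power of \<open>x\<^sup>p\<^sup>-\<^sup>1\<close>.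
\<close>

lemma power_minus_1_equiv:
  assumes "\<not> P dvd x" "P dvd x ^ K - 1"
  shows "x ^ K - 1 \<asymp> int K * unit_defect x"
proof -
  have np1: "\<not> P dvd 1" using p_ge_3 by auto
  have "x ^ K - 1 \<asymp> int (p - 1) * (x ^ K - 1)"
    by (rule equiv_val_sym[OF equiv_val_unit[OF not_dvd_p_minus_1]])
  also have "\<dots> \<asymp> (x ^ K) ^ (p - 1) - 1 ^ (p - 1)"
    using assms by (intro equiv_val_sym[OF lifting_the_exponent] np1) (auto simp: cong_iff_dvd_diff)
  also have "\<dots> = (x ^ (p - 1)) ^ K - 1 ^ K" by (simp add: power_mult[symmetric] mult.commute)
  also have "\<dots> \<asymp> int K * (x ^ (p - 1) - 1)"
    using fermat_P[OF assms(1)] by (intro lifting_the_exponent np1)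
  finally show ?thesis by (simp add: unit_defect_def)
qed

end

section \<open>The 2-cycle condition modulo a prime power\<close>

context odd_prime
begin

lemma power_dvd_power_iff_ceiling:
  assumes "j > 0"
  shows "P ^ e dvd d ^ j \<longleftrightarrow> P ^ ((e + j - 1) div j) dvd d"
proof (cases "d = 0")
  case True
  then show ?thesis using assms by (simp add: zero_power)
next
  case False
  have nu: "\<not> is_unit P" using p_ge_3 by auto
  have "P ^ e dvd d ^ j \<longleftrightarrow> e \<le> j * multiplicity P d"
    using False nu prime_P
    by (simp add: power_dvd_iff_le_multiplicity prime_elem_multiplicity_power_distrib)
  also have "\<dots> \<longleftrightarrow> (e + j - 1) div j \<le> multiplicity P d"
  proof
    assume "e \<le> j * multiplicity P d"
    then have "e + j - 1 < j * Suc (multiplicity P d)" using assms by simp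
    then show "(e + j - 1) div j \<le> multiplicity P d"
      by (metis less_mult_imp_div_less less_Suc_eq_le mult.commute)
  next
    assume le: "(e + j - 1) div j \<le> multiplicity P d"
    have "e + j - 1 < j * Suc ((e + j - 1) div j)" using assms
      by (metis dividend_less_times_div mult_Suc_right add.commute)
    also have "\<dots> \<le> j * Suc (multiplicity P d)" using le by (intro mult_le_mono2) simp
    finally show "e \<le> j * multiplicity P d" by simp
  qed
  also have "\<dots> \<longleftrightarrow> P ^ ((e + j - 1) div j) dvd d"
    using False nu by (simp add: power_dvd_iff_le_multiplicity)
  finally show ?thesis .
qed

text \<open>
  With \<open>k\<close> standing for \<open>x\<^sup>n\<close> modulo \<open>p - 1\<close> and \<open>D\<close> for \<open>unit_defect x\<close>, the condition for a 2-cycle turns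
  out to be \<open>p\<^sup>e dvd D\<close>, \<open>p\<^sup>e dvd D\<^sup>2\<close> or \<open>p\<^sup>e dvd D\<^sup>3\<close>, depending on the residue \<open>r\<close> of \<open>x\<close> modulo \<open>p\<close>.
  The level is the exponent \<open>s\<close> for which this condition reads \<open>p\<^sup>s dvd D\<close>, hence \<open>e\<close>, \<open>e/2\<close> or
  \<open>e/3\<close>, rounded up.
\<close>

definition defect_level :: "nat \<Rightarrow> nat \<Rightarrow> nat \<Rightarrow> nat \<Rightarrow> nat" where
  "defect_level n e r k =
    (if \<not> [r ^ (n + n * k) = 1] (mod p) then e
     else if [int r ^ n = -1] (mod P) then (e + 2) div 3
     else (e + 1) div 2)"

lemma cong_1_iff_P_dvd: "[r ^ k = 1] (mod p) \<longleftrightarrow> P dvd int r ^ k - 1"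
  by (metis cong_iff_dvd_diff cong_int_iff of_nat_1 of_nat_power)

text \<open>
  If \<open>x ^ (n (1 + x ^ n))\<close> is 1 modulo \<open>p\<close>, then its difference to 1 is associated to
  \<open>n (1 + x\<^sup>n) D\<close> by \<open>power_minus_1_equiv\<close>; here \<open>n\<close> is a unit.  The factor
  \<open>1 + x\<^sup>n\<close> is a unit unless \<open>x\<^sup>n\<close> is \<open>-1\<close> modulo \<open>p\<close>; in that case it is associated to \<open>x\<^sup>2\<^sup>n - 1\<close>, which contributes one more \<open>D\<close>.
\<close>

lemma defect_times_power_minus_1:
  assumes n: "\<not> p dvd n" and x: "\<not> P dvd int x"
  shows "P ^ e dvd (int x ^ (n + n * x ^ n) - 1) * unit_defect (int x)
    \<longleftrightarrow> P ^ defect_level n e x (x ^ n) dvd unit_defect (int x)"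
proof -
  define u where "u = int x"
  define K where "K = n + n * x ^ n"
  define D where "D = unit_defect u"
  note u = x[folded u_def]
  have K: "int K = int n * (1 + u ^ n)" by (simp add: K_def u_def algebra_simps)
  have n': "\<not> P dvd int n" using n by simp
  have goal: "P ^ e dvd (u ^ K - 1) * D \<longleftrightarrow> P ^ defect_level n e x (x ^ n) dvd D"
  proof (cases "P dvd u ^ K - 1")
    case False
    then have "(u ^ K - 1) * D \<asymp> D" by (rule equiv_val_unit)
    then show ?thesis
      using False by (simp add: equiv_val_dvd_iff defect_level_def cong_1_iff_P_dvd[unfolded One_nat_def] K_def u_def)
  next
    case True
    have "(u ^ K - 1) * D \<asymp> int K * D * D"
      unfolding D_def by (intro equiv_val_mult power_minus_1_equiv equiv_val_refl u True)
    also have "\<dots> = int n * ((1 + u ^ n) * D ^ 2)"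
      by (simp add: K power2_eq_square mult_ac)
    also have "\<dots> \<asymp> (1 + u ^ n) * D ^ 2" by (rule equiv_val_unit[OF n'])
    finally have eq: "(u ^ K - 1) * D \<asymp> (1 + u ^ n) * D ^ 2" .
    show ?thesis
    proof (cases "P dvd 1 + u ^ n")
      case False
      then have "(1 + u ^ n) * D ^ 2 \<asymp> D ^ 2" by (rule equiv_val_unit)
      with eq have "(u ^ K - 1) * D \<asymp> D ^ 2" by (rule equiv_val_trans)
      moreover have "\<not> [u ^ n = - 1] (mod P)"
        using False by (simp add: cong_iff_dvd_diff add.commute)
      ultimately show ?thesis
        using True power_dvd_power_iff_ceiling[of 2 e D]
        by (simp add: equiv_val_dvd_iff defect_level_def cong_1_iff_P_dvd[unfolded One_nat_def] K_def u_def)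
    next
      case minus: True
      have "\<not> P dvd 2" using p_ge_3 by (intro not_dvd_below) auto
      then have two_n: "\<not> P dvd int (2 * n)" using n' dvd_mult_P by simp
      have unit: "\<not> P dvd u ^ n - 1"
      proof
        assume "P dvd u ^ n - 1"
        with minus have "P dvd (1 + u ^ n) - (u ^ n - 1)" by (rule dvd_diff)
        with \<open>\<not> P dvd 2\<close> show False by simp
      qed
      have factor: "(u ^ n - 1) * (1 + u ^ n) = u ^ (2 * n) - 1"
        by (simp add: algebra_simps flip: power_add mult_2)
      have "1 + u ^ n \<asymp> (u ^ n - 1) * (1 + u ^ n)"
        by (rule equiv_val_sym[OF equiv_val_unit[OF unit]])
      also have "\<dots> = u ^ (2 * n) - 1" by (rule factor)
      also have "\<dots> \<asymp> int (2 * n) * D"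
        unfolding D_def using u minus factor by (intro power_minus_1_equiv) (auto simp flip: factor)
      also have "\<dots> \<asymp> D" by (rule equiv_val_unit[OF two_n])
      finally have "(1 + u ^ n) * D ^ 2 \<asymp> D * D ^ 2" by (intro equiv_val_mult equiv_val_refl)
      with eq have "(u ^ K - 1) * D \<asymp> D ^ 3"
        by (auto intro: equiv_val_trans simp: power2_eq_square power3_eq_cube mult.assoc)
      moreover have "[u ^ n = - 1] (mod P)"
        using minus by (simp add: cong_iff_dvd_diff add.commute)
      ultimately show ?thesis
        using True power_dvd_power_iff_ceiling[of 3 e D]
        by (simp add: equiv_val_dvd_iff defect_level_def cong_1_iff_P_dvd[unfolded One_nat_def] K_def u_def)
    qed
  qed
  then show ?thesis by (simp add: u_def K_def D_def)
qed

text \<open>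
  Eliminating \<open>y\<close> gives \<open>x\<^sup>M = x\<close> for \<open>M = x\<^sup>n y\<^sup>n\<close>, that is, \<open>p\<^sup>e dvd (M - 1) D\<close> besides the
  condition modulo \<open>p\<close>.  Since \<open>y\<close> is the \<open>x\<^sup>n\<close>-th power of \<open>x\<close> modulo \<open>p\<^sup>e\<close>, the number \<open>M\<close> is itself
  a power of \<open>x\<close> modulo \<open>p\<^sup>e\<close>, so that the preceding lemma applies.
\<close>

lemma two_cycle_iff:
  assumes n: "\<not> p dvd n" and e: "e \<ge> 1" and x: "\<not> p dvd x" and y: "y > 0"
    and xy: "[x ^ (x ^ n) = y] (mod p ^ e)"
  shows "[y ^ (y ^ n) = x] (mod p ^ e) \<longleftrightarrow>
    [x ^ (x ^ n * y ^ n) = x] (mod p) \<and> P ^ defect_level n e x (x ^ n) dvd unit_defect (int x)"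
proof -
  define M where "M = x ^ n * y ^ n"
  define D where "D = unit_defect (int x)"
  have "x > 0" using x by (intro Nat.gr0I) auto
  then have M: "M \<ge> 1" using y by (simp add: M_def Suc_le_eq)
  have ux: "\<not> P dvd int x" using x by simp
  have iter: "[y ^ (y ^ n) = x ^ M] (mod p ^ e)"
    using cong_pow[OF cong_sym[OF xy], of "y ^ n"] by (simp add: M_def power_mult)
  have red: "[x ^ M = x] (mod p ^ s) \<longleftrightarrow> P ^ s dvd int x ^ (M - 1) - 1" for s
  proof -
    have "[x ^ M = x] (mod p ^ s) \<longleftrightarrow> P ^ s dvd int x ^ M - int x"
      by (metis cong_iff_dvd_diff cong_int_iff of_nat_power)
    also have "int x ^ M - int x = int x * (int x ^ (M - 1) - 1)"
      using M by (simp add: algebra_simps power_eq_if)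
    also have "P ^ s dvd \<dots> \<longleftrightarrow> P ^ s dvd int x ^ (M - 1) - 1"
      using coprime_P_power[OF ux] by (simp add: coprime_dvd_mult_right_iff)
    finally show ?thesis .
  qed
  have "[y ^ (y ^ n) = x] (mod p ^ e) \<longleftrightarrow> [x ^ M = x] (mod p ^ e)"
    using iter cong_trans cong_sym by blast
  also have "\<dots> \<longleftrightarrow> P dvd int x ^ (M - 1) - 1 \<and> P ^ e dvd int (M - 1) * D"
  proof (cases "P dvd int x ^ (M - 1) - 1")
    case True
    with equiv_val_dvd_iff[OF power_minus_1_equiv[OF ux True]] show ?thesis
      by (simp add: red D_def)
  next
    case False
    then have "\<not> P ^ e dvd int x ^ (M - 1) - 1"
      using e by (meson dvd_power dvd_trans less_le_trans zero_less_one)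
    with False show ?thesis by (simp add: red)
  qed
  also have "P ^ e dvd int (M - 1) * D \<longleftrightarrow> P ^ e dvd (int x ^ (n + n * x ^ n) - 1) * D"
  proof (rule cong_dvd_iff)
    have "[x ^ n * y ^ n = x ^ n * (x ^ (x ^ n)) ^ n] (mod p ^ e)"
      by (intro cong_mult cong_pow cong_refl cong_sym[OF xy])
    also have "x ^ n * (x ^ (x ^ n)) ^ n = x ^ (n + n * x ^ n)"
      by (simp add: power_add power_mult[symmetric] mult.commute)
    finally have "[int M = int x ^ (n + n * x ^ n)] (mod P ^ e)"
      unfolding M_def by (metis cong_int_iff of_nat_power)
    then show "[int (M - 1) * D = (int x ^ (n + n * x ^ n) - 1) * D] (mod P ^ e)"
      using M by (intro cong_mult cong_refl) (auto simp: of_nat_diff intro: cong_diff)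
  qed
  also have "\<dots> \<longleftrightarrow> P ^ defect_level n e x (x ^ n) dvd D"
    unfolding D_def by (rule defect_times_power_minus_1[OF n ux])
  finally show ?thesis using red[of 1] by (simp add: M_def D_def)
qed

end

section \<open>Reduction to residues modulo a prime power\<close>

text \<open>
  Counting along a relation spares the choice of inverse functions where one direction is an
  application of the Chinese remainder theorem.
\<close>

lemma card_eq_if_unique_relation:
  assumes "\<And>s. s \<in> S \<Longrightarrow> \<exists>!t. t \<in> T \<and> R s t"
    and "\<And>t. t \<in> T \<Longrightarrow> \<exists>!s. s \<in> S \<and> R s t"
  shows "card S = card T"
proof -
  define f where "f s = (THE t. t \<in> T \<and> R s t)" for s
  have f: "f s \<in> T \<and> R s (f s)" if "s \<in> S" for s
    unfolding f_def by (rule theI') (rule assms(1)[OF that])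
  have f_eq: "f s = t" if "s \<in> S" "t \<in> T" "R s t" for s t
    using f assms(1) that by blast
  have "bij_betw f S T"
    unfolding bij_betw_def
  proof
    show "inj_on f S"
      by (rule inj_onI) (metis f assms(2))
    show "f ` S = T"
      using f f_eq assms(2) by blast
  qed
  then show ?thesis by (rule bij_betw_same_card)
qed

lemma chinese_remainder_positive:
  fixes q m u v :: nat
  assumes "coprime q m" "q > 0" "m > 0"
  shows "\<exists>!x. 1 \<le> x \<and> x \<le> q * m \<and> [x = u] (mod q) \<and> [x = v] (mod m)"
proof -
  obtain x where x: "x < q * m" "[x = u] (mod q)" "[x = v] (mod m)"
    using binary_chinese_remainder_unique_nat[OF assms(1), of u v] assms by auto
  \<comment> \<open>The two systems of representatives differ only in the zero class.\<close>
  define x' where "x' = (if x = 0 then q * m else x)"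
  have pos: "q * m > 0" using assms by simp
  have zero: "[q * m = 0] (mod q)" "[q * m = 0] (mod m)" by (simp_all add: cong_0_iff)
  have "[x' = u] (mod q) \<and> [x' = v] (mod m)"
    using x zero cong_trans by (auto simp: x'_def)
  moreover have "1 \<le> x' \<and> x' \<le> q * m"
    using x pos by (auto simp: x'_def)
  moreover have "y = z"
    if y: "1 \<le> y \<and> y \<le> q * m \<and> [y = u] (mod q) \<and> [y = v] (mod m)"
      and z: "1 \<le> z \<and> z \<le> q * m \<and> [z = u] (mod q) \<and> [z = v] (mod m)" for y z
  proof -
    have "[y = z] (mod q * m)"
      using y z assms(1) by (intro coprime_cong_mult_nat) (metis cong_sym cong_trans)+
    then have "q * m dvd nat \<bar>int y - int z\<bar>"
      by (metis cong_iff_dvd_diff cong_int_iff dvd_abs_iff int_dvd_int_iff nat_0_le abs_ge_zero)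
    moreover have "nat \<bar>int y - int z\<bar> < q * m" using y z by linarith
    ultimately have "nat \<bar>int y - int z\<bar> = 0"
      by (metis nat_dvd_not_less neq0_conv)
    then show ?thesis by linarith
  qed
  ultimately show ?thesis by blast
qed

lemma unique_positive_residue:
  fixes m v :: nat
  assumes "m > 0"
  shows "\<exists>!a. a \<in> {1..m} \<and> [v = a] (mod m)"
  using chinese_remainder_positive[of 1 m 0 v] assms by (simp add: cong_sym_eq conj_assoc)

lemma card_residue_class:
  fixes a b t :: nat
  assumes "a > 0"
  shows "card {z. z < a * b \<and> [z = t] (mod a)} = b"
proof -
  have "bij_betw (\<lambda>k. t mod a + a * k) {..<b} {z. z < a * b \<and> [z = t] (mod a)}"
  proof (rule bij_betw_byWitness[where f' = "\<lambda>z. z div a"])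
    show "(\<lambda>k. t mod a + a * k) ` {..<b} \<subseteq> {z. z < a * b \<and> [z = t] (mod a)}"
    proof safe
      fix k assume "k < b"
      have "t mod a + a * k < a * Suc k" using assms by simp
      also have "\<dots> \<le> a * b" using \<open>k < b\<close> by (intro mult_le_mono2) simp
      finally show "t mod a + a * k < a * b" .
      show "[t mod a + a * k = t] (mod a)" by (simp add: cong_def)
    qed
    show "(\<lambda>z. z div a) ` {z. z < a * b \<and> [z = t] (mod a)} \<subseteq> {..<b}"
      by (auto simp: less_mult_imp_div_less mult.commute)
    show "\<forall>z\<in>{z. z < a * b \<and> [z = t] (mod a)}. t mod a + a * (z div a) = z"
      by (auto simp: cong_def) (metis mod_mult_div_eq)
  qed (use assms in auto)
  from bij_betw_same_card[OF this] show ?thesis by simp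
qed

lemma power_cong_exponent:
  fixes x A B :: nat
  assumes "coprime x m" "[A = B] (mod totient m)"
  shows "[x ^ A = x ^ B] (mod m)"
proof -
  have c: "coprime m x" using assms(1) by (simp add: coprime_commute)
  have "[A = B] (mod ord m x)"
    using assms(2) order_divides_totient[OF c] by (rule cong_dvd_modulus_nat)
  then show ?thesis using order_divides_expdiff[OF c] by blast
qed

context odd_prime
begin

lemma coprime_p_iff: "coprime x (p ^ k) \<longleftrightarrow> k = 0 \<or> \<not> p dvd x" for x :: nat
proof -
  have "coprime p x \<longleftrightarrow> \<not> p dvd x"
    using prime_p by (metis coprime_absorb_left not_prime_unit prime_imp_coprime)
  then show ?thesis by (auto simp: coprime_commute)
qed

lemma power_cong_mod_p:
  fixes x r :: nat
  assumes "[x = r] (mod p)" "\<not> p dvd r" "[A = B] (mod p - 1)"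
  shows "[x ^ A = r ^ B] (mod p)"
proof -
  have "[x ^ A = r ^ A] (mod p)" by (rule cong_pow[OF assms(1)])
  also have "[r ^ A = r ^ B] (mod p)"
    using assms(2,3) coprime_p_iff[of r 1] totient_prime[OF prime_p]
    by (intro power_cong_exponent) auto
  finally show ?thesis .
qed

lemma unit_defect_cong: "[x = y] (mod m) \<Longrightarrow> [unit_defect x = unit_defect y] (mod m)"
  unfolding unit_defect_def by (intro cong_diff cong_pow cong_refl)

text \<open>
  The \<open>p\<^sup>s\<close>-th power of \<open>r\<close> is the Teichmueller representative of \<open>r\<close> modulo \<open>p\<^sup>s\<close>: raising it to the
  power \<open>p - 1\<close> gives a multiple of \<open>\<phi>(p\<^sup>s)\<close> in the exponent, and \<open>p\<^sup>s\<close> is 1 modulo \<open>p - 1\<close>.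
\<close>

lemma exists_root_of_unity_lift:
  assumes "\<not> p dvd r" "s \<ge> 1"
  shows "[r ^ (p ^ s) = r] (mod p)" "P ^ s dvd unit_defect (int (r ^ (p ^ s)))"
proof -
  have pk: "[p ^ k = 1] (mod p - 1)" for k
  proof -
    have "[p = 1] (mod p - 1)"
      using p_ge_3 by (simp add: cong_altdef_nat)
    then show ?thesis using cong_pow[of p 1 "p - 1" k] by simp
  qed
  show "[r ^ (p ^ s) = r] (mod p)"
    using power_cong_mod_p[OF cong_refl assms(1) pk[of s]] by simp
  have "totient (p ^ s) = p ^ (s - 1) * (p - 1)"
    using assms prime_p by (simp add: totient_prime_power)
  then have "p ^ s * (p - 1) = p * totient (p ^ s)"
    using assms by (cases s) auto
  then have "[p ^ s * (p - 1) = 0] (mod totient (p ^ s))" by (simp add: cong_0_iff)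
  then have "[r ^ (p ^ s * (p - 1)) = r ^ 0] (mod p ^ s)"
    using assms coprime_p_iff by (intro power_cong_exponent) blast+
  then have "[(int r ^ p ^ s) ^ (p - 1) = 1] (mod P ^ s)"
    by (metis cong_int_iff of_nat_1 of_nat_power power_0 power_mult)
  then show "P ^ s dvd unit_defect (int (r ^ (p ^ s)))"
    by (simp add: unit_defect_def cong_iff_dvd_diff)
qed

lemma cong_if_unit_defects_divisible:
  assumes "[x = y] (mod P)" "\<not> P dvd y" "P ^ s dvd unit_defect x" "P ^ s dvd unit_defect y"
  shows "[x = y] (mod P ^ s)"
proof -
  have "P ^ s dvd unit_defect x - unit_defect y" using assms by (intro dvd_diff)
  then have "P ^ s dvd x ^ (p - 1) - y ^ (p - 1)" by (simp add: unit_defect_def)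
  moreover have "x ^ (p - 1) - y ^ (p - 1) \<asymp> x - y"
    using not_dvd_p_minus_1 by (intro power_diff_unit_exponent assms) (simp only: int_dvd_int_iff not_False_eq_True)
  ultimately show ?thesis by (simp add: equiv_val_dvd_iff cong_iff_dvd_diff)
qed

text \<open>
  The condition singles out one residue class modulo \<open>p\<^sup>s\<close>, that of the root of unity above \<open>r\<close>.
\<close>

lemma card_near_root_of_unity:
  assumes "\<not> p dvd r" "1 \<le> s" "s \<le> e"
  shows "card {z. z < p ^ e \<and> [z = r] (mod p) \<and> P ^ s dvd unit_defect (int z)} = p ^ (e - s)"
proof -
  define t where "t = r ^ (p ^ s)"
  note t = exists_root_of_unity_lift[OF assms(1,2), folded t_def]
  have nt: "\<not> P dvd int t" using assms(1) dvd_power_P[of "int r" "p ^ s"] by (auto simp: t_def)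
  have "[z = r] (mod p) \<and> P ^ s dvd unit_defect (int z) \<longleftrightarrow> [z = t] (mod p ^ s)" for z
  proof
    assume z: "[z = r] (mod p) \<and> P ^ s dvd unit_defect (int z)"
    then have "[int z = int t] (mod P)"
      using t(1) by (meson cong_int_iff cong_sym cong_trans)
    then have "[int z = int t] (mod P ^ s)"
      using z t(2) nt by (intro cong_if_unit_defects_divisible) auto
    then show "[z = t] (mod p ^ s)" by (metis cong_int_iff of_nat_power)
  next
    assume z: "[z = t] (mod p ^ s)"
    then have "[z = t] (mod p)"
      using assms(2) by (meson cong_dvd_modulus_nat dvd_power less_le_trans zero_less_one)
    then have "[z = r] (mod p)" using t(1) cong_trans by blast
    moreover have "[unit_defect (int z) = unit_defect (int t)] (mod P ^ s)"
      using z by (intro unit_defect_cong) (metis cong_int_iff of_nat_power)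
    ultimately show "[z = r] (mod p) \<and> P ^ s dvd unit_defect (int z)"
      using t(2) cong_dvd_iff by blast
  qed
  then have "{z. z < p ^ e \<and> [z = r] (mod p) \<and> P ^ s dvd unit_defect (int z)}
      = {z. z < p ^ s * p ^ (e - s) \<and> [z = t] (mod p ^ s)}"
    using assms(3) by (simp flip: power_add)
  then show ?thesis using p_ge_3 by (simp add: card_residue_class)
qed

lemma defect_level_bounds: "e \<ge> 1 \<Longrightarrow> 1 \<le> defect_level n e r k \<and> defect_level n e r k \<le> e"
  unfolding defect_level_def by (auto split: if_splits)

lemma defect_level_cong:
  assumes "[x = r] (mod p)" "\<not> p dvd r" "[k = l] (mod p - 1)"
  shows "defect_level n e x k = defect_level n e r l"
proof -
  have "[x ^ (n + n * k) = r ^ (n + n * l)] (mod p)"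
    by (intro power_cong_mod_p assms cong_add cong_mult cong_refl)
  moreover have "[int x ^ n = int r ^ n] (mod P)"
    using assms(1) by (intro cong_pow) (simp add: cong_int_iff)
  ultimately have "[x ^ (n + n * k) = 1] (mod p) \<longleftrightarrow> [r ^ (n + n * l) = 1] (mod p)"
      "[int x ^ n = -1] (mod P) \<longleftrightarrow> [int r ^ n = -1] (mod P)"
    using cong_trans cong_sym by blast+
  then show ?thesis by (simp only: defect_level_def)
qed

text \<open>
  The residues modulo \<open>p\<^sup>e\<close> of the numbers \<open>x\<close> that occur in a 2-cycle \<open>(x, y)\<close> with \<open>x\<close> and \<open>y\<close>
  congruent to \<open>a\<close> and \<open>b\<close> modulo \<open>p - 1\<close>.
\<close>

definition two_cycle_residues :: "nat \<Rightarrow> nat \<Rightarrow> nat \<Rightarrow> nat \<Rightarrow> nat set" where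
  "two_cycle_residues n e a b = {z. z < p ^ e \<and> \<not> p dvd z \<and>
     [z ^ (a ^ n * b ^ n) = z] (mod p) \<and> P ^ defect_level n e z (a ^ n) dvd unit_defect (int z)}"

lemma two_cycle_residues_iff:
  assumes "\<not> p dvd n" "e \<ge> 1" "\<not> p dvd x" "y > 0" "[x ^ (x ^ n) = y] (mod p ^ e)"
    and x: "[x = a] (mod p - 1)" "[x = z] (mod p ^ e)" and y: "[y = b] (mod p - 1)"
    and z: "z < p ^ e"
  shows "[y ^ (y ^ n) = x] (mod p ^ e) \<longleftrightarrow> z \<in> two_cycle_residues n e a b"
proof -
  have xz: "[x = z] (mod p)"
    using x(2) assms(2) by (meson cong_dvd_modulus_nat dvd_power less_le_trans zero_less_one)
  then have nz: "\<not> p dvd z" using assms(3) cong_dvd_iff by blast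
  have "[x ^ n * y ^ n = a ^ n * b ^ n] (mod p - 1)"
    by (intro cong_mult cong_pow x y)
  then have "[x ^ (x ^ n * y ^ n) = z ^ (a ^ n * b ^ n)] (mod p)"
    by (rule power_cong_mod_p[OF xz nz])
  then have 1: "[x ^ (x ^ n * y ^ n) = x] (mod p) \<longleftrightarrow> [z ^ (a ^ n * b ^ n) = z] (mod p)"
    using xz by (meson cong_sym cong_trans)
  have lev: "defect_level n e x (x ^ n) = defect_level n e z (a ^ n)"
    by (intro defect_level_cong xz nz cong_pow x)
  have "[int x = int z] (mod P ^ e)" using x(2) by (metis cong_int_iff of_nat_power)
  then have "[int x = int z] (mod P ^ defect_level n e z (a ^ n))"
    using defect_level_bounds[OF assms(2)] by (meson cong_dvd_modulus le_imp_power_dvd)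
  then have "P ^ defect_level n e z (a ^ n) dvd unit_defect (int x)
      \<longleftrightarrow> P ^ defect_level n e z (a ^ n) dvd unit_defect (int z)"
    by (intro cong_dvd_iff unit_defect_cong)
  with 1 lev show ?thesis
    using two_cycle_iff[OF assms(1-5)] nz z by (simp add: two_cycle_residues_def)
qed

text \<open>
  By the Chinese remainder theorem \<open>x\<close> amounts to a residue modulo \<open>p\<^sup>e\<close> and one modulo \<open>p - 1\<close>; of
  \<open>y\<close> only the residue modulo \<open>p - 1\<close> is free, because \<open>x\<close> determines \<open>y\<close> modulo \<open>p\<^sup>e\<close>.
\<close>

lemma card_two_cycles_eq_sum:
  assumes n: "\<not> p dvd n" and e: "e \<ge> 1"
  shows "card {(x, y). 1 \<le> x \<and> x \<le> p ^ e * (p - 1) \<and> 1 \<le> y \<and> y \<le> p ^ e * (p - 1) \<and>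
      \<not> p dvd x \<and> \<not> p dvd y \<and>
      [x ^ (x ^ n) = y] (mod p ^ e) \<and> [y ^ (y ^ n) = x] (mod p ^ e)}
    = (\<Sum>a = 1..p - 1. \<Sum>b = 1..p - 1. card (two_cycle_residues n e a b))"
    (is "card ?S = _")
proof -
  define T where "T = (SIGMA a:{1..p - 1}. SIGMA b:{1..p - 1}. two_cycle_residues n e a b)"
  define R :: "nat \<times> nat \<Rightarrow> nat \<times> nat \<times> nat \<Rightarrow> bool" where
    "R = (\<lambda>(x, y) (a, b, z). [x = a] (mod p - 1) \<and> [y = b] (mod p - 1) \<and> [x = z] (mod p ^ e))"
  have q: "p ^ e > 0" and m: "p - 1 > 0" using p_ge_3 by auto
  have dvd_q: "p dvd p ^ e" using e by (simp add: dvd_power)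
  have cop: "coprime (p ^ e) (p - 1)"
    using not_dvd_p_minus_1 coprime_p_iff by (metis coprime_commute int_dvd_int_iff)
  note crt = chinese_remainder_positive[OF cop q m]
  have mem_z: "\<not> p dvd z \<and> z < p ^ e" if "z \<in> two_cycle_residues n e a b" for z a b
    using that by (simp add: two_cycle_residues_def)
  have "card ?S = card T"
  proof (rule card_eq_if_unique_relation[where R = R])
    fix s assume "s \<in> ?S"
    then obtain x y where s: "s = (x, y)" and x: "1 \<le> x" "x \<le> p ^ e * (p - 1)" "\<not> p dvd x"
      and y: "1 \<le> y" "y \<le> p ^ e * (p - 1)" "\<not> p dvd y"
      and xy: "[x ^ (x ^ n) = y] (mod p ^ e)" and yx: "[y ^ (y ^ n) = x] (mod p ^ e)"
      by auto
    obtain a where a: "a \<in> {1..p - 1}" "[x = a] (mod p - 1)"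
      and a_unique: "\<And>a'. a' \<in> {1..p - 1} \<Longrightarrow> [x = a'] (mod p - 1) \<Longrightarrow> a' = a"
      using unique_positive_residue[OF m, of x] by blast
    obtain b where b: "b \<in> {1..p - 1}" "[y = b] (mod p - 1)"
      and b_unique: "\<And>b'. b' \<in> {1..p - 1} \<Longrightarrow> [y = b'] (mod p - 1) \<Longrightarrow> b' = b"
      using unique_positive_residue[OF m, of y] by blast
    define z where "z = x mod p ^ e"
    have z: "z < p ^ e" "[x = z] (mod p ^ e)" using q by (auto simp: z_def cong_def)
    have z_unique: "z' = z" if "z' < p ^ e" "[x = z'] (mod p ^ e)" for z'
      using that by (simp add: z_def cong_def)
    have "z \<in> two_cycle_residues n e a b"
      using two_cycle_residues_iff[OF n e x(3) _ xy a(2) z(2) b(2) z(1)] y(1) yx by simp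
    with a b z have "(a, b, z) \<in> T \<and> R s (a, b, z)" by (simp add: T_def R_def s)
    moreover have "t = (a, b, z)" if "t \<in> T \<and> R s t" for t
      using that a_unique b_unique z_unique mem_z
      by (cases t) (auto simp: T_def R_def s)
    ultimately show "\<exists>!t. t \<in> T \<and> R s t" by blast
  next
    fix t assume "t \<in> T"
    then obtain a b z where t: "t = (a, b, z)" and z: "z \<in> two_cycle_residues n e a b"
      by (auto simp: T_def)
    obtain x where x: "1 \<le> x" "x \<le> p ^ e * (p - 1)" "[x = z] (mod p ^ e)" "[x = a] (mod p - 1)"
      and x_unique: "\<And>x'. 1 \<le> x' \<Longrightarrow> x' \<le> p ^ e * (p - 1) \<Longrightarrow> [x' = z] (mod p ^ e)
        \<Longrightarrow> [x' = a] (mod p - 1) \<Longrightarrow> x' = x"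
      using crt[of z a] by blast
    obtain y where y: "1 \<le> y" "y \<le> p ^ e * (p - 1)" "[y = x ^ (x ^ n)] (mod p ^ e)" "[y = b] (mod p - 1)"
      and y_unique: "\<And>y'. 1 \<le> y' \<Longrightarrow> y' \<le> p ^ e * (p - 1) \<Longrightarrow> [y' = x ^ (x ^ n)] (mod p ^ e)
        \<Longrightarrow> [y' = b] (mod p - 1) \<Longrightarrow> y' = y"
      using crt[of "x ^ (x ^ n)" b] by blast
    have xz: "[x = z] (mod p)" using x(3) dvd_q cong_dvd_modulus_nat by blast
    then have nx: "\<not> p dvd x" using mem_z[OF z] cong_dvd_iff by blast
    have "[y = x ^ (x ^ n)] (mod p)" using y(3) dvd_q cong_dvd_modulus_nat by blast
    then have ny: "\<not> p dvd y" using nx prime_dvd_power[OF prime_p] cong_dvd_iff by blast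
    have "[y ^ (y ^ n) = x] (mod p ^ e)"
      using two_cycle_residues_iff[OF n e nx _ cong_sym[OF y(3)] x(4,3) y(4)] mem_z[OF z] y(1) z
      by simp
    then have "(x, y) \<in> ?S \<and> R (x, y) t"
      using x y nx ny by (simp add: R_def t cong_sym)
    moreover have "s = (x, y)" if s: "s \<in> ?S \<and> R s t" for s
    proof -
      obtain x' y' where "s = (x', y')" by (cases s)
      with s have *: "1 \<le> x'" "x' \<le> p ^ e * (p - 1)" "1 \<le> y'" "y' \<le> p ^ e * (p - 1)"
        "[x' ^ (x' ^ n) = y'] (mod p ^ e)" "[x' = a] (mod p - 1)" "[y' = b] (mod p - 1)"
        "[x' = z] (mod p ^ e)"
        by (auto simp: R_def t)
      then have "x' = x" by (intro x_unique)
      with * have "y' = y" by (intro y_unique) (auto simp: cong_sym)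
      with \<open>x' = x\<close> \<open>s = (x', y')\<close> show ?thesis by simp
    qed
    ultimately show "\<exists>!s. s \<in> ?S \<and> R s t" by blast
  qed
  also have "finite (two_cycle_residues n e a b)" for a b
    by (rule finite_subset[of _ "{..<p ^ e}"]) (auto simp: two_cycle_residues_def)
  then have "card T = (\<Sum>a = 1..p - 1. \<Sum>b = 1..p - 1. card (two_cycle_residues n e a b))"
    unfolding T_def by (subst card_SigmaI; (intro finite_SigmaI sum.cong refl card_SigmaI ballI)?) auto
  finally show ?thesis .
qed

end

section \<open>Counting by orders of residues\<close>

lemma sum_div_3: "e div 3 + (e + 1) div 3 + (e + 2) div 3 = e" for e :: nat
proof (induction e)
  case (Suc e)
  have "(e + 3) div 3 = Suc (e div 3)" by simp
  moreover have "Suc e + 1 = e + 2" "Suc e + 2 = e + 3" by simp_all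
  ultimately show ?case using Suc by (simp only: Suc_eq_plus1)
qed simp

context odd_prime
begin

lemma nat_in_range_not_dvd: "r \<in> {0<..<p} \<Longrightarrow> \<not> p dvd r"
  by (auto dest: dvd_imp_le)

text \<open>
  In the cyclic group of units modulo \<open>p\<close> there are \<open>\<phi>(d)\<close> elements of order \<open>d\<close> for each divisor
  \<open>d\<close> of \<open>p - 1\<close>, and the sum of \<open>\<phi>(d)\<close> over the divisors of a number is that number.
\<close>

lemma card_ord_dvd: "card {r \<in> {0<..<p}. ord p r dvd a} = gcd (p - 1) a"
proof -
  have tot: "totatives p = {0<..<p}"
    using prime_p by (rule totatives_prime)
  define S where "S d = {r \<in> {0<..<p}. ord p r = d}" for d
  have "ord p r dvd p - 1" if "r \<in> {0<..<p}" for r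
    using order_divides_totient[of p r] coprime_p_iff[of r 1] nat_in_range_not_dvd[OF that]
    by (simp add: totient_prime[OF prime_p] coprime_commute)
  then have "{r \<in> {0<..<p}. ord p r dvd a} = (\<Union>d \<in> {d. d dvd gcd (p - 1) a}. S d)"
    by (auto simp: S_def)
  also have "card \<dots> = (\<Sum>d | d dvd gcd (p - 1) a. card (S d))"
    using p_ge_3 by (intro card_UN_disjoint) (auto simp: S_def finite_divisors_nat)
  also have "\<dots> = (\<Sum>d | d dvd gcd (p - 1) a. totient d)"
    using prime_card_elements_with_ord_eq_totient[of p] p_ge_3 prime_p tot
    by (intro sum.cong) (auto simp: S_def)
  also have "\<dots> = gcd (p - 1) a" by (rule totient_divisor_sum)
  finally show ?thesis .
qed

lemma power_eq_self_iff_ord: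
  assumes "r \<in> {0<..<p}" "K \<ge> 1"
  shows "[r ^ K = r] (mod p) \<longleftrightarrow> ord p r dvd K - 1"
proof -
  have "coprime p r"
    using coprime_p_iff[of r 1] nat_in_range_not_dvd[OF assms(1)] by (simp add: coprime_commute)
  then have "[r ^ K = r ^ 1] (mod p) \<longleftrightarrow> [K = 1] (mod ord p r)"
    by (rule order_divides_expdiff)
  with assms(2) show ?thesis by (simp add: cong_altdef_nat)
qed

lemma power_eq_minus_1_iff_ord:
  "[int r ^ n = - 1] (mod P) \<longleftrightarrow> ord p r dvd 2 * n \<and> \<not> ord p r dvd n"
proof -
  have "\<not> (P dvd int r ^ n - 1 \<and> P dvd int r ^ n + 1)"
  proof
    assume "P dvd int r ^ n - 1 \<and> P dvd int r ^ n + 1"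
    then have "P dvd (int r ^ n + 1) - (int r ^ n - 1)" using dvd_diff by blast
    moreover have "\<not> P dvd 2" using p_ge_3 by (intro not_dvd_below) auto
    ultimately show False by simp
  qed
  moreover have "int r ^ (2 * n) - 1 = (int r ^ n - 1) * (int r ^ n + 1)"
    by (simp add: algebra_simps flip: power_add mult_2)
  ultimately show ?thesis
    by (auto simp add: cong_iff_dvd_diff dvd_mult_P cong_1_iff_P_dvd[unfolded One_nat_def]
        simp flip: ord_divides)
qed

text \<open>
  Sort the residues by their class \<open>r\<close> modulo \<open>p\<close>.  An admissible class contributes \<open>p\<^sup>e\<^sup>-\<^sup>s\<close> residues,
  where \<open>s\<close> is its level, so all admissible classes contribute 1, those in \<open>G1\<close> in addition
  \<open>p\<^sup>e\<^sup>/\<^sup>2 - 1\<close>, and those in \<open>G2\<close> on top of this the difference to the larger power of \<open>p\<close>.  All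
  three sets of classes are described by divisibility conditions on the order of \<open>r\<close>.
\<close>

lemma card_two_cycle_residues:
  assumes n: "n > 0" "\<not> p dvd n" and e: "e \<ge> 1" and a: "a \<ge> 1" and b: "b \<ge> 1"
  defines "k \<equiv> a ^ n * b ^ n - 1"
  shows "int (card (two_cycle_residues n e a b))
    = int (gcd (p - 1) k)
      + int (gcd (p - 1) (gcd (n * (a ^ n + 1)) k)) * (int p ^ (e div 2) - 1)
      + (int (gcd (p - 1) (gcd (2 * n) k)) - int (gcd (p - 1) (gcd n k)))
        * (int p ^ (e div 3 + (e + 1) div 3) - int p ^ (e div 2))"
proof -
  define A where "A = a ^ n"
  define B where "B = b ^ n"
  define G where "G = {r \<in> {0<..<p}. ord p r dvd k}"
  define G1 where "G1 = {r \<in> G. ord p r dvd n * (A + 1)}"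
  define G2 where "G2 = {r \<in> G. ord p r dvd 2 * n \<and> \<not> ord p r dvd n}"
  define lev where "lev r = defect_level n e r A" for r
  define Z where "Z r = {z. z < p ^ e \<and> [z = r] (mod p) \<and> P ^ lev r dvd unit_defect (int z)}" for r
  have AB: "A * B \<ge> 1" using a b by (simp add: A_def B_def Suc_le_eq)
  have finG: "finite G" by (simp add: G_def)
  have kAB: "k = A * B - 1" by (simp add: k_def A_def B_def)
  \<comment> \<open>An r whose n-th power is -1 has even order; since this order divides A B - 1, A is odd.\<close>
  have G2_subset: "G2 \<subseteq> G1"
  proof
    fix r assume r: "r \<in> G2"
    then have ord: "ord p r dvd k" "ord p r dvd 2 * n" "\<not> ord p r dvd n" by (auto simp: G2_def G_def)
    have "even (ord p r)"
      using ord(2,3) by (metis coprime_dvd_mult_right_iff coprime_right_2_iff_odd)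
    then have "even k" using ord(1) dvd_trans by blast
    then have "odd A" using AB by (auto simp: kAB)
    then have "n * 2 dvd n * (A + 1)" by (intro mult_dvd_mono) auto
    then have "2 * n dvd n * (A + 1)" by (simp only: mult.commute)
    then show "r \<in> G1" using r ord(2) dvd_trans by (auto simp: G1_def G2_def)
  qed
  have lev: "lev r = (if r \<in> G2 then (e + 2) div 3 else if r \<in> G1 then (e + 1) div 2 else e)"
    if "r \<in> G" for r
  proof -
    have "n + n * A = n * (A + 1)" by simp
    then have "[r ^ (n + n * A) = 1] (mod p) \<longleftrightarrow> r \<in> G1"
      using that by (simp only: ord_divides G1_def mem_Collect_eq simp_thms)
    moreover have "[int r ^ n = - 1] (mod P) \<longleftrightarrow> r \<in> G2"
      using that by (simp only: power_eq_minus_1_iff_ord G2_def mem_Collect_eq simp_thms)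
    ultimately show ?thesis
      using G2_subset by (auto simp: lev_def defect_level_def)
  qed
  have "two_cycle_residues n e a b = (\<Union>r\<in>G. Z r)"
  proof (intro equalityI subsetI)
    fix z assume z: "z \<in> two_cycle_residues n e a b"
    define r where "r = z mod p"
    have zr: "[z = r] (mod p)" by (simp add: r_def cong_def)
    have r: "r \<in> {0<..<p}" using z p_ge_3 by (auto simp: two_cycle_residues_def r_def mod_eq_0_iff_dvd intro!: Nat.gr0I)
    have "[z ^ (A * B) = z] (mod p)" using z by (simp add: two_cycle_residues_def A_def B_def)
    then have "[r ^ (A * B) = r] (mod p)"
      using cong_pow[OF zr] zr by (meson cong_sym cong_trans)
    then have "r \<in> G" using power_eq_self_iff_ord[OF r AB] r by (simp add: G_def kAB)
    moreover have "defect_level n e z A = lev r"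
      unfolding lev_def using zr nat_in_range_not_dvd[OF r] by (intro defect_level_cong) auto
    then have "z \<in> Z r" using z zr by (simp add: two_cycle_residues_def Z_def A_def)
    ultimately show "z \<in> (\<Union>r\<in>G. Z r)" by blast
  next
    fix z assume "z \<in> (\<Union>r\<in>G. Z r)"
    then obtain r where r: "r \<in> {0<..<p}" "ord p r dvd A * B - 1" and z: "z \<in> Z r"
      by (auto simp: G_def kAB)
    have zr: "[z = r] (mod p)" using z by (simp add: Z_def)
    have "[r ^ (A * B) = r] (mod p)" using power_eq_self_iff_ord[OF r(1) AB] r(2) by simp
    then have "[z ^ (A * B) = z] (mod p)"
      using cong_pow[OF zr] zr by (meson cong_sym cong_trans)
    moreover have "\<not> p dvd z" using zr nat_in_range_not_dvd[OF r(1)] cong_dvd_iff by blast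
    moreover have "defect_level n e z A = lev r"
      unfolding lev_def using zr nat_in_range_not_dvd[OF r(1)] by (intro defect_level_cong) auto
    ultimately show "z \<in> two_cycle_residues n e a b"
      using z by (simp add: two_cycle_residues_def Z_def A_def B_def)
  qed
  then have "card (two_cycle_residues n e a b) = card (\<Union>r\<in>G. Z r)" by simp
  also have "\<dots> = (\<Sum>r\<in>G. card (Z r))"
  proof (rule card_UN_disjoint[OF finG])
    show "\<forall>r\<in>G. finite (Z r)" by (auto simp: Z_def)
    show "\<forall>r\<in>G. \<forall>r'\<in>G. r \<noteq> r' \<longrightarrow> Z r \<inter> Z r' = {}"
      by (auto simp: Z_def G_def) (metis cong_less_modulus_unique_nat cong_sym cong_trans)
  qed
  also have "\<dots> = (\<Sum>r\<in>G. p ^ (e - lev r))"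
  proof (rule sum.cong[OF refl])
    fix r assume "r \<in> G"
    then have "r \<in> {0<..<p}" by (simp add: G_def)
    then show "card (Z r) = p ^ (e - lev r)"
      unfolding Z_def using defect_level_bounds[OF e] nat_in_range_not_dvd
      by (intro card_near_root_of_unity) (auto simp: lev_def)
  qed
  finally have "int (card (two_cycle_residues n e a b)) = (\<Sum>r\<in>G. P ^ (e - lev r))" by simp
  also have "\<dots> = (\<Sum>r\<in>G. 1 + (if r \<in> G1 then P ^ (e div 2) - 1 else 0)
      + (if r \<in> G2 then P ^ (e div 3 + (e + 1) div 3) - P ^ (e div 2) else 0))"
  proof (rule sum.cong[OF refl])
    fix r assume "r \<in> G"
    moreover have "e - (e + 2) div 3 = e div 3 + (e + 1) div 3"
      using sum_div_3[of e] by linarith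
    moreover have "e - (e + 1) div 2 = e div 2" by linarith
    ultimately show "P ^ (e - lev r) = 1 + (if r \<in> G1 then P ^ (e div 2) - 1 else 0)
      + (if r \<in> G2 then P ^ (e div 3 + (e + 1) div 3) - P ^ (e div 2) else 0)"
      using G2_subset by (auto simp: lev)
  qed
  also have "\<dots> = int (card G) + int (card G1) * (P ^ (e div 2) - 1)
      + int (card G2) * (P ^ (e div 3 + (e + 1) div 3) - P ^ (e div 2))"
  proof -
    have "(\<Sum>r\<in>G. if r \<in> S then c else 0) = int (card S) * c" if "S \<subseteq> G" for S c
      using that finG by (simp add: sum.If_cases Int_absorb1)
    moreover have "G1 \<subseteq> G" "G2 \<subseteq> G" by (auto simp: G1_def G2_def)
    ultimately show ?thesis by (simp only: sum.distrib sum_constant mult_1_right)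
  qed
  also have "card G = gcd (p - 1) k" unfolding G_def by (rule card_ord_dvd)
  also have "card G1 = gcd (p - 1) (gcd (n * (A + 1)) k)"
  proof -
    have "G1 = {r \<in> {0<..<p}. ord p r dvd gcd (n * (A + 1)) k}" by (auto simp: G1_def G_def)
    then show ?thesis by (simp only: card_ord_dvd)
  qed
  also have "int (card G2) = int (gcd (p - 1) (gcd (2 * n) k)) - int (gcd (p - 1) (gcd n k))"
  proof -
    define S where "S j = {r \<in> {0<..<p}. ord p r dvd gcd j k}" for j
    have "G2 = S (2 * n) - S n" by (auto simp: G2_def G_def S_def)
    moreover have "S n \<subseteq> S (2 * n)" by (auto simp: S_def)
    moreover have "finite (S n)" "card (S j) = gcd (p - 1) (gcd j k)" for j
      by (simp_all only: S_def card_ord_dvd) simp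
    moreover have "card (S n) \<le> card (S (2 * n))"
      using calculation(2) by (intro card_mono) (auto simp: S_def)
    ultimately show ?thesis by (simp add: card_Diff_subset of_nat_diff)
  qed
  finally show ?thesis by (simp add: A_def)
qed

end

section \<open>Greatest common divisors as sums over divisors\<close>

text \<open>
  Every block of \<open>d\<close> consecutive arguments has the same sum, and \<open>{1..m}\<close> consists of \<open>m div d\<close> blocks.
\<close>

lemma sum_periodic:
  fixes f :: "nat \<Rightarrow> int"
  assumes d: "d > 0" and dm: "d dvd m"
    and periodic: "\<And>a b. [a = b] (mod d) \<Longrightarrow> f a = f b"
  shows "(\<Sum>a = 1..m. f a) = int (m div d) * (\<Sum>a<d. f a)"
proof -
  obtain k where k: "m = k * d" using dm by (metis dvd_def mult.commute)
  have block: "(\<Sum>a = j..<j + d. f a) = (\<Sum>a<d. f a)" for j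
  proof (induction j)
    case (Suc j)
    have "(\<Sum>a = j..<Suc (j + d). f a) = f j + (\<Sum>a = Suc j..<Suc (j + d). f a)"
      by (rule sum.atLeast_Suc_lessThan) simp
    moreover have "(\<Sum>a = j..<Suc (j + d). f a) = (\<Sum>a = j..<j + d. f a) + f (j + d)"
      by (rule sum.atLeastLessThan_Suc) simp
    moreover have "f (j + d) = f j" by (rule periodic) (simp add: cong_def)
    ultimately show ?case using Suc by simp
  qed (simp add: atLeast0LessThan)
  have "(\<Sum>a = 1..<1 + k * d. f a) = int k * (\<Sum>a<d. f a)" for k
  proof (induction k)
    case (Suc k)
    have "(\<Sum>a = 1..<1 + Suc k * d. f a)
        = (\<Sum>a = 1..<1 + k * d. f a) + (\<Sum>a = 1 + k * d..<1 + k * d + d. f a)"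
      by (subst sum.atLeastLessThan_concat) (auto simp: algebra_simps)
    then show ?case using Suc block[of "1 + k * d"] by (simp add: algebra_simps)
  qed simp
  moreover have "{1..m} = {1..<1 + k * d}" by (auto simp: k)
  ultimately show ?thesis using d by (simp add: k)
qed

lemma sum_sum_periodic:
  fixes g :: "nat \<Rightarrow> nat \<Rightarrow> int"
  assumes d: "d > 0" and dm: "d dvd m"
    and periodic: "\<And>a a' b b'. [a = a'] (mod d) \<Longrightarrow> [b = b'] (mod d) \<Longrightarrow> g a b = g a' b'"
  shows "(\<Sum>a = 1..m. \<Sum>b = 1..m. g a b) = int (m div d) ^ 2 * (\<Sum>a<d. \<Sum>b<d. g a b)"
proof -
  have "(\<Sum>b = 1..m. g a b) = int (m div d) * (\<Sum>b<d. g a b)" for a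
    using d dm by (rule sum_periodic) (auto intro: periodic)
  moreover have "(\<Sum>a = 1..m. \<Sum>b<d. g a b) = int (m div d) * (\<Sum>a<d. \<Sum>b<d. g a b)"
    using d dm by (rule sum_periodic) (auto intro!: periodic sum.cong)
  ultimately show ?thesis
    by (simp add: sum_distrib_left[symmetric] power2_eq_square)
qed

lemma card_int_residues: "card {z \<in> {0..<int d}. Q z} = card {z. z < d \<and> Q (int z)}"
proof -
  have "{z \<in> {0..<int d}. Q z} = int ` {z. z < d \<and> Q (int z)}"
  proof (intro equalityI subsetI)
    fix z assume "z \<in> {z \<in> {0..<int d}. Q z}"
    then show "z \<in> int ` {z. z < d \<and> Q (int z)}"
      by (intro image_eqI[of _ _ "nat z"]) auto
  qed auto
  then show ?thesis by (simp add: card_image)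
qed

lemma num_roots_mod_nat: "num_roots_mod f d = card {z. z < d \<and> int d dvd f (int z)}"
  unfolding num_roots_mod_def card_int_residues by (simp add: cong_0_iff)

lemma num_unit_roots_mod_nat:
  "num_unit_roots_mod f d = card {z. z < d \<and> coprime z d \<and> int d dvd f (int z)}"
  unfolding num_unit_roots_mod_def card_int_residues by (simp add: cong_0_iff)

lemma totient_card_below: "d > 0 \<Longrightarrow> totient d = card {z. z < d \<and> coprime z d}"
proof -
  assume d: "d > 0"
  have "int (totient d) = (\<Sum>a = 1..d. if coprime a d then 1 else 0)"
  proof -
    have "totatives d = {a \<in> {1..d}. coprime a d}" by (auto simp: totatives_def)
    then show ?thesis by (simp add: totient_def sum.If_cases Int_def)
  qed
  also have "\<dots> = int (d div d) * (\<Sum>a<d. if coprime a d then 1 else 0)"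
    using d by (rule sum_periodic) (auto simp: cong_imp_coprime cong_sym dest: cong_imp_coprime cong_imp_coprime[OF cong_sym])
  also have "\<dots> = int (card {z. z < d \<and> coprime z d})"
    using d by (simp add: sum.If_cases Int_def lessThan_def)
  finally show ?thesis by simp
qed

lemma coprime_if_dvd_power_product_minus_1:
  fixes n :: nat
  assumes "n > 0" "int d dvd int a ^ n * int b ^ n - 1"
  shows "coprime b d"
proof (rule coprimeI)
  fix c assume c: "c dvd b" "c dvd d"
  have "int c dvd int a ^ n * int b ^ n"
    using c(1) assms(1) by (metis dvd_mult dvd_power dvd_trans int_dvd_int_iff)
  moreover have "int c dvd int a ^ n * int b ^ n - 1"
    using c(2) assms(2) by (metis dvd_trans int_dvd_int_iff)
  ultimately have "int c dvd int a ^ n * int b ^ n - (int a ^ n * int b ^ n - 1)"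
    by (rule dvd_diff)
  then show "is_unit c" by simp
qed

text \<open>
  For a fixed unit \<open>b\<close> the substitution \<open>z = a b\<close> permutes the residues modulo \<open>d\<close> and turns the
  condition into \<open>z\<^sup>n = 1\<close>; for \<open>b\<close> not prime to \<open>d\<close> there is no solution.
\<close>

lemma card_pairs_power_product:
  fixes Q :: "nat \<Rightarrow> bool"
  assumes d: "d > 0" and n: "n > 0"
  shows "(\<Sum>a<d. \<Sum>b<d. if int d dvd int a ^ n * int b ^ n - 1 \<and> Q b then 1 else 0)
    = int (card {b. b < d \<and> coprime b d \<and> Q b}) * int (num_roots_mod (\<lambda>z. z ^ n - 1) d)"
proof -
  define N where "N = num_roots_mod (\<lambda>z. z ^ n - 1) d"
  have inner: "(\<Sum>a<d. if int d dvd int a ^ n * int b ^ n - 1 \<and> Q b then 1 else 0)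
      = (if coprime b d \<and> Q b then int N else 0)" for b
  proof (cases "coprime b d \<and> Q b")
    case True
    then have cop: "coprime b d" by simp
    have "bij_betw (\<lambda>a. a * b mod d) {a. a < d \<and> int d dvd int a ^ n * int b ^ n - 1}
        {z. z < d \<and> int d dvd int z ^ n - 1}"
    proof -
      obtain c where c: "[b * c = 1] (mod d)" using cong_solve_coprime_nat[OF cop] by auto
      have dvd_iff: "int d dvd int (z mod d) ^ n * u - 1 \<longleftrightarrow> int d dvd int z ^ n * u - 1" for z u
      proof (rule cong_dvd_iff)
        have "[int (z mod d) = int z] (mod int d)" by (simp add: cong_def zmod_int)
        then show "[int (z mod d) ^ n * u - 1 = int z ^ n * u - 1] (mod int d)"
          by (intro cong_diff cong_mult cong_pow cong_refl)
      qed
      have dvd_c: "int d dvd int (z * c mod d) ^ n * int b ^ n - 1 \<longleftrightarrow> int d dvd int z ^ n - 1" for z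
      proof -
        have "int d dvd int (z * c mod d) ^ n * int b ^ n - 1
            \<longleftrightarrow> int d dvd int (z * c) ^ n * int b ^ n - 1"
          by (rule dvd_iff)
        also have "int (z * c) ^ n * int b ^ n = int z ^ n * int (b * c) ^ n"
          by (simp add: power_mult_distrib)
        also have "int d dvd int z ^ n * int (b * c) ^ n - 1
            \<longleftrightarrow> int d dvd int z ^ n * 1 ^ n - 1"
        proof (rule cong_dvd_iff)
          have "[int (b * c) = 1] (mod int d)" using c by (metis cong_int_iff of_nat_1)
          then show "[int z ^ n * int (b * c) ^ n - 1 = int z ^ n * 1 ^ n - 1] (mod int d)"
            by (intro cong_diff cong_mult cong_pow cong_refl)
        qed
        finally show ?thesis by simp
      qed
      have cancel: "z * (u * v) mod d = z" if "z < d" "[u * v = 1] (mod d)" for z u v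
      proof -
        have "[z * (u * v) = z * 1] (mod d)" by (intro cong_mult cong_refl that)
        then show ?thesis using that(1) by (simp add: cong_def)
      qed
      show ?thesis
      proof (rule bij_betw_byWitness[where f' = "\<lambda>z. z * c mod d"])
        show "\<forall>a\<in>{a. a < d \<and> int d dvd int a ^ n * int b ^ n - 1}. a * b mod d * c mod d = a"
          using cancel[OF _ c] by (auto simp: mod_mult_left_eq mult.assoc)
        show "\<forall>z\<in>{z. z < d \<and> int d dvd int z ^ n - 1}. z * c mod d * b mod d = z"
        proof
          fix z assume "z \<in> {z. z < d \<and> int d dvd int z ^ n - 1}"
          then have "z * (c * b) mod d = z"
            using cancel[OF _ c] by (simp add: mult.commute[of c b])
          then show "z * c mod d * b mod d = z" by (simp only: mod_mult_left_eq mult.assoc)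
        qed
        show "(\<lambda>a. a * b mod d) ` {a. a < d \<and> int d dvd int a ^ n * int b ^ n - 1}
            \<subseteq> {z. z < d \<and> int d dvd int z ^ n - 1}"
        proof (intro image_subsetI CollectI conjI)
          fix a assume a: "a \<in> {a. a < d \<and> int d dvd int a ^ n * int b ^ n - 1}"
          show "a * b mod d < d" using d by simp
          have "int d dvd int (a * b) ^ n * 1 - 1" using a by (simp add: power_mult_distrib)
          then show "int d dvd int (a * b mod d) ^ n - 1" using dvd_iff[of "a * b" 1] by simp
        qed
        show "(\<lambda>z. z * c mod d) ` {z. z < d \<and> int d dvd int z ^ n - 1}
            \<subseteq> {a. a < d \<and> int d dvd int a ^ n * int b ^ n - 1}"
          using d dvd_c by auto
      qed
    qed
    then have "card {a. a < d \<and> int d dvd int a ^ n * int b ^ n - 1} = N"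
      unfolding N_def num_roots_mod_nat by (rule bij_betw_same_card)
    with True show ?thesis by (simp add: sum.If_cases Int_def)
  next
    case False
    then have "\<not> (int d dvd int a ^ n * int b ^ n - 1 \<and> Q b)" for a
      using coprime_if_dvd_power_product_minus_1[OF n] by blast
    with False show ?thesis by (simp only: if_False sum.neutral_const)
  qed
  have "(\<Sum>a<d. \<Sum>b<d. if int d dvd int a ^ n * int b ^ n - 1 \<and> Q b then 1 else 0)
      = (\<Sum>b<d. if coprime b d \<and> Q b then int N else 0)"
    by (subst sum.swap) (simp add: inner)
  also have "\<dots> = int (card {b. b < d \<and> coprime b d \<and> Q b}) * int N"
    by (simp add: sum.If_cases Int_def)
  finally show ?thesis by (simp add: N_def)
qed

lemma gcd_eq_sum_totient:
  assumes "m > 0"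
  shows "gcd (int m) k = (\<Sum>d | d dvd m. if int d dvd k then int (totient d) else 0)"
proof -
  have "gcd (int m) k = int (gcd m (nat \<bar>k\<bar>))"
    by (simp only: gcd_int_int_eq[symmetric] int_nat_eq abs_ge_zero if_True gcd_abs2_int)
  also have "\<dots> = int (\<Sum>d | d dvd gcd m (nat \<bar>k\<bar>). totient d)" by (simp only: totient_divisor_sum)
  also have "{d. d dvd gcd m (nat \<bar>k\<bar>)} = {d. d dvd m} \<inter> {d. int d dvd k}"
    by (auto simp: int_dvd_int_iff[symmetric] simp del: int_dvd_int_iff)
  finally show ?thesis
    using assms by (auto simp: sum.inter_restrict finite_divisors_nat intro!: sum.cong)
qed

text \<open>
  Write the greatest common divisor as the sum of \<open>\<phi>(d)\<close> over the common divisors \<open>d\<close> and exchange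
  the summations.  For fixed \<open>d\<close> the inner sum counts pairs by a condition modulo \<open>d\<close>.  The function
  \<open>h\<close> covers both the constants \<open>0\<close>, \<open>n\<close>, \<open>2 n\<close> and the polynomial \<open>n (z\<^sup>n + 1)\<close>.
\<close>

lemma sum_gcd_eq_divisor_sum:
  fixes h :: "nat \<Rightarrow> int"
  assumes m: "m > 0" and n: "n > 0"
    and h: "\<And>d b b'. [b = b'] (mod d) \<Longrightarrow> int d dvd h b \<longleftrightarrow> int d dvd h b'"
  shows "(\<Sum>a = 1..m. \<Sum>b = 1..m. gcd (int m) (gcd (h b) (int a ^ n * int b ^ n - 1)))
    = (\<Sum>d | d dvd m. int (totient d) * int (m div d) ^ 2
        * int (card {b. b < d \<and> coprime b d \<and> int d dvd h b})
        * int (num_roots_mod (\<lambda>z. z ^ n - 1) d))"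
proof -
  define I :: "nat \<Rightarrow> nat \<Rightarrow> nat \<Rightarrow> int" where
    "I d a b = (if int d dvd int a ^ n * int b ^ n - 1 \<and> int d dvd h b then 1 else 0)" for d a b
  have I_periodic: "I d a b = I d a' b'" if "[a = a'] (mod d)" "[b = b'] (mod d)" for d a a' b b'
  proof -
    have "[int a ^ n * int b ^ n - 1 = int a' ^ n * int b' ^ n - 1] (mod int d)"
      using that by (intro cong_diff cong_mult cong_pow cong_refl) (simp_all add: cong_int_iff)
    then show ?thesis using h[OF that(2)] cong_dvd_iff unfolding I_def by metis
  qed
  have "(\<Sum>a = 1..m. \<Sum>b = 1..m. gcd (int m) (gcd (h b) (int a ^ n * int b ^ n - 1)))
      = (\<Sum>a = 1..m. \<Sum>b = 1..m. \<Sum>d | d dvd m. int (totient d) * I d a b)"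
    unfolding gcd_eq_sum_totient[OF m]
  proof (intro sum.cong refl)
    fix a b d
    show "(if int d dvd gcd (h b) (int a ^ n * int b ^ n - 1) then int (totient d) else 0)
        = int (totient d) * I d a b"
      by (simp add: I_def)
  qed
  also have "\<dots> = (\<Sum>a = 1..m. \<Sum>d | d dvd m. \<Sum>b = 1..m. int (totient d) * I d a b)"
    by (intro sum.cong refl sum.swap)
  also have "\<dots> = (\<Sum>d | d dvd m. \<Sum>a = 1..m. \<Sum>b = 1..m. int (totient d) * I d a b)"
    by (rule sum.swap)
  also have "\<dots> = (\<Sum>d | d dvd m. int (totient d) * (\<Sum>a = 1..m. \<Sum>b = 1..m. I d a b))"
    by (simp only: sum_distrib_left)
  also have "\<dots> = (\<Sum>d | d dvd m. int (totient d) * int (m div d) ^ 2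
        * int (card {b. b < d \<and> coprime b d \<and> int d dvd h b})
        * int (num_roots_mod (\<lambda>z. z ^ n - 1) d))"
  proof (rule sum.cong[OF refl])
    fix d assume "d \<in> {d. d dvd m}"
    then have d: "d > 0" "d dvd m" using m by (auto intro: Nat.gr0I)
    have "(\<Sum>a = 1..m. \<Sum>b = 1..m. I d a b) = int (m div d) ^ 2 * (\<Sum>a<d. \<Sum>b<d. I d a b)"
      using d by (rule sum_sum_periodic) (rule I_periodic)
    also have "(\<Sum>a<d. \<Sum>b<d. I d a b)
        = int (card {b. b < d \<and> coprime b d \<and> int d dvd h b})
          * int (num_roots_mod (\<lambda>z. z ^ n - 1) d)"
      unfolding I_def by (rule card_pairs_power_product[OF d(1) n])
    finally show "int (totient d) * (\<Sum>a = 1..m. \<Sum>b = 1..m. I d a b)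
        = int (totient d) * int (m div d) ^ 2
          * int (card {b. b < d \<and> coprime b d \<and> int d dvd h b})
          * int (num_roots_mod (\<lambda>z. z ^ n - 1) d)"
      by (simp add: mult_ac)
  qed
  finally show ?thesis .
qed

lemma sum_gcd_const_eq_divisor_sum:
  assumes m: "m > 0" and n: "n > 0"
  shows "(\<Sum>a = 1..m. \<Sum>b = 1..m. gcd (int m) (gcd (int c) (int a ^ n * int b ^ n - 1)))
    = (\<Sum>d | d dvd gcd m c. int (totient d) ^ 2 * int (m div d) ^ 2
        * int (num_roots_mod (\<lambda>z. z ^ n - 1) d))"
proof -
  have "(\<Sum>a = 1..m. \<Sum>b = 1..m. gcd (int m) (gcd (int c) (int a ^ n * int b ^ n - 1)))
      = (\<Sum>d | d dvd m. int (totient d) * int (m div d) ^ 2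
        * int (card {b. b < d \<and> coprime b d \<and> int d dvd int c})
        * int (num_roots_mod (\<lambda>z. z ^ n - 1) d))"
    using m n by (rule sum_gcd_eq_divisor_sum) simp
  also have "\<dots> = (\<Sum>d | d dvd m. if d dvd c then int (totient d) ^ 2 * int (m div d) ^ 2
        * int (num_roots_mod (\<lambda>z. z ^ n - 1) d) else 0)"
  proof (rule sum.cong[OF refl])
    fix d assume "d \<in> {d. d dvd m}"
    then have "d > 0" using m by (auto intro: Nat.gr0I)
    then show "int (totient d) * int (m div d) ^ 2
        * int (card {b. b < d \<and> coprime b d \<and> int d dvd int c})
        * int (num_roots_mod (\<lambda>z. z ^ n - 1) d)
        = (if d dvd c then int (totient d) ^ 2 * int (m div d) ^ 2
        * int (num_roots_mod (\<lambda>z. z ^ n - 1) d) else 0)"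
      by (simp add: totient_card_below power2_eq_square mult_ac)
  qed
  also have "\<dots> = (\<Sum>d \<in> {d. d dvd m} \<inter> {d. d dvd c}. int (totient d) ^ 2 * int (m div d) ^ 2
        * int (num_roots_mod (\<lambda>z. z ^ n - 1) d))"
    using m by (subst sum.inter_restrict) (auto simp: finite_divisors_nat)
  also have "{d. d dvd m} \<inter> {d. d dvd c} = {d. d dvd gcd m c}" by auto
  finally show ?thesis .
qed

section \<open>Components, quotients and divided powers of p-adic integers\<close>

context odd_prime
begin

abbreviation Z :: "(nat \<Rightarrow> int) ring" where "Z \<equiv> Zp p"

sublocale Zp: cring Z
  using p_ge_3 by (intro cring_Zp) simp

lemma P_power_pos: "0 < P ^ k"
  using p_ge_3 by simp

lemma Zp_carrierI:
  assumes "\<And>k. 0 \<le> x k \<and> x k < P ^ k" "\<And>k. [x (Suc k) = x k] (mod P ^ k)"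
  shows "x \<in> carrier Z"
  using assms by (simp add: Zp_def cong_def)

lemma Zp_range: "x \<in> carrier Z \<Longrightarrow> 0 \<le> x k \<and> x k < P ^ k"
  by (simp add: Zp_def)

lemma Zp_coherent:
  assumes x: "x \<in> carrier Z" and "k \<le> m"
  shows "[x m = x k] (mod P ^ k)"
  using \<open>k \<le> m\<close>
proof (induction m rule: dec_induct)
  case (step m)
  have "x (Suc m) mod P ^ m = x m" using x by (simp add: Zp_def)
  then have "[x (Suc m) = x m] (mod P ^ m)" by (metis cong_mod_left cong_refl)
  then have "[x (Suc m) = x m] (mod P ^ k)"
    using step(1) by (meson cong_dvd_modulus le_imp_power_dvd)
  then show ?case using step.IH by (rule cong_trans)
qed simp

lemma Zp_component_eq_0_iff:
  assumes "x \<in> carrier Z"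
  shows "x k = 0 \<longleftrightarrow> P ^ k dvd x k"
proof -
  have "x k mod P ^ k = x k" using Zp_range[OF assms, of k] by simp
  then show ?thesis by (metis dvd_eq_mod_eq_0)
qed

lemma Zp_eqI:
  assumes "x \<in> carrier Z" "y \<in> carrier Z" "\<And>k. [x k = y k] (mod P ^ k)"
  shows "x = y"
proof
  fix k
  show "x k = y k"
    using Zp_range[OF assms(1), of k] Zp_range[OF assms(2), of k] assms(3)[of k]
    by (simp add: cong_def)
qed

lemma Zp_mult: "[(x \<otimes>\<^bsub>Z\<^esub> y) k = x k * y k] (mod P ^ k)"
  by (simp add: Zp_def cong_def)

lemma Zp_add: "[(x \<oplus>\<^bsub>Z\<^esub> y) k = x k + y k] (mod P ^ k)"
  by (simp add: Zp_def cong_def)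

lemma Zp_one: "[\<one>\<^bsub>Z\<^esub> k = 1] (mod P ^ k)"
  by (simp add: Zp_def cong_def)

lemma Zp_zero: "\<zero>\<^bsub>Z\<^esub> k = 0"
  by (simp add: Zp_def)

lemma Zp_pow: "[(x [^]\<^bsub>Z\<^esub> (n :: nat)) k = x k ^ n] (mod P ^ k)"
proof (induction n)
  case (Suc n)
  have "[(x [^]\<^bsub>Z\<^esub> Suc n) k = (x [^]\<^bsub>Z\<^esub> n) k * x k] (mod P ^ k)"
    by (simp add: Zp_mult)
  also have "[(x [^]\<^bsub>Z\<^esub> n) k * x k = x k ^ n * x k] (mod P ^ k)"
    by (rule cong_mult[OF Suc cong_refl])
  finally show ?case by (simp add: mult.commute)
qed (simp add: Zp_one)

lemma Zp_minus:
  assumes "x \<in> carrier Z" "y \<in> carrier Z"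
  shows "[(x \<ominus>\<^bsub>Z\<^esub> y) k = x k - y k] (mod P ^ k)"
proof -
  have "x \<ominus>\<^bsub>Z\<^esub> y \<oplus>\<^bsub>Z\<^esub> y = x" using assms by (simp add: Zp.minus_eq Zp.add.m_assoc Zp.l_neg)
  then have "[(x \<ominus>\<^bsub>Z\<^esub> y) k + y k = x k] (mod P ^ k)" by (metis Zp_add cong_sym)
  then have "[(x \<ominus>\<^bsub>Z\<^esub> y) k + y k - y k = x k - y k] (mod P ^ k)" by (intro cong_diff cong_refl)
  then show ?thesis by simp
qed

lemma Zp_nat_mult: "[([n] \<cdot>\<^bsub>Z\<^esub> x) k = int n * x k] (mod P ^ k)"
proof (induction n)
  case (Suc n)
  have "[([Suc n] \<cdot>\<^bsub>Z\<^esub> x) k = ([n] \<cdot>\<^bsub>Z\<^esub> x) k + x k] (mod P ^ k)"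
    using Zp_add[of "[n] \<cdot>\<^bsub>Z\<^esub> x" x k] by (simp add: add_pow_def)
  also have "[([n] \<cdot>\<^bsub>Z\<^esub> x) k + x k = int n * x k + x k] (mod P ^ k)"
    by (rule cong_add[OF Suc cong_refl])
  finally show ?case by (simp add: algebra_simps)
qed (simp add: add_pow_def Zp_zero)

lemma Zp_finsum:
  assumes "\<And>i. f i \<in> carrier Z"
  shows "[finsum Z f {..<N :: nat} k = (\<Sum>i<N. f i k)] (mod P ^ k)"
proof (induction N)
  case (Suc N)
  have "finsum Z f {..<Suc N} = f N \<oplus>\<^bsub>Z\<^esub> finsum Z f {..<N}"
    using assms by (simp add: lessThan_Suc)
  then have "[finsum Z f {..<Suc N} k = f N k + finsum Z f {..<N} k] (mod P ^ k)"
    by (simp add: Zp_add)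
  also have "[f N k + finsum Z f {..<N} k = f N k + (\<Sum>i<N. f i k)] (mod P ^ k)"
    by (rule cong_add[OF cong_refl Suc])
  finally show ?case by (simp add: add.commute)
qed (simp add: Zp_zero)

text \<open>
  Division by \<open>K\<close> costs \<open>v\<close> digits of precision, where \<open>v\<close> is the valuation of \<open>K\<close>.
\<close>

lemma cancel_multiple:
  assumes K: "K = p ^ v * c" "\<not> p dvd c" and dvd: "P ^ (m + v) dvd int K * t"
  shows "P ^ m dvd t"
proof -
  have "P ^ v * P ^ m dvd P ^ v * (int c * t)"
    using dvd by (simp add: K power_add mult_ac)
  then have "P ^ m dvd int c * t" using p_ge_3 by simp
  moreover have "\<not> P dvd int c" using K(2) by simp
  ultimately show ?thesis using coprime_P_power by (metis coprime_dvd_mult_right_iff)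
qed

lemma p_part_exists:
  fixes K :: nat
  assumes "K > 0"
  obtains v c where "K = p ^ v * c" "\<not> p dvd c"
proof -
  have "\<not> is_unit p" using p_ge_3 by simp
  then show thesis using multiplicity_decompose'[of K p] assms that by blast
qed

lemma nat_mult_cancel:
  fixes K :: nat
  assumes "K > 0" "s \<in> carrier Z" "s' \<in> carrier Z" "[K] \<cdot>\<^bsub>Z\<^esub> s = [K] \<cdot>\<^bsub>Z\<^esub> s'"
  shows "s = s'"
proof (rule Zp_eqI[OF assms(2,3)])
  fix m
  obtain v c where K: "K = p ^ v * c" "\<not> p dvd c" using p_part_exists[OF assms(1)] .
  have "[int K * s (m + v) = int K * s' (m + v)] (mod P ^ (m + v))"
    using cong_trans[OF cong_sym[OF Zp_nat_mult[of K s]] Zp_nat_mult[of K s', folded assms(4)]] .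
  then have "P ^ (m + v) dvd int K * (s (m + v) - s' (m + v))"
    by (simp add: cong_iff_dvd_diff right_diff_distrib)
  then have "[s (m + v) = s' (m + v)] (mod P ^ m)" unfolding cong_iff_dvd_diff by (rule cancel_multiple[OF K])
  then show "[s m = s' m] (mod P ^ m)"
    using cong_trans[OF cong_sym[OF Zp_coherent[OF assms(2) le_add1]]]
      cong_trans[OF _ Zp_coherent[OF assms(3) le_add1]] by blast
qed

text \<open>
  The component at \<open>m\<close> of the quotient is obtained from that of \<open>a\<close> at \<open>m + v\<close>: divide the latter
  by \<open>p\<^sup>v\<close> and multiply by an inverse of \<open>c\<close> modulo \<open>p\<^sup>m\<close>.
\<close>

lemma quotient_exists:
  assumes K: "K = p ^ v * c" "\<not> p dvd c" and a: "a \<in> carrier Z" "a v = 0"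
  shows "\<exists>s \<in> carrier Z. [K] \<cdot>\<^bsub>Z\<^esub> s = a"
proof -
  have "\<exists>g. [int c * g = 1] (mod P ^ m)" for m
    using coprime_P_power[of "int c" m] K(2)
    by (intro cong_solve_coprime_int) (simp add: coprime_commute)
  then obtain g where g: "\<And>m. [int c * g m = 1] (mod P ^ m)" by metis
  define A where "A m = a (m + v) div P ^ v" for m
  have A: "P ^ v * A m = a (m + v)" for m
  proof -
    have "P ^ v dvd a (m + v)"
      using Zp_coherent[OF a(1), of v "m + v"] a(2) by (simp add: cong_0_iff)
    then show ?thesis by (simp add: A_def)
  qed
  define s where "s m = (A m * g m) mod P ^ m" for m
  have Ks: "[int K * s m = a (m + v)] (mod P ^ (m + v))" for m
  proof -
    have "[s m = A m * g m] (mod P ^ m)" by (simp add: s_def cong_def)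
    then have "[int c * s m = int c * (A m * g m)] (mod P ^ m)" by (intro cong_mult cong_refl)
    also have "int c * (A m * g m) = A m * (int c * g m)" by simp
    also have "[A m * (int c * g m) = A m * 1] (mod P ^ m)" by (intro cong_mult cong_refl g)
    finally have "P ^ m dvd int c * s m - A m" by (simp add: cong_iff_dvd_diff)
    then have "P ^ v * P ^ m dvd P ^ v * (int c * s m - A m)" by (intro mult_dvd_mono) auto
    then have "P ^ (m + v) dvd int K * s m - P ^ v * A m"
      by (simp add: K algebra_simps power_add)
    then show ?thesis by (simp add: A cong_iff_dvd_diff)
  qed
  have "s \<in> carrier Z"
  proof (rule Zp_carrierI)
    fix k
    show "0 \<le> s k \<and> s k < P ^ k" using P_power_pos by (simp add: s_def)
    have "[int K * s (Suc k) = a (Suc k + v)] (mod P ^ (k + v))"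
      using Ks[of "Suc k"] by (rule cong_dvd_modulus) (simp add: le_imp_power_dvd)
    also have "[a (Suc k + v) = a (k + v)] (mod P ^ (k + v))"
      by (rule Zp_coherent[OF a(1)]) simp
    also have "[a (k + v) = int K * s k] (mod P ^ (k + v))" by (rule cong_sym[OF Ks])
    finally have "P ^ (k + v) dvd int K * (s (Suc k) - s k)"
      by (simp add: cong_iff_dvd_diff right_diff_distrib)
    then show "[s (Suc k) = s k] (mod P ^ k)" unfolding cong_iff_dvd_diff by (rule cancel_multiple[OF K])
  qed
  moreover have "[K] \<cdot>\<^bsub>Z\<^esub> s = a"
  proof (rule Zp_eqI)
    show "[K] \<cdot>\<^bsub>Z\<^esub> s \<in> carrier Z" using \<open>s \<in> carrier Z\<close> by simp
    fix k
    have "[([K] \<cdot>\<^bsub>Z\<^esub> s) k = int K * s k] (mod P ^ k)" by (rule Zp_nat_mult)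
    also have "[int K * s k = a (k + v)] (mod P ^ k)"
      using Ks[of k] by (rule cong_dvd_modulus) (simp add: le_imp_power_dvd)
    also have "[a (k + v) = a k] (mod P ^ k)" by (rule Zp_coherent[OF a(1)]) simp
    finally show "[([K] \<cdot>\<^bsub>Z\<^esub> s) k = a k] (mod P ^ k)" .
  qed (rule a)
  ultimately show ?thesis by blast
qed

lemma padic_quot_eqI:
  assumes "K > 0" "s \<in> carrier Z" "[K] \<cdot>\<^bsub>Z\<^esub> s = a"
  shows "padic_quot p a K = s"
  unfolding padic_quot_def using assms nat_mult_cancel[OF assms(1)] by (intro the_equality) auto

lemma p_dvd_iff:
  assumes x: "x \<in> carrier Z"
  shows "p_dvd p x \<longleftrightarrow> x 1 = 0"
proof
  assume "p_dvd p x"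
  then obtain c where c: "x = [p] \<cdot>\<^bsub>Z\<^esub> \<one>\<^bsub>Z\<^esub> \<otimes>\<^bsub>Z\<^esub> c"
    unfolding p_dvd_def factor_def by auto
  have "[x 1 = ([p] \<cdot>\<^bsub>Z\<^esub> \<one>\<^bsub>Z\<^esub>) 1 * c 1] (mod P ^ 1)" unfolding c by (rule Zp_mult)
  also have "[([p] \<cdot>\<^bsub>Z\<^esub> \<one>\<^bsub>Z\<^esub>) 1 * c 1 = (P * \<one>\<^bsub>Z\<^esub> 1) * c 1] (mod P ^ 1)"
    by (intro cong_mult cong_refl Zp_nat_mult)
  finally have "P dvd x 1" by (simp add: cong_dvd_iff)
  then show "x 1 = 0" using Zp_component_eq_0_iff[OF x, of 1] by simp
next
  assume "x 1 = 0"
  then obtain s where s: "s \<in> carrier Z" "[p] \<cdot>\<^bsub>Z\<^esub> s = x"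
    using quotient_exists[of p 1 1 x] x p_ge_3 by auto
  then have "x = [p] \<cdot>\<^bsub>Z\<^esub> \<one>\<^bsub>Z\<^esub> \<otimes>\<^bsub>Z\<^esub> s" by (simp add: Zp.add_pow_ldistr)
  then show "p_dvd p x" using s(1) by (auto simp: p_dvd_def factor_def)
qed

lemma fact_extend_below_block:
  assumes "j < p"
  shows "\<exists>c. \<not> p dvd c \<and> fact (p * q + j) = fact (p * q) * (c :: nat)"
  using assms
proof (induction j)
  case 0
  then show ?case using p_ge_3 by (intro exI[of _ 1]) auto
next
  case (Suc j)
  then obtain c where c: "\<not> p dvd c" "fact (p * q + j) = fact (p * q) * (c :: nat)" by auto
  have "\<not> p dvd Suc (p * q + j)"
    using Suc.prems by (metis add_Suc_right dvd_add_right_iff dvd_triv_left nat_dvd_not_less zero_less_Suc)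
  then have "\<not> p dvd c * Suc (p * q + j)" using c(1) prime_p prime_dvd_mult_iff by blast
  moreover have "fact (p * q + Suc j) = fact (p * q) * (c * Suc (p * q + j))"
    using c(2) by (simp add: algebra_simps)
  ultimately show ?case by blast
qed

lemma fact_block: "\<exists>c. \<not> p dvd c \<and> fact (p * q) = p ^ q * fact q * (c :: nat)"
proof (induction q)
  case 0
  then show ?case using p_ge_3 by (intro exI[of _ 1]) auto
next
  case (Suc q)
  then obtain c where c: "\<not> p dvd c" "fact (p * q) = p ^ q * fact q * (c :: nat)" by auto
  obtain d where d: "\<not> p dvd d" "fact (p * q + (p - 1)) = fact (p * q) * (d :: nat)"
    using fact_extend_below_block[of "p - 1" q] p_ge_3 by auto
  have "p * Suc q = Suc (p * q + (p - 1))" using p_ge_3 by simp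
  then have "fact (p * Suc q) = p * Suc q * fact (p * q + (p - 1))" by (metis fact_Suc of_nat_id)
  also have "\<dots> = p ^ Suc q * fact (Suc q) * (c * d)" 
    by (simp only: d(2) c(2) fact_Suc power_Suc of_nat_id mult_ac)
  finally show ?case using c(1) d(1) prime_p prime_dvd_mult_iff by blast
qed

text \<open>
  The bound \<open>v\<^sub>p(k!) \<le> k/2\<close>, which makes the exponential series converge on \<open>p\<int>\<^sub>p\<close>.  It follows from
  \<open>v\<^sub>p(k!) = q + v\<^sub>p(q!)\<close> with \<open>q = k div p\<close>, because \<open>q + q/2 \<le> p q/2\<close> for \<open>p \<ge> 3\<close>.
\<close>

lemma fact_p_part: "\<exists>v c. fact k = p ^ v * c \<and> \<not> p dvd c \<and> 2 * v \<le> k"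
proof (induction k rule: less_induct)
  case (less k)
  define q where "q = k div p"
  have k: "k = p * q + k mod p" by (simp add: q_def)
  obtain c where c: "\<not> p dvd c" "fact k = fact (p * q) * (c :: nat)"
    using fact_extend_below_block[of "k mod p" q] p_ge_3 k by auto
  obtain d where d: "\<not> p dvd d" "fact (p * q) = p ^ q * fact q * (d :: nat)"
    using fact_block by blast
  show ?case
  proof (cases "q = 0")
    case True
    then show ?thesis using c by (intro exI[of _ 0] exI[of _ c]) auto
  next
    case False
    then have "k > 0" by (auto simp: q_def intro: Nat.gr0I)
    then have "q < k" unfolding q_def using p_ge_3 by (intro div_less_dividend) auto
    then obtain v b where b: "fact q = p ^ v * b" "\<not> p dvd b" "2 * v \<le> q" using less by blast
    have "fact k = p ^ (q + v) * (b * d * c)" by (simp add: c d b power_add mult_ac)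
    moreover have "\<not> p dvd b * d * c" using b c d prime_p prime_dvd_mult_iff by blast
    moreover have "2 * (q + v) \<le> k"
    proof -
      have "2 * (q + v) \<le> 3 * q" using b(3) by simp
      also have "\<dots> \<le> p * q" using p_ge_3 by simp
      also have "\<dots> \<le> k" using k by linarith
      finally show ?thesis .
    qed
    ultimately show ?thesis by blast
  qed
qed

text \<open>
  The divided powers \<open>u\<^sup>k / k!\<close>.  They are the terms of the exponential series, and the terms of the
  logarithmic series are the multiples \<open>t\<^sup>k / k = (k - 1)! (t\<^sup>k / k!)\<close> of them, so that all questions
  of integrality and convergence are settled by the properties of divided powers.
\<close>

definition dpow :: "(nat \<Rightarrow> int) \<Rightarrow> nat \<Rightarrow> (nat \<Rightarrow> int)" where
  "dpow u k = padic_quot p (u [^]\<^bsub>Z\<^esub> k) (fact k)"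

text \<open>
  For \<open>u\<close> in \<open>p\<int>\<^sub>p\<close>, that is, with component 0 at 1, the valuation of \<open>u\<^sup>k / k!\<close> is at least
  \<open>k - v\<^sub>p(k!) \<ge> k/2\<close>.
\<close>

lemma dpow:
  assumes u: "u \<in> carrier Z" "u 1 = 0"
  shows dpow_closed: "dpow u k \<in> carrier Z"
    and fact_dpow: "[(fact k :: nat)] \<cdot>\<^bsub>Z\<^esub> dpow u k = u [^]\<^bsub>Z\<^esub> k"
    and dpow_vanishes: "2 * m \<le> Suc k \<Longrightarrow> dpow u k m = 0"
proof -
  obtain v c where vc: "fact k = p ^ v * c" "\<not> p dvd c" "2 * v \<le> k" using fact_p_part by blast
  have uk: "u [^]\<^bsub>Z\<^esub> k \<in> carrier Z" using u by simp
  have pow_0: "(u [^]\<^bsub>Z\<^esub> k) j = 0" if "j \<le> k" for j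
  proof (cases "j = 0")
    case True
    then show ?thesis using Zp_range[OF uk, of 0] by simp
  next
    case False
    then have "P dvd u j" using Zp_coherent[OF u(1), of 1 j] u(2) by (simp add: cong_0_iff)
    then have "P ^ j dvd u j ^ k" using that by (meson dvd_power_same dvd_trans le_imp_power_dvd)
    then have "P ^ j dvd (u [^]\<^bsub>Z\<^esub> k) j" using Zp_pow cong_dvd_iff by blast
    then show ?thesis using Zp_component_eq_0_iff[OF uk] by blast
  qed
  obtain s where s: "s \<in> carrier Z" "[(fact k :: nat)] \<cdot>\<^bsub>Z\<^esub> s = u [^]\<^bsub>Z\<^esub> k"
    using quotient_exists[OF vc(1,2) uk pow_0] vc(3) by auto
  have eq: "dpow u k = s" unfolding dpow_def using s by (intro padic_quot_eqI) auto
  show "dpow u k \<in> carrier Z" "[(fact k :: nat)] \<cdot>\<^bsub>Z\<^esub> dpow u k = u [^]\<^bsub>Z\<^esub> k" using s eq by auto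
  assume m: "2 * m \<le> Suc k"
  have "[int (fact k) * s (m + v) = (u [^]\<^bsub>Z\<^esub> k) (m + v)] (mod P ^ (m + v))"
    using Zp_nat_mult[of "fact k" s "m + v"] s(2) by (simp add: cong_sym)
  also have "(u [^]\<^bsub>Z\<^esub> k) (m + v) = 0" using m vc(3) by (intro pow_0) linarith
  finally have "P ^ m dvd s (m + v)" unfolding cong_0_iff by (rule cancel_multiple[OF vc(1,2)])
  then have "P ^ m dvd s m" using cong_dvd_iff[OF Zp_coherent[OF s(1) le_add1]] by blast
  then show "dpow u k m = 0" using Zp_component_eq_0_iff[OF s(1)] eq by blast
qed

lemma dpow_eqI:
  assumes "s \<in> carrier Z" "[(fact k :: nat)] \<cdot>\<^bsub>Z\<^esub> s = u [^]\<^bsub>Z\<^esub> k"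
  shows "dpow u k = s"
  unfolding dpow_def using assms by (intro padic_quot_eqI) auto

lemma fact_dpow_component:
  assumes "u \<in> carrier Z" "u 1 = 0"
  shows "[fact k * dpow u k m = u m ^ k] (mod P ^ m)"
proof -
  have "[int (fact k) * dpow u k m = ([(fact k :: nat)] \<cdot>\<^bsub>Z\<^esub> dpow u k) m] (mod P ^ m)"
    by (rule cong_sym[OF Zp_nat_mult])
  also have "[(fact k :: nat)] \<cdot>\<^bsub>Z\<^esub> dpow u k = u [^]\<^bsub>Z\<^esub> k" by (rule fact_dpow[OF assms])
  also have "[(u [^]\<^bsub>Z\<^esub> k) m = u m ^ k] (mod P ^ m)" by (rule Zp_pow)
  finally show ?thesis by simp
qed

lemma padic_suminf_component:
  assumes f: "\<And>k. f k \<in> carrier Z" and vanish: "\<And>k m. 2 * m \<le> k \<Longrightarrow> f k m = 0"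
  shows "padic_suminf p f \<in> carrier Z"
    and "2 * m \<le> N \<Longrightarrow> [padic_suminf p f m = (\<Sum>k<N. f k m)] (mod P ^ m)"
proof -
  define s where "s m = (\<Sum>k<2 * m. f k m) mod P ^ m" for m
  have tail: "(\<Sum>k<N. f k m) = (\<Sum>k<2 * m. f k m)" if "2 * m \<le> N" for N m
    using that vanish by (intro sum.mono_neutral_right) auto
  have s: "[s m = (\<Sum>k<N. f k m)] (mod P ^ m)" if "2 * m \<le> N" for N m
    using tail[OF that] by (simp add: s_def cong_def)
  have closed: "s \<in> carrier Z"
  proof (rule Zp_carrierI)
    fix k
    show "0 \<le> s k \<and> s k < P ^ k" using P_power_pos by (simp add: s_def)
    have "[s (Suc k) = (\<Sum>i<2 * Suc k. f i (Suc k))] (mod P ^ k)"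
      using s[of "Suc k" "2 * Suc k"] by (rule cong_dvd_modulus) (simp_all add: le_imp_power_dvd)
    also have "[(\<Sum>i<2 * Suc k. f i (Suc k)) = (\<Sum>i<2 * Suc k. f i k)] (mod P ^ k)"
      by (intro cong_sum Zp_coherent f) simp
    also have "[(\<Sum>i<2 * Suc k. f i k) = s k] (mod P ^ k)"
      by (rule cong_sym[OF s]) simp
    finally show "[s (Suc k) = s k] (mod P ^ k)" .
  qed
  have partial: "finsum Z f {..<N} m = s m" if "2 * m \<le> N" for N m
  proof -
    have "[finsum Z f {..<N} m = s m] (mod P ^ m)"
      using Zp_finsum[OF f] s[OF that] by (meson cong_sym cong_trans)
    moreover have "finsum Z f {..<N} \<in> carrier Z" using f by (intro Zp.finsum_closed) auto
    ultimately show ?thesis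
      using Zp_range closed by (meson cong_less_imp_eq_int)
  qed
  have "padic_sums p f s"
    unfolding padic_sums_def eventually_sequentially using closed partial by blast
  moreover have "s' = s" if "padic_sums p f s'" for s'
  proof
    fix m
    have "\<exists>N0. \<forall>N\<ge>N0. finsum Z f {..<N} m = s' m"
      using that by (simp add: padic_sums_def eventually_sequentially)
    then obtain N0 where "\<And>N. N \<ge> N0 \<Longrightarrow> finsum Z f {..<N} m = s' m"
      by blast
    then show "s' m = s m" using partial[of m "max N0 (2 * m)"] by force
  qed
  ultimately have "padic_suminf p f = s"
    unfolding padic_suminf_def by (rule the_equality)
  then show "padic_suminf p f \<in> carrier Z"
    "2 * m \<le> N \<Longrightarrow> [padic_suminf p f m = (\<Sum>k<N. f k m)] (mod P ^ m)"
    using closed s by auto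
qed

end

section \<open>The p-adic exponential and logarithm\<close>

context odd_prime
begin

definition in_pZp :: "(nat \<Rightarrow> int) \<Rightarrow> bool" where
  "in_pZp u \<longleftrightarrow> u \<in> carrier Z \<and> u 1 = 0"

lemma in_pZpD: "in_pZp u \<Longrightarrow> u \<in> carrier Z" "in_pZp u \<Longrightarrow> u 1 = 0"
  by (simp_all add: in_pZp_def)

lemma in_pZp_iff: "in_pZp u \<longleftrightarrow> u \<in> carrier Z \<and> P dvd u 1"
  using Zp_component_eq_0_iff[of u 1] by (auto simp: in_pZp_def)

lemma in_pZp_add: "in_pZp u \<Longrightarrow> in_pZp v \<Longrightarrow> in_pZp (u \<oplus>\<^bsub>Z\<^esub> v)"
  using cong_dvd_iff[OF Zp_add[of u v 1]] by (simp add: in_pZp_iff)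

lemma in_pZp_mult: "w \<in> carrier Z \<Longrightarrow> in_pZp u \<Longrightarrow> in_pZp (w \<otimes>\<^bsub>Z\<^esub> u)"
  using cong_dvd_iff[OF Zp_mult[of w u 1]] by (simp add: in_pZp_iff)

lemma in_pZp_nat_mult: "in_pZp u \<Longrightarrow> in_pZp ([(N :: nat)] \<cdot>\<^bsub>Z\<^esub> u)"
  using cong_dvd_iff[OF Zp_nat_mult[of N u 1]] by (simp add: in_pZp_iff)

lemma dpow_0: "dpow u 0 = \<one>\<^bsub>Z\<^esub>"
  by (rule dpow_eqI) (simp_all add: Zp.add.nat_pow_eone)

lemma dpow_1: "u \<in> carrier Z \<Longrightarrow> dpow u 1 = u"
  by (rule dpow_eqI) (simp_all add: Zp.add.nat_pow_eone)

text \<open>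
  The binomial theorem divided by \<open>k!\<close>.  The division is carried out at the higher precision
  \<open>m + a\<close>, where \<open>a\<close> is the valuation of \<open>k!\<close>.
\<close>

lemma dpow_add:
  assumes u: "in_pZp u" and v: "in_pZp v"
  shows "[dpow (u \<oplus>\<^bsub>Z\<^esub> v) k m = (\<Sum>i\<le>k. dpow u i m * dpow v (k - i) m)] (mod P ^ m)"
proof -
  note u' = in_pZpD[OF u] and v' = in_pZpD[OF v] and uv' = in_pZpD[OF in_pZp_add[OF u v]]
  obtain a c where ac: "fact k = p ^ a * c" "\<not> p dvd c" using fact_p_part[of k] by blast
  define M where "M = m + a"
  define S where "S M = (\<Sum>i\<le>k. dpow u i M * dpow v (k - i) M)" for M
  have "[fact k * dpow (u \<oplus>\<^bsub>Z\<^esub> v) k M = (u \<oplus>\<^bsub>Z\<^esub> v) M ^ k] (mod P ^ M)"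
    by (rule fact_dpow_component[OF uv'])
  also have "[(u \<oplus>\<^bsub>Z\<^esub> v) M ^ k = (u M + v M) ^ k] (mod P ^ M)"
    by (rule cong_pow[OF Zp_add])
  also have "(u M + v M) ^ k = (\<Sum>i\<le>k. of_nat (k choose i) * u M ^ i * v M ^ (k - i))"
    by (rule binomial_ring)
  also have "[\<dots> = (\<Sum>i\<le>k. of_nat (k choose i) * (fact i * dpow u i M) * (fact (k - i) * dpow v (k - i) M))] (mod P ^ M)"
    by (intro cong_sum cong_mult cong_refl cong_sym[OF fact_dpow_component[OF u']] cong_sym[OF fact_dpow_component[OF v']])
  also have "(\<Sum>i\<le>k. of_nat (k choose i) * (fact i * dpow u i M) * (fact (k - i) * dpow v (k - i) M))
      = fact k * S M"
    unfolding S_def sum_distrib_left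
  proof (rule sum.cong[OF refl])
    fix i assume "i \<in> {..k}"
    then have "fact i * fact (k - i) * (k choose i) = (fact k :: nat)"
      using binomial_fact_lemma by simp
    then have "int (fact i * fact (k - i) * (k choose i)) = int (fact k)" by (simp only:)
    then have int_fact: "fact k = fact i * fact (k - i) * int (k choose i)" by simp
    show "of_nat (k choose i) * (fact i * dpow u i M) * (fact (k - i) * dpow v (k - i) M)
        = fact k * (dpow u i M * dpow v (k - i) M)"
      unfolding int_fact by (simp only: mult_ac)
  qed
  finally have "P ^ (m + a) dvd int (fact k) * (dpow (u \<oplus>\<^bsub>Z\<^esub> v) k M - S M)"
    by (simp add: M_def cong_iff_dvd_diff right_diff_distrib)
  then have "[dpow (u \<oplus>\<^bsub>Z\<^esub> v) k M = S M] (mod P ^ m)"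
    unfolding cong_iff_dvd_diff by (rule cancel_multiple[OF ac])
  moreover have "[dpow (u \<oplus>\<^bsub>Z\<^esub> v) k M = dpow (u \<oplus>\<^bsub>Z\<^esub> v) k m] (mod P ^ m)"
    by (rule Zp_coherent[OF dpow_closed[OF uv']]) (simp add: M_def)
  moreover have "[S M = S m] (mod P ^ m)"
    unfolding S_def M_def
    by (intro cong_sum cong_mult Zp_coherent dpow_closed u' v') simp_all
  ultimately show ?thesis
    unfolding S_def by (blast intro: cong_trans cong_sym)
qed

lemma padic_exp:
  assumes u: "in_pZp u"
  shows padic_exp_closed: "padic_exp p u \<in> carrier Z"
    and padic_exp_component: "2 * m \<le> N \<Longrightarrow> [padic_exp p u m = (\<Sum>k<N. dpow u k m)] (mod P ^ m)"
  unfolding padic_exp_def dpow_def[symmetric]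
  using padic_suminf_component[of "dpow u"] dpow_closed[OF in_pZpD[OF u]]
    dpow_vanishes[OF in_pZpD[OF u]] by auto

lemma padic_exp_mod_p:
  assumes u: "in_pZp u"
  shows "[padic_exp p u 1 = 1] (mod P)"
proof -
  have "[padic_exp p u 1 = (\<Sum>k<2. dpow u k 1)] (mod P ^ 1)"
    by (rule padic_exp_component[OF u]) simp
  also have "(\<Sum>k<2. dpow u k 1) = \<one>\<^bsub>Z\<^esub> 1"
    using dpow_vanishes[OF in_pZpD[OF u], of 1 1] by (simp add: numeral_2_eq_2 dpow_0)
  also have "[\<one>\<^bsub>Z\<^esub> 1 = 1] (mod P ^ 1)" by (rule Zp_one)
  finally show ?thesis by simp
qed

text \<open>
  This is the Cauchy product.  At precision \<open>m\<close> all divided powers from \<open>2 m\<close> on vanish, so the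
  triangle \<open>i + j < 4 m\<close> and the square \<open>i, j < 2 m\<close> carry the same sum.
\<close>

lemma padic_exp_add:
  assumes u: "in_pZp u" and v: "in_pZp v"
  shows "padic_exp p (u \<oplus>\<^bsub>Z\<^esub> v) = padic_exp p u \<otimes>\<^bsub>Z\<^esub> padic_exp p v"
proof (rule Zp_eqI)
  note uv = in_pZp_add[OF u v]
  show "padic_exp p (u \<oplus>\<^bsub>Z\<^esub> v) \<in> carrier Z" by (rule padic_exp_closed[OF uv])
  show "padic_exp p u \<otimes>\<^bsub>Z\<^esub> padic_exp p v \<in> carrier Z"
    by (intro Zp.m_closed padic_exp_closed u v)
  fix m
  have zero: "dpow u k m = 0" "dpow v k m = 0" if "2 * m \<le> k" for k
    using dpow_vanishes[OF in_pZpD[OF u]] dpow_vanishes[OF in_pZpD[OF v]] that by auto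
  define f where "f i j = dpow u i m * dpow v j m" for i j
  have "[padic_exp p (u \<oplus>\<^bsub>Z\<^esub> v) m = (\<Sum>k<4 * m. dpow (u \<oplus>\<^bsub>Z\<^esub> v) k m)] (mod P ^ m)"
    by (rule padic_exp_component[OF uv]) simp
  also have "[(\<Sum>k<4 * m. dpow (u \<oplus>\<^bsub>Z\<^esub> v) k m) = (\<Sum>k<4 * m. \<Sum>i\<le>k. f i (k - i))] (mod P ^ m)"
    unfolding f_def by (intro cong_sum dpow_add u v)
  also have "(\<Sum>k<4 * m. \<Sum>i\<le>k. f i (k - i)) = (\<Sum>(i, j)\<in>{(i, j). i + j < 4 * m}. f i j)"
    by (rule sum.triangle_reindex[symmetric])
  also have "\<dots> = (\<Sum>(i, j)\<in>{..<2 * m} \<times> {..<2 * m}. f i j)"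
  proof (rule sum.mono_neutral_right)
    show "finite {(i, j). i + j < 4 * m}"
      by (rule finite_subset[of _ "{..<4 * m} \<times> {..<4 * m}"]) auto
    show "\<forall>ij \<in> {(i, j). i + j < 4 * m} - {..<2 * m} \<times> {..<2 * m}. (case ij of (i, j) \<Rightarrow> f i j) = 0"
      using zero by (auto simp: f_def) (metis not_less)+
  qed auto
  also have "\<dots> = (\<Sum>i<2 * m. dpow u i m) * (\<Sum>j<2 * m. dpow v j m)"
    by (simp add: f_def sum_product sum.cartesian_product)
  also have "[\<dots> = padic_exp p u m * padic_exp p v m] (mod P ^ m)"
    by (intro cong_mult cong_sym[OF padic_exp_component] u v) simp_all
  also have "[padic_exp p u m * padic_exp p v m = (padic_exp p u \<otimes>\<^bsub>Z\<^esub> padic_exp p v) m] (mod P ^ m)"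
    by (rule cong_sym[OF Zp_mult])
  finally show "[padic_exp p (u \<oplus>\<^bsub>Z\<^esub> v) m = (padic_exp p u \<otimes>\<^bsub>Z\<^esub> padic_exp p v) m] (mod P ^ m)" .
qed

lemma padic_exp_nat_mult:
  fixes N :: nat
  assumes u: "in_pZp u" and N: "N \<ge> 1"
  shows "padic_exp p ([N] \<cdot>\<^bsub>Z\<^esub> u) = padic_exp p u [^]\<^bsub>Z\<^esub> N"
  using N
proof (induction N rule: dec_induct)
  case base
  then show ?case using in_pZpD[OF u] padic_exp_closed[OF u] by (simp add: Zp.add.nat_pow_eone)
next
  case (step N)
  have "[Suc N] \<cdot>\<^bsub>Z\<^esub> u = [N] \<cdot>\<^bsub>Z\<^esub> u \<oplus>\<^bsub>Z\<^esub> u"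
    using in_pZpD[OF u] by (simp add: Zp.add.nat_pow_Suc)
  then show ?case using step padic_exp_add[OF in_pZp_nat_mult[OF u] u] by simp
qed

text \<open>
  For \<open>k \<ge> 2\<close> the divided power \<open>(p\<^sup>j u)\<^sup>k / k! = p\<^sup>j\<^sup>k (u\<^sup>k / k!)\<close> is a multiple of \<open>p\<^sup>2\<^sup>j\<close>.
\<close>

lemma padic_exp_small:
  assumes u: "in_pZp u"
  shows "[padic_exp p ([(p ^ j)] \<cdot>\<^bsub>Z\<^esub> u) (2 * j) = 1 + P ^ j * u (2 * j)] (mod P ^ (2 * j))"
proof -
  define w where "w = [(p ^ j)] \<cdot>\<^bsub>Z\<^esub> u"
  note u' = in_pZpD[OF u]
  have w: "in_pZp w" unfolding w_def by (rule in_pZp_nat_mult[OF u])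
  have small: "[dpow w k (2 * j) = 0] (mod P ^ (2 * j))" if k: "k \<ge> 2" for k
  proof -
    have "dpow w k = [(p ^ (j * k))] \<cdot>\<^bsub>Z\<^esub> dpow u k"
    proof (rule dpow_eqI)
      show "[(p ^ (j * k))] \<cdot>\<^bsub>Z\<^esub> dpow u k \<in> carrier Z" using dpow_closed[OF u'] by simp
      have "[(fact k :: nat)] \<cdot>\<^bsub>Z\<^esub> ([(p ^ (j * k))] \<cdot>\<^bsub>Z\<^esub> dpow u k)
          = [(p ^ (j * k))] \<cdot>\<^bsub>Z\<^esub> ([(fact k :: nat)] \<cdot>\<^bsub>Z\<^esub> dpow u k)"
        using dpow_closed[OF u'] by (simp add: Zp.add.nat_pow_pow mult.commute)
      also have "\<dots> = [(p ^ (j * k))] \<cdot>\<^bsub>Z\<^esub> (u [^]\<^bsub>Z\<^esub> k)" by (simp only: fact_dpow[OF u'])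
      also have "\<dots> = w [^]\<^bsub>Z\<^esub> k"
      proof (rule Zp_eqI)
        show "[(p ^ (j * k))] \<cdot>\<^bsub>Z\<^esub> (u [^]\<^bsub>Z\<^esub> k) \<in> carrier Z" using u' by simp
        show "w [^]\<^bsub>Z\<^esub> k \<in> carrier Z" using in_pZpD[OF w] by simp
        fix m
        have "[([(p ^ (j * k))] \<cdot>\<^bsub>Z\<^esub> (u [^]\<^bsub>Z\<^esub> k)) m = int (p ^ (j * k)) * (u [^]\<^bsub>Z\<^esub> k) m] (mod P ^ m)"
          by (rule Zp_nat_mult)
        also have "[int (p ^ (j * k)) * (u [^]\<^bsub>Z\<^esub> k) m = int (p ^ (j * k)) * u m ^ k] (mod P ^ m)"
          by (intro cong_mult cong_refl Zp_pow)
        also have "int (p ^ (j * k)) * u m ^ k = (int (p ^ j) * u m) ^ k"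
          by (simp add: power_mult power_mult_distrib)
        also have "[\<dots> = w m ^ k] (mod P ^ m)"
          unfolding w_def by (intro cong_pow cong_sym[OF Zp_nat_mult])
        also have "[w m ^ k = (w [^]\<^bsub>Z\<^esub> k) m] (mod P ^ m)" by (rule cong_sym[OF Zp_pow])
        finally show "[([(p ^ (j * k))] \<cdot>\<^bsub>Z\<^esub> (u [^]\<^bsub>Z\<^esub> k)) m = (w [^]\<^bsub>Z\<^esub> k) m] (mod P ^ m)" .
      qed
      finally show "[(fact k :: nat)] \<cdot>\<^bsub>Z\<^esub> ([(p ^ (j * k))] \<cdot>\<^bsub>Z\<^esub> dpow u k) = w [^]\<^bsub>Z\<^esub> k" .
    qed
    then have "[dpow w k (2 * j) = P ^ (j * k) * dpow u k (2 * j)] (mod P ^ (2 * j))"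
      using Zp_nat_mult[of "p ^ (j * k)" "dpow u k" "2 * j"] by simp
    moreover have "P ^ (2 * j) dvd P ^ (j * k)"
      using k by (intro le_imp_power_dvd) (simp add: mult.commute)
    ultimately show ?thesis by (meson cong_0_iff cong_dvd_iff dvd_mult2)
  qed
  \<comment> \<open>Two terms more than the precision requires, so that those for 0 and 1 can be split off if j is 0.\<close>
  have "[padic_exp p w (2 * j) = (\<Sum>k<4 * j + 2. dpow w k (2 * j))] (mod P ^ (2 * j))"
    by (rule padic_exp_component[OF w]) simp
  also have "(\<Sum>k<4 * j + 2. dpow w k (2 * j))
      = dpow w 0 (2 * j) + (dpow w 1 (2 * j) + (\<Sum>k<4 * j. dpow w (Suc (Suc k)) (2 * j)))"
    by (simp add: sum.lessThan_Suc_shift del: sum.lessThan_Suc)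
  also have "[\<dots> = 1 + (P ^ j * u (2 * j) + (\<Sum>k<4 * j. 0))] (mod P ^ (2 * j))"
  proof (intro cong_add cong_sum small)
    show "[dpow w 0 (2 * j) = 1] (mod P ^ (2 * j))" by (simp add: dpow_0 Zp_one)
    show "[dpow w 1 (2 * j) = P ^ j * u (2 * j)] (mod P ^ (2 * j))"
      using Zp_nat_mult[of "p ^ j" u "2 * j"] in_pZpD[OF w] by (simp add: dpow_1[simplified] w_def)
  qed simp
  finally show ?thesis by (simp add: w_def)
qed

text \<open>
  The left-hand side is the falling factorial \<open>M (M - 1) \<dots> (M - k)\<close>, and each \<open>M - i\<close> is \<open>-i\<close> modulo \<open>M\<close>.
\<close>

lemma falling_factorial_cong:
  "[int (M choose Suc k) * fact (Suc k) = int M * ((- 1) ^ k * fact k)] (mod int M ^ 2)"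
proof (induction k)
  case (Suc k)
  have rec: "int (M choose Suc (Suc k)) * fact (Suc (Suc k))
      = (int M - int (Suc k)) * (int (M choose Suc k) * fact (Suc k))"
  proof -
    have "Suc (Suc k) * (M choose Suc (Suc k)) = (M - Suc k) * (M choose Suc k)"
      using binomial_absorption[of "Suc k" M] binomial_absorb_comp[of M "Suc k"] by simp
    then have "int (Suc (Suc k) * (M choose Suc (Suc k))) = int ((M - Suc k) * (M choose Suc k))"
      by (simp only:)
    also have "\<dots> = (int M - int (Suc k)) * int (M choose Suc k)"
      by (cases "Suc k \<le> M") (auto simp: of_nat_diff binomial_eq_0)
    finally have "int (Suc (Suc k)) * int (M choose Suc (Suc k))
        = (int M - int (Suc k)) * int (M choose Suc k)" by (simp only: of_nat_mult)
    moreover have "fact (Suc (Suc k)) = int (Suc (Suc k)) * fact (Suc k)" by simp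
    ultimately show ?thesis by (simp only: mult_ac)
  qed
  have "[(int M - int (Suc k)) * (int (M choose Suc k) * fact (Suc k))
      = (int M - int (Suc k)) * (int M * ((- 1) ^ k * fact k))] (mod int M ^ 2)"
    by (rule cong_mult[OF cong_refl Suc])
  also have "(int M - int (Suc k)) * (int M * ((- 1) ^ k * fact k))
      = int M * ((- 1) ^ Suc k * fact (Suc k)) + int M ^ 2 * ((- 1) ^ k * fact k)"
    by (simp add: algebra_simps power2_eq_square)
  also have "[\<dots> = int M * ((- 1) ^ Suc k * fact (Suc k))] (mod int M ^ 2)"
    by (simp only: cong_iff_dvd_diff add_diff_cancel_left' dvd_triv_left)
  finally show ?case by (simp only: rec)
qed simp

text \<open>
  The approximation expresses that \<open>log a\<close> is the derivative of \<open>N \<mapsto> a\<^sup>N\<close> at 0.  In the binomial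
  expansion of \<open>(1 + t)\<^sup>M - 1\<close> with \<open>M = p\<^sup>j\<close>, the term \<open>(M choose k) t\<^sup>k\<close> is the divided power
  \<open>t\<^sup>k / k!\<close> times a falling factorial, and modulo \<open>M\<^sup>2\<close> the latter is \<open>M (-1)\<^sup>k\<^sup>-\<^sup>1 (k - 1)!\<close>; hence
  the expansion is \<open>M\<close> times the logarithmic series.
\<close>

lemma padic_log:
  assumes a: "a \<in> carrier Z" "[a 1 = 1] (mod P)"
  shows padic_log_in_pZp: "in_pZp (padic_log p a)"
    and padic_log_approx:
      "[P ^ j * padic_log p a (2 * j) = a (2 * j) ^ (p ^ j) - 1] (mod P ^ (2 * j))"
proof -
  define t where "t = a \<ominus>\<^bsub>Z\<^esub> \<one>\<^bsub>Z\<^esub>"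
  have t_cong: "[t m = a m - 1] (mod P ^ m)" for m
  proof -
    have "[t m = a m - \<one>\<^bsub>Z\<^esub> m] (mod P ^ m)"
      unfolding t_def using a by (intro Zp_minus) auto
    also have "[a m - \<one>\<^bsub>Z\<^esub> m = a m - 1] (mod P ^ m)" by (intro cong_diff cong_refl Zp_one)
    finally show ?thesis .
  qed
  have t: "in_pZp t"
    using a t_cong[of 1] cong_dvd_iff[of "t 1" "a 1 - 1" P]
    by (simp add: in_pZp_iff t_def cong_iff_dvd_diff)
  note t' = in_pZpD[OF t]
  define f where "f k = (\<ominus>\<^bsub>Z\<^esub> \<one>\<^bsub>Z\<^esub>) [^]\<^bsub>Z\<^esub> k \<otimes>\<^bsub>Z\<^esub> padic_quot p (t [^]\<^bsub>Z\<^esub> Suc k) (Suc k)" for k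
  have quot: "padic_quot p (t [^]\<^bsub>Z\<^esub> Suc k) (Suc k) = [(fact k :: nat)] \<cdot>\<^bsub>Z\<^esub> dpow t (Suc k)" for k
  proof (rule padic_quot_eqI)
    show "[(fact k :: nat)] \<cdot>\<^bsub>Z\<^esub> dpow t (Suc k) \<in> carrier Z" using dpow_closed[OF t'] by simp
    have "[Suc k] \<cdot>\<^bsub>Z\<^esub> ([(fact k :: nat)] \<cdot>\<^bsub>Z\<^esub> dpow t (Suc k)) = [(fact (Suc k) :: nat)] \<cdot>\<^bsub>Z\<^esub> dpow t (Suc k)"
      using dpow_closed[OF t'] by (simp only: Zp.add.nat_pow_pow fact_Suc of_nat_id mult.commute)
    then show "[Suc k] \<cdot>\<^bsub>Z\<^esub> ([(fact k :: nat)] \<cdot>\<^bsub>Z\<^esub> dpow t (Suc k)) = t [^]\<^bsub>Z\<^esub> Suc k"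
      using fact_dpow[OF t', of "Suc k"] by (simp only:)
  qed simp
  have f_closed: "f k \<in> carrier Z" for k
    unfolding f_def quot using dpow_closed[OF t'] by simp
  have f_cong: "[f k m = (- 1) ^ k * (fact k * dpow t (Suc k) m)] (mod P ^ m)" for k m
  proof -
    have "[(\<ominus>\<^bsub>Z\<^esub> \<one>\<^bsub>Z\<^esub>) m = - 1] (mod P ^ m)"
    proof -
      have "\<zero>\<^bsub>Z\<^esub> \<ominus>\<^bsub>Z\<^esub> \<one>\<^bsub>Z\<^esub> = \<ominus>\<^bsub>Z\<^esub> \<one>\<^bsub>Z\<^esub>" by (simp add: Zp.minus_eq)
      then have "[(\<ominus>\<^bsub>Z\<^esub> \<one>\<^bsub>Z\<^esub>) m = 0 - \<one>\<^bsub>Z\<^esub> m] (mod P ^ m)"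
        using Zp_minus[of "\<zero>\<^bsub>Z\<^esub>" "\<one>\<^bsub>Z\<^esub>" m] by (simp add: Zp_zero)
      also have "[0 - \<one>\<^bsub>Z\<^esub> m = 0 - 1] (mod P ^ m)" by (intro cong_diff cong_refl Zp_one)
      finally show ?thesis by simp
    qed
    then have "[((\<ominus>\<^bsub>Z\<^esub> \<one>\<^bsub>Z\<^esub>) [^]\<^bsub>Z\<^esub> k) m = (- 1) ^ k] (mod P ^ m)"
      by (rule cong_trans[OF Zp_pow cong_pow])
    moreover have "[([(fact k :: nat)] \<cdot>\<^bsub>Z\<^esub> dpow t (Suc k)) m = int (fact k) * dpow t (Suc k) m] (mod P ^ m)"
      by (rule Zp_nat_mult)
    ultimately have "[((\<ominus>\<^bsub>Z\<^esub> \<one>\<^bsub>Z\<^esub>) [^]\<^bsub>Z\<^esub> k) m * ([(fact k :: nat)] \<cdot>\<^bsub>Z\<^esub> dpow t (Suc k)) m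
        = (- 1) ^ k * (int (fact k) * dpow t (Suc k) m)] (mod P ^ m)" by (rule cong_mult)
    then show ?thesis unfolding f_def quot using cong_trans[OF Zp_mult] by simp
  qed
  have f_vanish: "f k m = 0" if "2 * m \<le> k + 2" for k m
  proof -
    have "dpow t (Suc k) m = 0" using that by (intro dpow_vanishes[OF t']) simp
    then have "P ^ m dvd f k m" using f_cong[of k m] by (simp add: cong_0_iff)
    then show ?thesis using Zp_component_eq_0_iff[OF f_closed] by blast
  qed
  have log: "padic_log p a = padic_suminf p f"
    unfolding padic_log_def f_def t_def ..
  have log_closed: "padic_log p a \<in> carrier Z"
    and log_cong: "2 * m \<le> N \<Longrightarrow> [padic_log p a m = (\<Sum>k<N. f k m)] (mod P ^ m)" for m N
    unfolding log using padic_suminf_component[of f] f_closed f_vanish by auto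
  have "[padic_log p a 1 = (\<Sum>k<2. f k 1)] (mod P ^ 1)" by (rule log_cong) simp
  moreover have "(\<Sum>k<2. f k 1) = 0" by (intro sum.neutral) (auto intro: f_vanish)
  ultimately show "in_pZp (padic_log p a)" using log_closed by (simp add: in_pZp_iff cong_0_iff)

  define M where "M = p ^ j"
  define m where "m = 2 * j"
  \<comment> \<open>Enough terms for the logarithmic series at precision m and for the whole binomial expansion.\<close>
  define N where "N = max M (2 * m)"
  have M2: "P ^ m = int M ^ 2" by (simp add: M_def m_def power_mult[symmetric] mult.commute)
  have "[int M * padic_log p a m = int M * (\<Sum>k<N. f k m)] (mod P ^ m)"
    by (intro cong_mult cong_refl log_cong) (simp add: N_def)
  also have "[int M * (\<Sum>k<N. f k m) = int M * (\<Sum>k<N. (- 1) ^ k * (fact k * dpow t (Suc k) m))] (mod P ^ m)"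
    by (intro cong_mult cong_refl cong_sum f_cong)
  also have "int M * (\<Sum>k<N. (- 1) ^ k * (fact k * dpow t (Suc k) m))
      = (\<Sum>k<N. int M * ((- 1) ^ k * fact k) * dpow t (Suc k) m)"
    by (simp add: sum_distrib_left mult.assoc)
  also have "[\<dots> = (\<Sum>k<N. int (M choose Suc k) * fact (Suc k) * dpow t (Suc k) m)] (mod P ^ m)"
    unfolding M2 by (intro cong_sum cong_mult cong_refl cong_sym[OF falling_factorial_cong])
  also have "(\<Sum>k<N. int (M choose Suc k) * fact (Suc k) * dpow t (Suc k) m)
      = (\<Sum>k<N. int (M choose Suc k) * (fact (Suc k) * dpow t (Suc k) m))"
    by (simp only: mult.assoc)
  also have "[\<dots> = (\<Sum>k<N. int (M choose Suc k) * t m ^ Suc k)] (mod P ^ m)"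
    by (intro cong_sum cong_mult cong_refl fact_dpow_component[OF t'])
  also have "(\<Sum>k<N. int (M choose Suc k) * t m ^ Suc k) = (\<Sum>k<M. int (M choose Suc k) * t m ^ Suc k)"
    by (rule sum.mono_neutral_right) (auto simp: N_def binomial_eq_0)
  also have "\<dots> = (t m + 1) ^ M - 1"
  proof -
    have "(t m + 1) ^ M = (\<Sum>k\<le>M. int (M choose k) * t m ^ k)"
      using binomial_ring[of "t m" 1 M] by simp
    also have "\<dots> = 1 + (\<Sum>k<M. int (M choose Suc k) * t m ^ Suc k)"
      by (subst sum.atMost_shift) simp
    finally show ?thesis by simp
  qed
  also have "[\<dots> = a m ^ M - 1] (mod P ^ m)"
  proof (intro cong_diff cong_pow cong_refl)
    have "[t m + 1 = a m - 1 + 1] (mod P ^ m)" by (rule cong_add[OF t_cong cong_refl])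
    then show "[t m + 1 = a m] (mod P ^ m)" by simp
  qed
  finally show "[P ^ j * padic_log p a (2 * j) = a (2 * j) ^ (p ^ j) - 1] (mod P ^ (2 * j))"
    by (simp add: M_def m_def)
qed

text \<open>
  The power \<open>exp (w log a)\<close> is the continuous extension of \<open>k \<mapsto> a\<^sup>k\<close>.  Instead of composing the two
  series, compare \<open>p\<^sup>j\<close>-th powers modulo \<open>p\<^sup>2\<^sup>j\<close>: for \<open>B = exp (w log a)\<close> and \<open>M = p\<^sup>j\<close> the power
  \<open>B\<^sup>M = exp (M w log a)\<close> is congruent to \<open>1 + w M log a\<close> and to \<open>1 + w (a\<^sup>M - 1)\<close>, while \<open>(a\<^sup>k)\<^sup>M\<close> is
  congruent to \<open>1 + k (a\<^sup>M - 1)\<close>; these agree because \<open>p\<^sup>j\<close> divides both \<open>w - k\<close> and \<open>a\<^sup>M - 1\<close>.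
  By lifting the exponent, congruent \<open>p\<^sup>j\<close>-th powers modulo \<open>p\<^sup>2\<^sup>j\<close> have congruent
  bases modulo \<open>p\<^sup>j\<close>.
\<close>

lemma exp_log_component:
  assumes a: "a \<in> carrier Z" "[a 1 = 1] (mod P)"
    and w: "w \<in> carrier Z" "[w j = int k] (mod P ^ j)"
  shows "[padic_exp p (w \<otimes>\<^bsub>Z\<^esub> padic_log p a) j = a j ^ k] (mod P ^ j)"
proof (cases "j = 0")
  case False
  define M where "M = p ^ j"
  define m where "m = 2 * j"
  define u where "u = w \<otimes>\<^bsub>Z\<^esub> padic_log p a"
  define B where "B = padic_exp p u"
  have u: "in_pZp u" unfolding u_def by (intro in_pZp_mult w padic_log_in_pZp a)
  have B: "B \<in> carrier Z" unfolding B_def by (rule padic_exp_closed[OF u])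
  have mj: "1 \<le> m" "j \<le> m" using False by (simp_all add: m_def)
  have unit: "\<not> P dvd c" if "[c = 1] (mod P)" for c
  proof
    assume "P dvd c"
    then have "P dvd 1" using cong_dvd_iff[of c 1 P] that by simp
    then show False using p_ge_3 by simp
  qed
  have am: "[a m = 1] (mod P)" using Zp_coherent[OF a(1) mj(1)] a(2) by (auto intro: cong_trans)
  have Bm: "[B m = 1] (mod P)"
    using Zp_coherent[OF B mj(1)] padic_exp_mod_p[OF u] by (auto simp: B_def intro: cong_trans)
  have d: "P ^ j dvd a m ^ M - 1"
  proof -
    have "a m ^ M - 1 ^ M \<asymp> int M * (a m - 1)"
      using am p_ge_3 by (intro lifting_the_exponent) auto
    moreover have "P ^ j dvd int M * (a m - 1)" by (simp add: M_def)
    ultimately show ?thesis by (simp add: equiv_val_dvd_iff)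
  qed
  have split: "P ^ m = P ^ j * P ^ j" by (simp add: m_def power_add[symmetric] mult_2)
  have "[B m ^ M = (B [^]\<^bsub>Z\<^esub> M) m] (mod P ^ m)" by (rule cong_sym[OF Zp_pow])
  also have "B [^]\<^bsub>Z\<^esub> M = padic_exp p ([M] \<cdot>\<^bsub>Z\<^esub> u)"
    unfolding B_def using p_ge_3 by (intro padic_exp_nat_mult[symmetric] u) (simp add: M_def Suc_le_eq)
  also have "[padic_exp p ([M] \<cdot>\<^bsub>Z\<^esub> u) m = 1 + P ^ j * u m] (mod P ^ m)"
    unfolding M_def m_def by (rule padic_exp_small[OF u])
  also have "[1 + P ^ j * u m = 1 + P ^ j * (w m * padic_log p a m)] (mod P ^ m)"
    unfolding u_def by (intro cong_add cong_mult cong_refl Zp_mult)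
  also have "1 + P ^ j * (w m * padic_log p a m) = 1 + w m * (P ^ j * padic_log p a m)"
    by simp
  also have "[\<dots> = 1 + w m * (a m ^ M - 1)] (mod P ^ m)"
    unfolding m_def M_def by (intro cong_add cong_mult cong_refl padic_log_approx a)
  also have "[1 + w m * (a m ^ M - 1) = 1 + int k * (a m ^ M - 1)] (mod P ^ m)"
  proof -
    have "[w m = int k] (mod P ^ j)" using Zp_coherent[OF w(1) mj(2)] w(2) by (rule cong_trans)
    then have "P ^ m dvd (w m - int k) * (a m ^ M - 1)"
      unfolding split using d by (intro mult_dvd_mono) (auto simp: cong_iff_dvd_diff)
    then show ?thesis by (simp add: cong_iff_dvd_diff algebra_simps)
  qed
  also have "[1 + int k * (a m ^ M - 1) = (a m ^ M) ^ k] (mod P ^ m)"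
  proof (induction k)
    case (Suc k)
    have "[(a m ^ M) ^ k * a m ^ M = (1 + int k * (a m ^ M - 1)) * a m ^ M] (mod P ^ m)"
      by (rule cong_mult[OF cong_sym[OF Suc] cong_refl])
    also have "(1 + int k * (a m ^ M - 1)) * a m ^ M
        = 1 + int (Suc k) * (a m ^ M - 1) + int k * ((a m ^ M - 1) * (a m ^ M - 1))"
      by (simp add: algebra_simps)
    also have "[\<dots> = 1 + int (Suc k) * (a m ^ M - 1) + 0] (mod P ^ m)"
      unfolding split using d by (intro cong_add cong_refl) (simp add: cong_0_iff mult_dvd_mono)
    finally show ?case by (simp add: cong_sym mult.commute)
  qed simp
  also have "(a m ^ M) ^ k = (a m ^ k) ^ M" by (simp add: power_mult[symmetric] mult.commute)
  finally have "P ^ m dvd B m ^ M - (a m ^ k) ^ M" by (simp add: cong_iff_dvd_diff)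
  moreover have ak: "[a m ^ k = 1] (mod P)" using cong_pow[OF am, of k] by simp
  have "B m ^ M - (a m ^ k) ^ M \<asymp> int M * (B m - a m ^ k)"
    using Bm ak unit by (intro lifting_the_exponent) (auto intro: cong_trans cong_sym)
  ultimately have "P ^ m dvd int M * (B m - a m ^ k)"
    using equiv_val_dvd_iff by blast
  then have "P ^ j * P ^ j dvd P ^ j * (B m - a m ^ k)" by (simp add: split M_def)
  then have "[B m = a m ^ k] (mod P ^ j)"
    using p_ge_3 by (simp add: cong_iff_dvd_diff)
  moreover have "[B m = B j] (mod P ^ j)" "[a m ^ k = a j ^ k] (mod P ^ j)"
    by (intro Zp_coherent B mj cong_pow a)+
  ultimately have "[B j = a j ^ k] (mod P ^ j)" by (blast intro: cong_trans cong_sym)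
  then show ?thesis by (simp add: B_def u_def)
qed simp

end

section \<open>Roots of unity and p-adic 2-cycles\<close>

context odd_prime
begin

lemma root_of_unity_component:
  assumes "w [^]\<^bsub>Z\<^esub> (p - 1) = \<one>\<^bsub>Z\<^esub>"
  shows "[w m ^ (p - 1) = 1] (mod P ^ m)"
  using cong_trans[OF cong_sym[OF Zp_pow[of w "p - 1" m]]] Zp_one[of m] assms by simp

lemma roots_of_unity_eqI:
  assumes w: "w \<in> carrier Z" "w [^]\<^bsub>Z\<^esub> (p - 1) = \<one>\<^bsub>Z\<^esub>"
    and w': "w' \<in> carrier Z" "w' [^]\<^bsub>Z\<^esub> (p - 1) = \<one>\<^bsub>Z\<^esub>"
    and eq: "w 1 = w' 1" "w' 1 \<noteq> 0"
  shows "w = w'"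
proof (rule Zp_eqI[OF w(1) w'(1)])
  fix m
  show "[w m = w' m] (mod P ^ m)"
  proof (cases "m = 0")
    case False
    then have 1: "[w m = w 1] (mod P)" "[w' m = w' 1] (mod P)"
      using Zp_coherent[OF w(1), of 1 m] Zp_coherent[OF w'(1), of 1 m] by auto
    have "\<not> P dvd w' m"
      using eq(2) Zp_component_eq_0_iff[OF w'(1), of 1] cong_dvd_iff[OF 1(2)] by simp
    moreover have "[w m = w' m] (mod P)" using 1 eq(1) by (metis cong_sym cong_trans)
    moreover have "P ^ m dvd unit_defect (w m)" "P ^ m dvd unit_defect (w' m)"
      using root_of_unity_component[OF w(2), of m] root_of_unity_component[OF w'(2), of m]
      by (simp_all add: unit_defect_def cong_iff_dvd_diff)
    ultimately show ?thesis by (intro cong_if_unit_defects_divisible)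
  qed simp
qed

text \<open>
  The residues \<open>r\<close> to the power \<open>p\<^sup>s\<close> are compatible for varying \<open>s\<close>, since two approximate roots
  of unity that agree modulo \<open>p\<close> agree to the precision to which they are roots of unity.
\<close>

lemma root_of_unity_exists:
  assumes r: "r \<in> {0<..<p}"
  shows "\<exists>w \<in> carrier Z. w [^]\<^bsub>Z\<^esub> (p - 1) = \<one>\<^bsub>Z\<^esub> \<and> w 1 = int r"
proof -
  note nr = nat_in_range_not_dvd[OF r]
  define t where "t s = int (r ^ (p ^ s))" for s
  have t_r: "[t s = int r] (mod P)" and t_root: "P ^ s dvd unit_defect (t s)" for s
  proof -
    have "[t s = int r] (mod P) \<and> P ^ s dvd unit_defect (t s)"
      using exists_root_of_unity_lift[OF nr, of s]
      by (cases "s = 0") (auto simp: t_def cong_int_iff simp del: of_nat_power)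
    then show "[t s = int r] (mod P)" "P ^ s dvd unit_defect (t s)" by auto
  qed
  have t_unit: "\<not> P dvd t s" for s
    using cong_dvd_iff[OF t_r] nr by simp
  define w where "w s = t s mod P ^ s" for s
  have w_t: "[w s = t s] (mod P ^ s)" for s by (simp add: w_def cong_def)
  have w: "w \<in> carrier Z"
  proof (rule Zp_carrierI)
    fix s
    show "0 \<le> w s \<and> w s < P ^ s" using P_power_pos by (simp add: w_def)
    have "[w (Suc s) = t (Suc s)] (mod P ^ s)"
      using w_t[of "Suc s"] by (rule cong_dvd_modulus) simp
    also have "[t (Suc s) = t s] (mod P ^ s)"
    proof (rule cong_if_unit_defects_divisible[OF _ t_unit _ t_root])
      show "[t (Suc s) = t s] (mod P)" using t_r cong_sym cong_trans by blast
      show "P ^ s dvd unit_defect (t (Suc s))"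
        using t_root[of "Suc s"] by (rule dvd_trans[rotated]) simp
    qed
    also have "[t s = w s] (mod P ^ s)" by (rule cong_sym[OF w_t])
    finally show "[w (Suc s) = w s] (mod P ^ s)" .
  qed
  moreover have "w [^]\<^bsub>Z\<^esub> (p - 1) = \<one>\<^bsub>Z\<^esub>"
  proof (rule Zp_eqI)
    fix s
    have "[(w [^]\<^bsub>Z\<^esub> (p - 1)) s = w s ^ (p - 1)] (mod P ^ s)" by (rule Zp_pow)
    also have "[w s ^ (p - 1) = t s ^ (p - 1)] (mod P ^ s)" by (rule cong_pow[OF w_t])
    also have "[t s ^ (p - 1) = 1] (mod P ^ s)"
      using t_root by (simp add: unit_defect_def cong_iff_dvd_diff)
    also have "[1 = \<one>\<^bsub>Z\<^esub> s] (mod P ^ s)" by (rule cong_sym[OF Zp_one])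
    finally show "[(w [^]\<^bsub>Z\<^esub> (p - 1)) s = \<one>\<^bsub>Z\<^esub> s] (mod P ^ s)" .
  qed (use w in auto)
  moreover have "w 1 = int r"
  proof -
    have "[w 1 = int r] (mod P)" using w_t[of 1] t_r[of 1] cong_trans by auto
    then show ?thesis using Zp_range[OF w, of 1] r by (simp add: cong_def)
  qed
  ultimately show ?thesis by blast
qed

lemma p_dvd_minus_iff:
  assumes "w \<in> carrier Z" "x \<in> carrier Z"
  shows "p_dvd p (w \<ominus>\<^bsub>Z\<^esub> x) \<longleftrightarrow> w 1 = x 1"
proof -
  have closed: "w \<ominus>\<^bsub>Z\<^esub> x \<in> carrier Z" using assms by simp
  have "p_dvd p (w \<ominus>\<^bsub>Z\<^esub> x) \<longleftrightarrow> P dvd (w \<ominus>\<^bsub>Z\<^esub> x) 1"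
    using p_dvd_iff[OF closed] Zp_component_eq_0_iff[OF closed, of 1] by simp
  also have "\<dots> \<longleftrightarrow> P dvd w 1 - x 1"
    using Zp_minus[OF assms, of 1] by (intro cong_dvd_iff) simp
  also have "\<dots> \<longleftrightarrow> w 1 = x 1"
    using Zp_range[OF assms(1), of 1] Zp_range[OF assms(2), of 1]
    by (simp add: cong_def flip: cong_iff_dvd_diff)
  finally show ?thesis .
qed

lemma teichmueller_eqI:
  assumes x: "x \<in> carrier Z" "x 1 \<noteq> 0"
    and w: "w \<in> carrier Z" "w [^]\<^bsub>Z\<^esub> (p - 1) = \<one>\<^bsub>Z\<^esub>" "w 1 = x 1"
  shows "teichmueller p x = w"
  unfolding teichmueller_def
proof (rule the_equality)
  show "w \<in> carrier Z \<and> w [^]\<^bsub>Z\<^esub> (p - 1) = \<one>\<^bsub>Z\<^esub> \<and> p_dvd p (w \<ominus>\<^bsub>Z\<^esub> x)"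
    using w x by (simp add: p_dvd_minus_iff)
  fix w' assume w': "w' \<in> carrier Z \<and> w' [^]\<^bsub>Z\<^esub> (p - 1) = \<one>\<^bsub>Z\<^esub> \<and> p_dvd p (w' \<ominus>\<^bsub>Z\<^esub> x)"
  then have "w' 1 = w 1" unfolding w(3) using p_dvd_minus_iff[of w' x] x(1) by blast
  moreover have "w 1 \<noteq> 0" unfolding w(3) by (rule x(2))
  ultimately show "w' = w" using w' w(1,2) roots_of_unity_eqI by blast
qed

lemma teichmueller:
  assumes x: "x \<in> carrier Z" "x 1 \<noteq> 0"
  shows teichmueller_root: "teichmueller p x [^]\<^bsub>Z\<^esub> (p - 1) = \<one>\<^bsub>Z\<^esub>"
    and one_unit_part_closed: "one_unit_part p x \<in> carrier Z"
    and one_unit_part_1: "[one_unit_part p x 1 = 1] (mod P)"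
    and teichmueller_decomposition: "x = teichmueller p x \<otimes>\<^bsub>Z\<^esub> one_unit_part p x"
proof -
  have "nat (x 1) \<in> {0<..<p}" using Zp_range[OF x(1), of 1] x(2) by auto
  from root_of_unity_exists[OF this]
  obtain w where w: "w \<in> carrier Z" "w [^]\<^bsub>Z\<^esub> (p - 1) = \<one>\<^bsub>Z\<^esub>" "w 1 = x 1"
    using Zp_range[OF x(1), of 1] by auto
  have eq: "teichmueller p x = w" by (rule teichmueller_eqI[OF x w])
  show "teichmueller p x [^]\<^bsub>Z\<^esub> (p - 1) = \<one>\<^bsub>Z\<^esub>"
    using w eq by auto
  have "w [^]\<^bsub>Z\<^esub> (p - 2) \<otimes>\<^bsub>Z\<^esub> w = \<one>\<^bsub>Z\<^esub>"
  proof -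
    have "p - 1 = Suc (p - 2)" using p_ge_3 by simp
    then show ?thesis using w(2) by simp
  qed
  then have unit: "w \<in> Units Z"
    using w(1) by (auto simp: Units_def Zp.m_comm intro!: bexI[of _ "w [^]\<^bsub>Z\<^esub> (p - 2)"])
  have a: "one_unit_part p x = x \<otimes>\<^bsub>Z\<^esub> inv\<^bsub>Z\<^esub> w" by (simp add: one_unit_part_def eq)
  show closed: "one_unit_part p x \<in> carrier Z" using unit x(1) by (simp add: a)
  have "w \<otimes>\<^bsub>Z\<^esub> (x \<otimes>\<^bsub>Z\<^esub> inv\<^bsub>Z\<^esub> w) = x \<otimes>\<^bsub>Z\<^esub> (w \<otimes>\<^bsub>Z\<^esub> inv\<^bsub>Z\<^esub> w)"
    using unit x(1) w(1) by (intro Zp.m_lcomm) auto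
  then show dec: "x = teichmueller p x \<otimes>\<^bsub>Z\<^esub> one_unit_part p x"
    using unit x(1) by (simp add: a eq)
  have "[w 1 * one_unit_part p x 1 = x 1] (mod P)"
    using Zp_mult[of w "one_unit_part p x" 1] dec by (simp add: eq cong_sym)
  then have "P dvd w 1 * (one_unit_part p x 1 - 1)"
    using w(3) by (simp add: cong_iff_dvd_diff right_diff_distrib)
  moreover have "\<not> P dvd w 1"
    unfolding w(3) using x(2) Zp_component_eq_0_iff[OF x(1), of 1] by simp
  ultimately show "[one_unit_part p x 1 = 1] (mod P)"
    by (simp add: dvd_mult_P cong_iff_dvd_diff)
qed

lemma one_unit_power_component:
  assumes x: "x \<in> carrier Z" "x 1 \<noteq> 0" and w: "w \<in> carrier Z" "[w j = int k] (mod P ^ j)"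
  shows "[one_unit_power p x w j = one_unit_part p x j ^ k] (mod P ^ j)"
  unfolding one_unit_power_def
  by (intro exp_log_component one_unit_part_closed one_unit_part_1 x w)

lemma one_unit_power_closed:
  assumes "x \<in> carrier Z" "x 1 \<noteq> 0" "w \<in> carrier Z"
  shows "one_unit_power p x w \<in> carrier Z"
  unfolding one_unit_power_def
  by (intro padic_exp_closed in_pZp_mult padic_log_in_pZp one_unit_part_closed one_unit_part_1 assms)

lemma teichmueller_of_root:
  assumes "x \<in> carrier Z" "x 1 \<noteq> 0" "x [^]\<^bsub>Z\<^esub> (p - 1) = \<one>\<^bsub>Z\<^esub>"
  shows "teichmueller p x = x"
  using assms by (intro teichmueller_eqI) auto

lemma one_unit_power_of_root:
  assumes x: "x \<in> carrier Z" "x 1 \<noteq> 0" "x [^]\<^bsub>Z\<^esub> (p - 1) = \<one>\<^bsub>Z\<^esub>" and w: "w \<in> carrier Z"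
  shows "one_unit_power p x w = \<one>\<^bsub>Z\<^esub>"
proof (rule Zp_eqI)
  show "one_unit_power p x w \<in> carrier Z" by (rule one_unit_power_closed[OF x(1,2) w])
  have "x [^]\<^bsub>Z\<^esub> (p - 2) \<otimes>\<^bsub>Z\<^esub> x = \<one>\<^bsub>Z\<^esub>"
  proof -
    have "p - 1 = Suc (p - 2)" using p_ge_3 by simp
    then show ?thesis using x(3) by simp
  qed
  then have "x \<in> Units Z"
    using x(1) by (auto simp: Units_def Zp.m_comm intro!: bexI[of _ "x [^]\<^bsub>Z\<^esub> (p - 2)"])
  then have one: "one_unit_part p x = \<one>\<^bsub>Z\<^esub>"
    by (simp add: one_unit_part_def teichmueller_of_root[OF x])
  fix j
  have "[w j = int (nat (w j))] (mod P ^ j)" using Zp_range[OF w, of j] by simp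
  then have "[one_unit_power p x w j = \<one>\<^bsub>Z\<^esub> j ^ nat (w j)] (mod P ^ j)"
    using one_unit_power_component[OF x(1,2) w] one by simp
  also have "[\<one>\<^bsub>Z\<^esub> j ^ nat (w j) = 1 ^ nat (w j)] (mod P ^ j)" by (rule cong_pow[OF Zp_one])
  also have "[1 ^ nat (w j) = \<one>\<^bsub>Z\<^esub> j] (mod P ^ j)" using cong_sym[OF Zp_one] by simp
  finally show "[one_unit_power p x w j = \<one>\<^bsub>Z\<^esub> j] (mod P ^ j)" .
qed simp

lemma exists_multiple_if_cong_nat:
  fixes a b m :: nat
  assumes "[a = b] (mod m)"
  shows "\<exists>h. a + m * h = b \<or> b + m * h = a"
proof (cases "a \<le> b")
  case True
  then have "m dvd b - a" using cong_sym[OF assms] by (simp add: cong_altdef_nat)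
  then obtain h where "b - a = m * h" by (elim dvdE)
  with True have "a + m * h = b" by linarith
  then show ?thesis by blast
next
  case False
  then have "m dvd a - b" using assms by (simp add: cong_altdef_nat)
  then obtain h where "a - b = m * h" by (elim dvdE)
  with False have "b + m * h = a" by linarith
  then show ?thesis by blast
qed

text \<open>
  The \<open>p\<close>-adic interpolation of \<open>x \<mapsto> x ^ (x ^ n)\<close> along the numbers congruent to \<open>x0\<close> modulo \<open>p - 1\<close>.
\<close>

definition padic_step :: "nat \<Rightarrow> nat \<Rightarrow> (nat \<Rightarrow> int) \<Rightarrow> (nat \<Rightarrow> int)" where
  "padic_step n x0 x = teichmueller p x [^]\<^bsub>Z\<^esub> (x0 ^ n) \<otimes>\<^bsub>Z\<^esub> one_unit_power p x (x [^]\<^bsub>Z\<^esub> n)"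

lemma padic_step_component:
  assumes x: "x \<in> carrier Z" "x 1 \<noteq> 0"
    and k: "[int k = x e] (mod P ^ e)" "[k = x0] (mod p - 1)"
  shows "[int (k ^ (k ^ n)) = padic_step n x0 x e] (mod P ^ e)"
proof -
  define w where "w = teichmueller p x"
  define a where "a = one_unit_part p x"
  have xwa: "[x e = w e * a e] (mod P ^ e)"
    using Zp_mult[of w a e] teichmueller_decomposition[OF x] by (simp add: w_def a_def)
  obtain h where h: "k ^ n + (p - 1) * h = x0 ^ n \<or> x0 ^ n + (p - 1) * h = k ^ n"
    using exists_multiple_if_cong_nat[OF cong_pow[OF k(2)]] by blast
  have root: "[w e ^ (p - 1) = 1] (mod P ^ e)"
    unfolding w_def by (rule root_of_unity_component[OF teichmueller_root[OF x]])
  have pw: "[w e ^ (k ^ n) = w e ^ (x0 ^ n)] (mod P ^ e)"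
  proof -
    have "[w e ^ (i + (p - 1) * h) = w e ^ i] (mod P ^ e)" for i
      using cong_mult[OF cong_refl[of "w e ^ i"] cong_pow[OF root, of h]]
      by (simp add: power_add power_mult)
    then show ?thesis using h cong_sym by metis
  qed
  have "[int k ^ (k ^ n) = (w e * a e) ^ (k ^ n)] (mod P ^ e)"
    using cong_trans[OF k(1) xwa] by (rule cong_pow)
  also have "(w e * a e) ^ (k ^ n) = w e ^ (k ^ n) * a e ^ (k ^ n)" by (rule power_mult_distrib)
  also have "[w e ^ (k ^ n) * a e ^ (k ^ n)
      = (w [^]\<^bsub>Z\<^esub> (x0 ^ n)) e * one_unit_power p x (x [^]\<^bsub>Z\<^esub> n) e] (mod P ^ e)"
  proof (rule cong_mult)
    show "[w e ^ (k ^ n) = (w [^]\<^bsub>Z\<^esub> (x0 ^ n)) e] (mod P ^ e)"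
      by (rule cong_trans[OF pw cong_sym[OF Zp_pow[of w "x0 ^ n" e]]])
    have "[(x [^]\<^bsub>Z\<^esub> n) e = x e ^ n] (mod P ^ e)" by (rule Zp_pow)
    also have "[x e ^ n = int k ^ n] (mod P ^ e)" by (rule cong_pow[OF cong_sym[OF k(1)]])
    finally have "[(x [^]\<^bsub>Z\<^esub> n) e = int (k ^ n)] (mod P ^ e)" by simp
    then show "[a e ^ (k ^ n) = one_unit_power p x (x [^]\<^bsub>Z\<^esub> n) e] (mod P ^ e)"
      unfolding a_def using x by (intro cong_sym[OF one_unit_power_component]) auto
  qed
  also have "[(w [^]\<^bsub>Z\<^esub> (x0 ^ n)) e * one_unit_power p x (x [^]\<^bsub>Z\<^esub> n) e = padic_step n x0 x e] (mod P ^ e)"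
    unfolding padic_step_def w_def by (rule cong_sym[OF Zp_mult])
  finally show ?thesis by simp
qed

lemma padic_step_root:
  assumes x: "x \<in> carrier Z" "x 1 \<noteq> 0" "x [^]\<^bsub>Z\<^esub> (p - 1) = \<one>\<^bsub>Z\<^esub>"
  shows "padic_step n x0 x = x [^]\<^bsub>Z\<^esub> (x0 ^ n)"
  using x by (simp add: padic_step_def teichmueller_of_root one_unit_power_of_root)

text \<open>
  At precision \<open>e = 3 m\<close> a \<open>p\<close>-adic 2-cycle gives a 2-cycle of natural numbers modulo \<open>p\<^sup>e\<close>.  Its level
  is at least \<open>e/3 = m\<close>, so \<open>x\<^sup>p\<^sup>-\<^sup>1\<close> is 1 modulo \<open>p\<^sup>m\<close>, for every \<open>m\<close>.
\<close>

lemma padic_two_cycle_root_of_unity: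
  assumes n: "\<not> p dvd n" and x: "x \<in> carrier Z" "x 1 \<noteq> 0" and y: "y \<in> carrier Z" "y 1 \<noteq> 0"
    and xy: "padic_step n x0 x = y" and yx: "padic_step n y0 y = x"
  shows "x [^]\<^bsub>Z\<^esub> (p - 1) = \<one>\<^bsub>Z\<^esub>"
proof (rule Zp_eqI)
  fix m
  show "[(x [^]\<^bsub>Z\<^esub> (p - 1)) m = \<one>\<^bsub>Z\<^esub> m] (mod P ^ m)"
  proof (cases "m = 0")
    case False
    define e where "e = 3 * m"
    have e: "e \<ge> 1" using False by (simp add: e_def)
    have cop: "coprime (p ^ e) (p - 1)"
      using not_dvd_p_minus_1 coprime_p_iff by (metis coprime_commute int_dvd_int_iff)
    have pos: "p ^ e > 0" "p - 1 > 0" using p_ge_3 by auto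
    have lift: "\<exists>k > 0. [int k = z e] (mod P ^ e) \<and> [k = z0] (mod p - 1)"
      if "z \<in> carrier Z" for z z0
    proof -
      obtain k where "1 \<le> k" "[k = nat (z e)] (mod p ^ e)" "[k = z0] (mod p - 1)"
        using chinese_remainder_positive[OF cop pos, of "nat (z e)" z0] by blast
      moreover from this have "[int k = z e] (mod P ^ e)"
        using Zp_range[OF that, of e] cong_int_iff[of k "nat (z e)" "p ^ e"] by simp
      ultimately show ?thesis by (intro exI[of _ k]) auto
    qed
    obtain k where k: "k > 0" "[int k = x e] (mod P ^ e)" "[k = x0] (mod p - 1)"
      using lift[OF x(1)] by blast
    obtain l where l: "l > 0" "[int l = y e] (mod P ^ e)" "[l = y0] (mod p - 1)"
      using lift[OF y(1)] by blast
    have "[int k = x 1] (mod P)"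
    proof -
      have "[int k = x e] (mod P)" using k(2) e by (meson cong_dvd_modulus dvd_power less_le_trans zero_less_one)
      then show ?thesis using Zp_coherent[OF x(1), of 1 e] e cong_trans by auto
    qed
    then have nk: "\<not> p dvd k"
      using cong_dvd_iff[of "int k" "x 1" P] x Zp_component_eq_0_iff[OF x(1), of 1] by simp
    have "[int (k ^ (k ^ n)) = int l] (mod P ^ e)"
      using padic_step_component[OF x k(2,3), of n] l(2) unfolding xy by (blast intro: cong_trans cong_sym)
    then have kl: "[k ^ (k ^ n) = l] (mod p ^ e)" by (metis cong_int_iff of_nat_power)
    have "[int (l ^ (l ^ n)) = int k] (mod P ^ e)"
      using padic_step_component[OF y l(2,3), of n] k(2) unfolding yx by (blast intro: cong_trans cong_sym)
    then have lk: "[l ^ (l ^ n) = k] (mod p ^ e)" by (metis cong_int_iff of_nat_power)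
    have "P ^ defect_level n e k (k ^ n) dvd unit_defect (int k)"
      using two_cycle_iff[OF n e nk l(1) kl] lk by blast
    moreover have "m \<le> defect_level n e k (k ^ n)" by (auto simp: defect_level_def e_def)
    ultimately have "P ^ m dvd unit_defect (int k)" by (meson dvd_trans le_imp_power_dvd)
    moreover have "[int k = x m] (mod P ^ m)"
    proof -
      have "[int k = x e] (mod P ^ m)"
        using k(2) by (rule cong_dvd_modulus) (simp add: e_def le_imp_power_dvd)
      then show ?thesis using Zp_coherent[OF x(1), of m e] cong_trans by (auto simp: e_def)
    qed
    ultimately have "P ^ m dvd unit_defect (x m)"
      using cong_dvd_iff[OF unit_defect_cong] by blast
    then have "[x m ^ (p - 1) = 1] (mod P ^ m)" by (simp add: unit_defect_def cong_iff_dvd_diff)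
    then show ?thesis using Zp_pow Zp_one by (meson cong_sym cong_trans)
  qed simp
qed (use x in auto)

text \<open>
  On roots of unity the one-unit part is trivial, and a 2-cycle is a root of unity \<open>x\<close> with
  \<open>x ^ (a ^ n * b ^ n) = x\<close>, together with \<open>y = x ^ (a ^ n)\<close>.
  Such \<open>x\<close> are determined by their residue modulo \<open>p\<close>.
\<close>

lemma card_padic_two_cycles:
  assumes n: "n > 0" "\<not> p dvd n"
  shows "card {(x, y, x0, y0). x \<in> carrier Z \<and> y \<in> carrier Z \<and>
      x0 \<in> {1..p - 1} \<and> y0 \<in> {1..p - 1} \<and> \<not> p_dvd p x \<and> \<not> p_dvd p y \<and>
      padic_step n x0 x = y \<and> padic_step n y0 y = x}
    = (\<Sum>x0 = 1..p - 1. \<Sum>y0 = 1..p - 1. gcd (p - 1) (x0 ^ n * y0 ^ n - 1))"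
    (is "card ?S = _")
proof -
  define G where "G a b = {r \<in> {0<..<p}. ord p r dvd a ^ n * b ^ n - 1}" for a b
  define T where "T = (SIGMA a:{1..p - 1}. SIGMA b:{1..p - 1}. G a b)"
  define R :: "(nat \<Rightarrow> int) \<times> (nat \<Rightarrow> int) \<times> nat \<times> nat \<Rightarrow> nat \<times> nat \<times> nat \<Rightarrow> bool" where
    "R = (\<lambda>(x, y, x0, y0) (a, b, r). x0 = a \<and> y0 = b \<and> x 1 = int r)"
  have G_iff: "r \<in> G a b \<longleftrightarrow> r \<in> {0<..<p} \<and> [int r ^ (a ^ n * b ^ n) = int r] (mod P)"
    if "a \<ge> 1" "b \<ge> 1" for r a b
  proof -
    have "[int r ^ (a ^ n * b ^ n) = int r] (mod P) \<longleftrightarrow> [r ^ (a ^ n * b ^ n) = r] (mod p)"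
      by (metis cong_int_iff of_nat_power)
    moreover have "a ^ n * b ^ n \<ge> 1" using that by (simp add: Suc_le_eq)
    ultimately show ?thesis using power_eq_self_iff_ord by (auto simp: G_def)
  qed
  have S_iff: "(x, y, a, b) \<in> ?S \<longleftrightarrow> x \<in> carrier Z \<and> x 1 \<noteq> 0 \<and> x [^]\<^bsub>Z\<^esub> (p - 1) = \<one>\<^bsub>Z\<^esub> \<and>
      a \<in> {1..p - 1} \<and> b \<in> {1..p - 1} \<and> y = x [^]\<^bsub>Z\<^esub> (a ^ n) \<and> [x 1 ^ (a ^ n * b ^ n) = x 1] (mod P)"
    for x y a b
  proof
    assume "(x, y, a, b) \<in> ?S"
    then have s: "x \<in> carrier Z" "x 1 \<noteq> 0" "y \<in> carrier Z" "y 1 \<noteq> 0" "a \<in> {1..p - 1}" "b \<in> {1..p - 1}"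
      "padic_step n a x = y" "padic_step n b y = x"
      by (auto simp: p_dvd_iff)
    note rx = padic_two_cycle_root_of_unity[OF n(2) s(1-4,7,8)]
    note ry = padic_two_cycle_root_of_unity[OF n(2) s(3,4,1,2,8,7)]
    have y: "y = x [^]\<^bsub>Z\<^esub> (a ^ n)" using s rx padic_step_root by metis
    have "x = y [^]\<^bsub>Z\<^esub> (b ^ n)" using s ry padic_step_root by metis
    also have "\<dots> = x [^]\<^bsub>Z\<^esub> (a ^ n * b ^ n)" using s(1) by (simp add: y Zp.nat_pow_pow)
    finally have "[x 1 ^ (a ^ n * b ^ n) = x 1] (mod P)"
      using Zp_pow[of x "a ^ n * b ^ n" 1] by (simp add: cong_sym)
    with s rx y show "x \<in> carrier Z \<and> x 1 \<noteq> 0 \<and> x [^]\<^bsub>Z\<^esub> (p - 1) = \<one>\<^bsub>Z\<^esub> \<and>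
      a \<in> {1..p - 1} \<and> b \<in> {1..p - 1} \<and> y = x [^]\<^bsub>Z\<^esub> (a ^ n) \<and> [x 1 ^ (a ^ n * b ^ n) = x 1] (mod P)"
      by blast
  next
    assume s: "x \<in> carrier Z \<and> x 1 \<noteq> 0 \<and> x [^]\<^bsub>Z\<^esub> (p - 1) = \<one>\<^bsub>Z\<^esub> \<and>
      a \<in> {1..p - 1} \<and> b \<in> {1..p - 1} \<and> y = x [^]\<^bsub>Z\<^esub> (a ^ n) \<and> [x 1 ^ (a ^ n * b ^ n) = x 1] (mod P)"
    then have x: "x \<in> carrier Z" "x 1 \<noteq> 0" "x [^]\<^bsub>Z\<^esub> (p - 1) = \<one>\<^bsub>Z\<^esub>" and y: "y = x [^]\<^bsub>Z\<^esub> (a ^ n)" by auto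
    have root_pow: "(x [^]\<^bsub>Z\<^esub> i) [^]\<^bsub>Z\<^esub> (p - 1) = \<one>\<^bsub>Z\<^esub>" for i :: nat
    proof -
      have "(x [^]\<^bsub>Z\<^esub> i) [^]\<^bsub>Z\<^esub> (p - 1) = (x [^]\<^bsub>Z\<^esub> (p - 1)) [^]\<^bsub>Z\<^esub> i"
        using x(1) by (simp only: Zp.nat_pow_pow mult.commute)
      then show ?thesis by (simp only: x(3) Zp.nat_pow_one)
    qed
    have yc: "y \<in> carrier Z" using x y by simp
    have ry: "y [^]\<^bsub>Z\<^esub> (p - 1) = \<one>\<^bsub>Z\<^esub>" using root_pow y by simp
    have "\<not> P dvd x 1" using x Zp_component_eq_0_iff[OF x(1), of 1] by simp
    then have "\<not> P dvd x 1 ^ (a ^ n)" using dvd_power_P by blast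
    then have "\<not> P dvd y 1" using cong_dvd_iff[OF Zp_pow[of x "a ^ n" 1]] y by simp
    then have y1: "y 1 \<noteq> 0" by auto
    have "y [^]\<^bsub>Z\<^esub> (b ^ n) = x"
    proof (rule roots_of_unity_eqI[OF _ _ x(1,3) _ x(2)])
      have eq: "y [^]\<^bsub>Z\<^esub> (b ^ n) = x [^]\<^bsub>Z\<^esub> (a ^ n * b ^ n)" using x(1) by (simp add: y Zp.nat_pow_pow)
      show "y [^]\<^bsub>Z\<^esub> (b ^ n) \<in> carrier Z" using yc by simp
      show "(y [^]\<^bsub>Z\<^esub> (b ^ n)) [^]\<^bsub>Z\<^esub> (p - 1) = \<one>\<^bsub>Z\<^esub>" unfolding eq by (rule root_pow)
      have "[(y [^]\<^bsub>Z\<^esub> (b ^ n)) 1 = x 1] (mod P)"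
        unfolding eq using Zp_pow[of x "a ^ n * b ^ n" 1] s by (auto intro: cong_trans)
      then show "(y [^]\<^bsub>Z\<^esub> (b ^ n)) 1 = x 1"
        using Zp_range[OF \<open>y [^]\<^bsub>Z\<^esub> (b ^ n) \<in> carrier Z\<close>, of 1] Zp_range[OF x(1), of 1]
        by (simp add: cong_def)
    qed
    then show "(x, y, a, b) \<in> ?S"
      using s x y yc y1 padic_step_root[OF x] padic_step_root[OF yc y1 ry] by (simp add: p_dvd_iff)
  qed
  have "card ?S = card T"
  proof (rule card_eq_if_unique_relation[where R = R])
    fix s assume s: "s \<in> ?S"
    obtain x y a b where xyab: "s = (x, y, a, b)" by (cases s)
    from s have s': "x \<in> carrier Z" "x 1 \<noteq> 0" "a \<in> {1..p - 1}" "b \<in> {1..p - 1}"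
      "[x 1 ^ (a ^ n * b ^ n) = x 1] (mod P)"
      unfolding xyab S_iff by auto
    define r where "r = nat (x 1)"
    have r: "int r = x 1" "r \<in> {0<..<p}" using Zp_range[OF s'(1), of 1] s'(2) by (auto simp: r_def)
    then have "(a, b, r) \<in> T \<and> R s (a, b, r)"
      using s' G_iff by (simp add: T_def R_def xyab)
    moreover have "t = (a, b, r)" if "t \<in> T \<and> R s t" for t
      using that r by (cases t) (auto simp: R_def xyab)
    ultimately show "\<exists>!t. t \<in> T \<and> R s t" by blast
  next
    fix t assume "t \<in> T"
    then obtain a b r where t: "t = (a, b, r)" and ab: "a \<in> {1..p - 1}" "b \<in> {1..p - 1}" and r: "r \<in> G a b"
      by (auto simp: T_def)
    have r': "r \<in> {0<..<p}" "[int r ^ (a ^ n * b ^ n) = int r] (mod P)" using r G_iff ab by auto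
    obtain w where w: "w \<in> carrier Z" "w [^]\<^bsub>Z\<^esub> (p - 1) = \<one>\<^bsub>Z\<^esub>" "w 1 = int r"
      using root_of_unity_exists[OF r'(1)] by blast
    have "(w, w [^]\<^bsub>Z\<^esub> (a ^ n), a, b) \<in> ?S \<and> R (w, w [^]\<^bsub>Z\<^esub> (a ^ n), a, b) t"
      unfolding S_iff using w ab r' by (auto simp: R_def t)
    moreover have "s = (w, w [^]\<^bsub>Z\<^esub> (a ^ n), a, b)" if s: "s \<in> ?S \<and> R s t" for s
    proof -
      obtain x y a' b' where xy: "s = (x, y, a', b')" by (cases s)
      with s have *: "a' = a" "b' = b" "x 1 = int r" by (auto simp: R_def t)
      have "(x, y, a', b') \<in> ?S" using s xy by blast
      then have **: "x \<in> carrier Z" "x [^]\<^bsub>Z\<^esub> (p - 1) = \<one>\<^bsub>Z\<^esub>" "y = x [^]\<^bsub>Z\<^esub> (a ^ n)"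
        unfolding S_iff * by auto
      have "x 1 = w 1" "w 1 \<noteq> 0" unfolding *(3) w(3) using r'(1) by simp_all
      then have "x = w" by (rule roots_of_unity_eqI[OF **(1,2) w(1,2)])
      then show ?thesis by (simp only: xy *(1,2) **(3))
    qed
    ultimately show "\<exists>!s. s \<in> ?S \<and> R s t" by (rule ex1I)
  qed
  also have "\<dots> = (\<Sum>a = 1..p - 1. \<Sum>b = 1..p - 1. card (G a b))"
    unfolding T_def by (subst card_SigmaI; (intro finite_SigmaI sum.cong refl card_SigmaI ballI)?) (auto simp: G_def)
  finally show ?thesis by (simp only: G_def card_ord_dvd)
qed

end


section \<open>The counting formulas\<close>

theorem theorem17:
  fixes p n e :: nat
  assumes "Factorial_Ring.prime p" and "p \<noteq> 2" and "n > 0" and "\<not> p dvd n" and "e \<ge> 1"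
  shows
    "int (card {(x :: nat, y :: nat).
         1 \<le> x \<and> x \<le> p ^ e * (p - 1) \<and> 1 \<le> y \<and> y \<le> p ^ e * (p - 1) \<and>
         \<not> p dvd x \<and> \<not> p dvd y \<and>
         [x ^ (x ^ n) = y] (mod p ^ e) \<and> [y ^ (y ^ n) = x] (mod p ^ e)})
     = (\<Sum>x0 = 1..p - 1. \<Sum>y0 = 1..p - 1.
          gcd (int p - 1) (int x0 ^ n * int y0 ^ n - 1))
       + (\<Sum>x0 = 1..p - 1. \<Sum>y0 = 1..p - 1.
            gcd (int p - 1) (gcd (int n * (int y0 ^ n + 1)) (int x0 ^ n * int y0 ^ n - 1)))
         * (int p ^ (e div 2) - 1)
       + (\<Sum>x0 = 1..p - 1. \<Sum>y0 = 1..p - 1.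
            gcd (int p - 1) (gcd (2 * int n) (int x0 ^ n * int y0 ^ n - 1))
            - gcd (int p - 1) (gcd (int n) (int x0 ^ n * int y0 ^ n - 1)))
         * (int p ^ (e div 3 + (e + 1) div 3) - int p ^ (e div 2))
     \<and>
     (\<Sum>x0 = 1..p - 1. \<Sum>y0 = 1..p - 1.
          gcd (int p - 1) (int x0 ^ n * int y0 ^ n - 1))
       + (\<Sum>x0 = 1..p - 1. \<Sum>y0 = 1..p - 1.
            gcd (int p - 1) (gcd (int n * (int y0 ^ n + 1)) (int x0 ^ n * int y0 ^ n - 1)))
         * (int p ^ (e div 2) - 1)
       + (\<Sum>x0 = 1..p - 1. \<Sum>y0 = 1..p - 1.
            gcd (int p - 1) (gcd (2 * int n) (int x0 ^ n * int y0 ^ n - 1))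
            - gcd (int p - 1) (gcd (int n) (int x0 ^ n * int y0 ^ n - 1)))
         * (int p ^ (e div 3 + (e + 1) div 3) - int p ^ (e div 2))
     = (\<Sum>d | d dvd p - 1.
          int (totient d) ^ 2 * int ((p - 1) div d) ^ 2
          * int (num_roots_mod (\<lambda>z. z ^ n - 1) d))
       + (\<Sum>d | d dvd p - 1.
            int (totient d) * int ((p - 1) div d) ^ 2
            * int (num_unit_roots_mod (\<lambda>z. int n * (z ^ n + 1)) d)
            * int (num_roots_mod (\<lambda>z. z ^ n - 1) d))
         * (int p ^ (e div 2) - 1)
       + (\<Sum>d | d dvd gcd (p - 1) (2 * n) \<and> \<not> d dvd gcd (p - 1) n.
            int (totient d) ^ 2 * int ((p - 1) div d) ^ 2
            * int (num_roots_mod (\<lambda>z. z ^ n - 1) d))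
         * (int p ^ (e div 3 + (e + 1) div 3) - int p ^ (e div 2))
     \<and>
     int (card {(x, y, x0 :: nat, y0 :: nat).
         x \<in> carrier (Zp p) \<and> y \<in> carrier (Zp p) \<and>
         x0 \<in> {1..p - 1} \<and> y0 \<in> {1..p - 1} \<and>
         \<not> p_dvd p x \<and> \<not> p_dvd p y \<and>
         teichmueller p x [^]\<^bsub>Zp p\<^esub> (x0 ^ n)
           \<otimes>\<^bsub>Zp p\<^esub> one_unit_power p x (x [^]\<^bsub>Zp p\<^esub> n) = y \<and>
         teichmueller p y [^]\<^bsub>Zp p\<^esub> (y0 ^ n)
           \<otimes>\<^bsub>Zp p\<^esub> one_unit_power p y (y [^]\<^bsub>Zp p\<^esub> n) = x})
     = (\<Sum>x0 = 1..p - 1. \<Sum>y0 = 1..p - 1.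
          gcd (int p - 1) (int x0 ^ n * int y0 ^ n - 1))
     \<and>
     (\<Sum>x0 = 1..p - 1. \<Sum>y0 = 1..p - 1.
          gcd (int p - 1) (int x0 ^ n * int y0 ^ n - 1))
     = (\<Sum>d | d dvd p - 1.
          int (totient d) ^ 2 * int ((p - 1) div d) ^ 2
          * int (num_roots_mod (\<lambda>z. z ^ n - 1) d))"
proof -
  interpret odd_prime p using assms(1,2) by unfold_locales
  define m where "m = p - 1"
  have m: "m > 0" "int p - 1 = int m" using p_ge_3 by (auto simp: m_def of_nat_diff)
  \<comment> \<open>C 0 is A, as gcd ignores 0; so both A and C are divisor sums of the same shape.\<close>
  define A where "A = (\<Sum>a = 1..m. \<Sum>b = 1..m. gcd (int m) (int a ^ n * int b ^ n - 1))"
  define B where "B = (\<Sum>a = 1..m. \<Sum>b = 1..m.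
    gcd (int m) (gcd (int n * (int b ^ n + 1)) (int a ^ n * int b ^ n - 1)))"
  define C where "C c = (\<Sum>a = 1..m. \<Sum>b = 1..m.
    gcd (int m) (gcd (int c) (int a ^ n * int b ^ n - 1)))" for c :: nat
  define q where "q = int p ^ (e div 2)"
  define q' where "q' = int p ^ (e div 3 + (e + 1) div 3)"
  define X where "X d = int (totient d) ^ 2 * int (m div d) ^ 2 * int (num_roots_mod (\<lambda>z. z ^ n - 1) d)" for d
  have diff: "int (a ^ n * b ^ n - 1) = int a ^ n * int b ^ n - 1" if "a \<ge> 1" "b \<ge> 1" for a b
    using that by (simp add: of_nat_diff Suc_le_eq)

  have A_sum: "A = (\<Sum>d | d dvd m. X d)"
    using sum_gcd_const_eq_divisor_sum[OF m(1) assms(3), of 0] by (simp add: A_def X_def)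
  have C_sum: "C c = (\<Sum>d | d dvd gcd m c. X d)" for c
    unfolding C_def X_def by (rule sum_gcd_const_eq_divisor_sum[OF m(1) assms(3)])
  have B_sum: "B = (\<Sum>d | d dvd m. int (totient d) * int (m div d) ^ 2
      * int (num_unit_roots_mod (\<lambda>z. int n * (z ^ n + 1)) d)
      * int (num_roots_mod (\<lambda>z. z ^ n - 1) d))"
    unfolding B_def num_unit_roots_mod_nat
  proof (rule sum_gcd_eq_divisor_sum[OF m(1) assms(3)])
    fix d b b' :: nat assume "[b = b'] (mod d)"
    then have "[int n * (int b ^ n + 1) = int n * (int b' ^ n + 1)] (mod int d)"
      by (intro cong_mult cong_add cong_pow cong_refl) (simp add: cong_int_iff)
    then show "int d dvd int n * (int b ^ n + 1) \<longleftrightarrow> int d dvd int n * (int b' ^ n + 1)"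
      by (rule cong_dvd_iff)
  qed
  have C_diff: "C (2 * n) - C n = (\<Sum>d | d dvd gcd m (2 * n) \<and> \<not> d dvd gcd m n. X d)"
  proof -
    have "{d. d dvd gcd m (2 * n) \<and> \<not> d dvd gcd m n} = {d. d dvd gcd m (2 * n)} - {d. d dvd gcd m n}"
      by blast
    moreover have "{d. d dvd gcd m n} \<subseteq> {d. d dvd gcd m (2 * n)}" by auto
    moreover have "finite {d. d dvd gcd m (2 * n)}" using m(1) by (simp add: finite_divisors_nat)
    ultimately show ?thesis by (simp only: C_sum sum_diff)
  qed
  have C_diff': "(\<Sum>a = 1..m. \<Sum>b = 1..m. gcd (int m) (gcd (2 * int n) (int a ^ n * int b ^ n - 1))
      - gcd (int m) (gcd (int n) (int a ^ n * int b ^ n - 1))) = C (2 * n) - C n"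
    by (simp add: C_def sum_subtractf)

  have "int (\<Sum>a = 1..m. \<Sum>b = 1..m. card (two_cycle_residues n e a b))
      = (\<Sum>a = 1..m. \<Sum>b = 1..m. gcd (int m) (int a ^ n * int b ^ n - 1)
          + gcd (int m) (gcd (int n * (int a ^ n + 1)) (int a ^ n * int b ^ n - 1)) * (q - 1)
          + (gcd (int m) (gcd (int (2 * n)) (int a ^ n * int b ^ n - 1))
             - gcd (int m) (gcd (int n) (int a ^ n * int b ^ n - 1))) * (q' - q))"
    unfolding of_nat_sum
  proof (intro sum.cong refl)
    fix a b assume "a \<in> {1..m}" "b \<in> {1..m}"
    then have ab: "a \<ge> 1" "b \<ge> 1" by auto
    show "int (card (two_cycle_residues n e a b)) = gcd (int m) (int a ^ n * int b ^ n - 1)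
          + gcd (int m) (gcd (int n * (int a ^ n + 1)) (int a ^ n * int b ^ n - 1)) * (q - 1)
          + (gcd (int m) (gcd (int (2 * n)) (int a ^ n * int b ^ n - 1))
             - gcd (int m) (gcd (int n) (int a ^ n * int b ^ n - 1))) * (q' - q)"
      using card_two_cycle_residues[OF assms(3-5) ab] diff[OF ab]
      by (simp add: m_def q_def q'_def distrib_left add.commute flip: gcd_int_int_eq)
  qed
  also have "\<dots> = A + (\<Sum>a = 1..m. \<Sum>b = 1..m.
      gcd (int m) (gcd (int n * (int a ^ n + 1)) (int a ^ n * int b ^ n - 1))) * (q - 1)
      + (C (2 * n) - C n) * (q' - q)"
    by (simp only: A_def C_def sum.distrib sum_subtractf sum_distrib_right left_diff_distrib)
  \<comment> \<open>The residue of x enters the local count, that of y the formula; the sum is symmetric.\<close>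
  also have "(\<Sum>a = 1..m. \<Sum>b = 1..m.
      gcd (int m) (gcd (int n * (int a ^ n + 1)) (int a ^ n * int b ^ n - 1))) = B"
    unfolding B_def by (subst sum.swap) (simp only: mult.commute)
  finally have count: "int (\<Sum>a = 1..m. \<Sum>b = 1..m. card (two_cycle_residues n e a b))
      = A + B * (q - 1) + (C (2 * n) - C n) * (q' - q)" .
  have padic: "int (\<Sum>a = 1..m. \<Sum>b = 1..m. gcd (p - 1) (a ^ n * b ^ n - 1)) = A"
    unfolding of_nat_sum A_def
    by (intro sum.cong refl) (simp add: m_def diff gcd_int_int_eq[symmetric] del: gcd_int_int_eq)
  show ?thesis
    unfolding card_two_cycles_eq_sum[OF assms(4,5)]
      card_padic_two_cycles[OF assms(3,4), unfolded padic_step_def]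
    unfolding m(2) m_def[symmetric] q_def[symmetric] q'_def[symmetric] A_def[symmetric] B_def[symmetric]
      C_diff' C_diff[symmetric] X_def[symmetric] A_sum[symmetric] B_sum[symmetric] count
    using padic by (simp add: m_def)
qed

end
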